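(* Let $(\Omega,\mathcal F,\mathbb P)$ be a non-atomic probability space, let $\Sigma$ be the collection of all sub-$\sigma$-algebras of $\mathcal F$, and let $\{\mathcal E_{\mathcal G}\}_{\mathcal G\in\Sigma}$ be a family of maps $\mathcal E_{\mathcal G}:L^\infty(\Omega,\mathcal F,\mathbb P)\to L^\infty(\Omega,\mathcal G,\mathbb P)$. Then the following are equivalent: (a) $\{\mathcal E_{\mathcal G}\}_{\mathcal G\in\Sigma}$ is a time consistent family of conditional nonlinear expectations and $\mathcal E_0$ is strictly monotone on dichotomic random variables and pointwise continuous (both notions as defined in the context); (b) there exists a function $\mathbb u:\Omega\times\mathbb R\to\mathbb R$ which is $\mathcal F$-regular and such that $\mathbb u(\cdot,x)$ is $\mathbb P$-integrable for every $x\in\mathbb R$, and for every $\mathcal G\in\Sigma$ there is a $\mathcal G$-regular function $\mathbb u_{\mathcal G}$ such that, for every $x\in\mathbb R$, $\mathbb u_{\mathcal G}(\cdot,x)$ is $\mathbb P$-integrable and is a version of $\mathbb E_{\mathbb P}[\mathbb u(\cdot,x)\mid\mathcal G]$, and such that for every $X\in L^\infty(\Omega,\mathcal F,\mathbb P)$ $$\mathcal E_{\mathcal G}(X)=\mathbb u_{\mathcal G}^{-1}\big(\mathbb E_{\mathbb P}[\mathbb u(X)\mid \mathcal G]\big).$$ Here $\mathbb u_{\mathcal G}^{-1}(\mathbb E_{\mathbb P}[\mathbb u(X)\mid\mathcal G])$ denotes the $\mathbb P$-equivalence class of $\omega\mapsto\Phi_{\mathcal G}(\omega,h(\omega))$,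 where $f$ is any representative of $X$, $h$ is a version of $\mathbb E_{\mathbb P}[\mathbb u(\cdot,f(\cdot))\mid\mathcal G]$ with $h(\omega)\in\{\mathbb u_{\mathcal G}(\omega,y):y\in\mathbb R\}$ for every $\omega$ (such a version exists, and the resulting class does not depend on the choices), and $\Phi_{\mathcal G}(\omega,x):=\inf\{y\in\mathbb R:\mathbb u_{\mathcal G}(\omega,y)>x\}$.
   Context: $L^\infty(\Omega,\mathcal G,\mathbb P)$ is the space of $\mathbb P$-a.s. equivalence classes of bounded $\mathcal G$-measurable real random variables. $\mathcal E_0$ denotes $\mathcal E_{\mathcal G}$ for the trivial $\sigma$-algebra $\mathcal G=\{\varnothing,\Omega\}$ (so $\mathcal E_0$ is real-valued). A map $\mathcal E_{\mathcal G}$ is a conditional nonlinear expectation if $\mathcal E_{\mathcal G}(X1_A)=\mathcal E_{\mathcal G}(X)1_A$ for all $X\in L^\infty(\Omega,\mathcal F,\mathbb P)$ and $A\in\mathcal G$. The family is time consistent if $\mathcal E_0(\mathcal E_{\mathcal G}(X))=\mathcal E_0(X)$ for all $\mathcal G\in\Sigma$ and all $X$. $\mathcal E_0$ is strictly monotone on dichotomic random variables if for all $x<y$ in $\mathbb R$, $Z\in L^\infty(\Omega,\mathcal F,\mathbb P)$ and $A\in\mathcal F$ with $\mathbb P(A)>0$: $\mathcal E_0(x1_A+Z1_{A^c})<\mathcal E_0(y1_A+Z1_{A^c})$. $\mathcal E_0$ is pointwise continuous if $\mathcal E_0(X_n)\to\mathcal E_0(X)$ for every uniformly bounded sequence $X_n$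 converging $\mathbb P$-a.s. to $X$. For a sub-$\sigma$-algebra $\mathcal G\subseteq\mathcal F$, a function $\varphi:\Omega\times\mathbb R\to\mathbb R$ is $\mathcal G$-regular if $\varphi(\omega,\cdot)$ is continuous and strictly increasing on $\mathbb R$ for every $\omega$, $\varphi(\omega,0)=0$ for every $\omega$, and $\varphi$ is $\mathcal G\otimes\mathcal B_{\mathbb R}$-measurable. *)

theory Defs
  imports "HOL-Probability.Probability"
begin

definition nonatomic :: "'a measure \<Rightarrow> bool" where
  "nonatomic M \<longleftrightarrow> (\<forall>A\<in>sets M. 0 < measure M A \<longrightarrow>
      (\<exists>B\<in>sets M. B \<subseteq> A \<and> 0 < measure M B \<and> measure M B < measure M A))"

definition subsigma :: "'a measure \<Rightarrow> 'a set set \<Rightarrow> bool" where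
  "subsigma M G \<longleftrightarrow> sigma_algebra (space M) G \<and> G \<subseteq> sets M"

definition msp :: "'a measure \<Rightarrow> 'a set set \<Rightarrow> 'a measure" where
  "msp M G = sigma (space M) G"

(* representatives of elements of L^infty(Omega, G, P): bounded G-measurable real functions *)
definition Linf :: "'a measure \<Rightarrow> 'a set set \<Rightarrow> ('a \<Rightarrow> real) \<Rightarrow> bool" where
  "Linf M G f \<longleftrightarrow> f \<in> borel_measurable (msp M G) \<and> (\<exists>C. \<forall>\<omega>\<in>space M. \<bar>f \<omega>\<bar> \<le> C)"

definition triv :: "'a measure \<Rightarrow> 'a set set" where
  "triv M = {{}, space M}"

(* E_0 as a real number: E_{triv}(X) is constant on Omega; evaluate it at some point *)
definition E0 :: "'a measure \<Rightarrow> ('a set set \<Rightarrow> ('a \<Rightarrow> real) \<Rightarrow> 'a \<Rightarrow> real) \<Rightarrow> ('a \<Rightarrow> real) \<Rightarrow> real" where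
  "E0 M E X = E (triv M) X (SOME \<omega>. \<omega> \<in> space M)"

definition cond_nonlin_exp :: "'a measure \<Rightarrow> ('a set set \<Rightarrow> ('a \<Rightarrow> real) \<Rightarrow> 'a \<Rightarrow> real) \<Rightarrow> bool" where
  "cond_nonlin_exp M E \<longleftrightarrow> (\<forall>G X A. subsigma M G \<longrightarrow> Linf M (sets M) X \<longrightarrow> A \<in> G \<longrightarrow>
      (AE \<omega> in M. E G (\<lambda>\<omega>. X \<omega> * indicator A \<omega>) \<omega> = E G X \<omega> * indicator A \<omega>))"

definition time_consistent :: "'a measure \<Rightarrow> ('a set set \<Rightarrow> ('a \<Rightarrow> real) \<Rightarrow> 'a \<Rightarrow> real) \<Rightarrow> bool" where
  "time_consistent M E \<longleftrightarrow> (\<forall>G X. subsigma M G \<longrightarrow> Linf M (sets M) X \<longrightarrow>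
      E0 M E (E G X) = E0 M E X)"

definition strictly_monotone_dichotomic :: "'a measure \<Rightarrow> (('a \<Rightarrow> real) \<Rightarrow> real) \<Rightarrow> bool" where
  "strictly_monotone_dichotomic M e \<longleftrightarrow> (\<forall>x y Z A. x < y \<longrightarrow> Linf M (sets M) Z \<longrightarrow>
      A \<in> sets M \<longrightarrow> 0 < measure M A \<longrightarrow>
      e (\<lambda>\<omega>. x * indicator A \<omega> + Z \<omega> * indicator (space M - A) \<omega>)
      < e (\<lambda>\<omega>. y * indicator A \<omega> + Z \<omega> * indicator (space M - A) \<omega>))"

definition pointwise_continuous :: "'a measure \<Rightarrow> (('a \<Rightarrow> real) \<Rightarrow> real) \<Rightarrow> bool" where
  "pointwise_continuous M e \<longleftrightarrow> (\<forall>Xs X. (\<forall>n. Linf M (sets M) (Xs n)) \<longrightarrow> Linf M (sets M) X \<longrightarrow>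
      (\<exists>C. \<forall>n. \<forall>\<omega>\<in>space M. \<bar>Xs n \<omega>\<bar> \<le> C) \<longrightarrow>
      (AE \<omega> in M. (\<lambda>n. Xs n \<omega>) \<longlonglongrightarrow> X \<omega>) \<longrightarrow>
      (\<lambda>n. e (Xs n)) \<longlonglongrightarrow> e X)"

definition regular :: "'a measure \<Rightarrow> 'a set set \<Rightarrow> ('a \<Rightarrow> real \<Rightarrow> real) \<Rightarrow> bool" where
  "regular M G \<phi> \<longleftrightarrow>
     (\<forall>\<omega>\<in>space M. continuous_on UNIV (\<phi> \<omega>) \<and> strict_mono (\<phi> \<omega>) \<and> \<phi> \<omega> 0 = 0) \<and>
     (\<lambda>(\<omega>, x). \<phi> \<omega> x) \<in> borel_measurable (msp M G \<Otimes>\<^sub>M borel)"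

definition cond_exp_version :: "'a measure \<Rightarrow> 'a set set \<Rightarrow> ('a \<Rightarrow> real) \<Rightarrow> ('a \<Rightarrow> real) \<Rightarrow> bool" where
  "cond_exp_version M G f h \<longleftrightarrow> h \<in> borel_measurable (msp M G) \<and>
     (AE \<omega> in M. h \<omega> = real_cond_exp M (msp M G) f \<omega>)"

definition Phi :: "('a \<Rightarrow> real \<Rightarrow> real) \<Rightarrow> 'a \<Rightarrow> real \<Rightarrow> real" where
  "Phi uG \<omega> x = Inf {y. uG \<omega> y > x}"

end

theory Submission
  imports Defs
begin

text \<open>
  Conditioning on \<open>{\<emptyset>, A, \<Omega> - A, \<Omega>}\<close> together with time consistency and strict monotonicity gives
  Savage's sure-thing principle for \<open>\<E>\<^sub>0\<close>. For fixed \<open>K\<close>, the comparison of the bets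
  \<open>K\<close> on \<open>A\<close>, \<open>-K\<close> off \<open>A\<close> is then a qualitative probability on a nonatomic space, which dyadic
  equipartitions turn into a finitely additive measure. Every \<open>X\<close> with values in \<open>[-K, K]\<close> is
  indifferent to such a bet, and the measure of the corresponding event is a value \<open>V X\<close> that
  represents \<open>\<E>\<^sub>0\<close> ordinally and is additive over disjoint events; the affine uniqueness of \<open>V\<close>
  removes the dependence on \<open>K\<close>.

  For every sub-\<open>\<sigma>\<close>-algebra \<open>G\<close>, the Radon-Nikodym densities on \<open>G\<close> of \<open>A \<mapsto> V (x 1\<^sub>A)\<close>, regularised
  in \<open>x\<close>, form a \<open>G\<close>-regular \<open>u\<^sub>G\<close> with \<open>V X = E[u\<^sub>G(X)]\<close> for all bounded \<open>G\<close>-measurable \<open>X\<close>. Since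
  \<open>V (\<E>\<^sub>G(X) 1\<^sub>A) = V (X 1\<^sub>A)\<close> for \<open>A \<in> G\<close>, the variable \<open>u\<^sub>G(\<E>\<^sub>G(X))\<close> is a version of \<open>E[u(X) | G]\<close>.
\<close>

section \<open>Additive functionals on bounded random variables\<close>

text \<open>Strict monotonicity is assumed for constants on one event, so monotonicity of E_0 on all
  bounded variables has to be recovered first, through finitely valued variables. It brackets X
  between the constants -K and K, and nonatomicity then yields a bet indifferent to X; an unbounded
  range would have no extreme constants, hence the fixed K. The second obstacle is that a
  Radon-Nikodym density exists for one x at a time, up to a null set. Monotonicity in x survives on
  the rationals. A jump in x, however, may sit at a place depending on \<omega>, which continuity of
  V along constants does not see; V has to be evaluated at random variables that follow the jump. V
  is built once on the nonatomic space and then restricted to G, which may have atoms. The density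
  theorem applied to each restriction gives u_G directly, and u and u_G are linked by representing
  the same V on G. The converse rests on one identity: E[u(E_G(X)) 1_A] = E[u(X) 1_A] for A in
  G.\<close>

definition bounded_measurable :: "'a measure \<Rightarrow> ('a \<Rightarrow> real) \<Rightarrow> bool" where
  "bounded_measurable N X \<longleftrightarrow> X \<in> borel_measurable N \<and> (\<exists>C. \<forall>\<omega>\<in>space N. \<bar>X \<omega>\<bar> \<le> C)"

text \<open>Off the space it equals Z, where the indicator form would be 0, so identities such as
  \<open>mix A X X = X\<close> hold as equations between functions.\<close>

definition mix :: "'a set \<Rightarrow> ('a \<Rightarrow> real) \<Rightarrow> ('a \<Rightarrow> real) \<Rightarrow> 'a \<Rightarrow> real" where
  "mix A X Z = (\<lambda>\<omega>. if \<omega> \<in> A then X \<omega> else Z \<omega>)"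

text \<open>The grids are nested, so the rounded values increase to x with n; on bounded variables
  the range is finite; and the values are rational, so that countably many densities suffice
  later.\<close>

definition dyadic_floor :: "nat \<Rightarrow> real \<Rightarrow> real" where
  "dyadic_floor n x = of_int \<lfloor>2 ^ n * x\<rfloor> / 2 ^ n"

lemma bounded_measurable_const [simp]: "bounded_measurable N (\<lambda>_. c)"
  by (auto simp: bounded_measurable_def)

lemma bounded_measurable_mix:
  assumes "bounded_measurable N X" "bounded_measurable N Z" "A \<in> sets N"
  shows "bounded_measurable N (mix A X Z)"
proof -
  have [measurable]: "X \<in> borel_measurable N" "Z \<in> borel_measurable N" "A \<in> sets N"
    using assms by (auto simp: bounded_measurable_def)
  obtain C D where "\<forall>\<omega>\<in>space N. \<bar>X \<omega>\<bar> \<le> C" "\<forall>\<omega>\<in>space N. \<bar>Z \<omega>\<bar> \<le> D"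
    using assms by (auto simp: bounded_measurable_def)
  then have "\<forall>\<omega>\<in>space N. \<bar>mix A X Z \<omega>\<bar> \<le> max C D"
    by (auto simp: mix_def le_max_iff_disj)
  moreover have "mix A X Z \<in> borel_measurable N"
    unfolding mix_def by measurable
  ultimately show ?thesis by (auto simp: bounded_measurable_def)
qed

lemma dyadic_floor_le: "dyadic_floor n x \<le> x"
proof -
  have "of_int \<lfloor>2 ^ n * x\<rfloor> \<le> 2 ^ n * x" by simp
  then show ?thesis by (simp add: dyadic_floor_def divide_le_eq mult.commute)
qed

lemma dyadic_floor_gt: "x - 1 / 2 ^ n < dyadic_floor n x"
proof -
  have "2 ^ n * x - 1 < of_int \<lfloor>2 ^ n * x\<rfloor>" by linarith
  then have "(2 ^ n * x - 1) / 2 ^ n < of_int \<lfloor>2 ^ n * x\<rfloor> / 2 ^ n"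
    by (rule divide_strict_right_mono) simp
  then show ?thesis by (simp add: dyadic_floor_def diff_divide_distrib)
qed

lemma dyadic_floor_mono: "x \<le> y \<Longrightarrow> dyadic_floor n x \<le> dyadic_floor n y"
  by (auto simp: dyadic_floor_def intro!: divide_right_mono floor_mono)

lemma dyadic_floor_Rats [simp]: "dyadic_floor n x \<in> \<rat>"
  by (simp add: dyadic_floor_def)

lemma dyadic_floor_zero [simp]: "dyadic_floor n 0 = 0"
  by (simp add: dyadic_floor_def)

lemma dyadic_floor_tendsto: "(\<lambda>n. dyadic_floor n x) \<longlonglongrightarrow> x"
proof (rule tendsto_sandwich)
  show "\<forall>\<^sub>F n in sequentially. x - 1 / 2 ^ n \<le> dyadic_floor n x"
    using dyadic_floor_gt less_imp_le by (intro always_eventually allI) blast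
  show "\<forall>\<^sub>F n in sequentially. dyadic_floor n x \<le> x"
    by (simp add: dyadic_floor_le)
  have "(\<lambda>n. x - (1 / 2) ^ n) \<longlonglongrightarrow> x - 0"
    by (intro tendsto_intros LIMSEQ_power_zero) simp
  then show "(\<lambda>n. x - 1 / 2 ^ n) \<longlonglongrightarrow> x" by (simp add: power_one_over)
qed simp

lemma dyadic_floor_of_dyadic:
  assumes "m \<le> n" shows "dyadic_floor n (of_int i / 2 ^ m) = of_int i / 2 ^ m"
proof -
  obtain k where n: "n = m + k" using assms le_Suc_ex by blast
  have "2 ^ n * (of_int i / 2 ^ m) = (of_int (2 ^ k * i) :: real)"
    by (simp add: n power_add)
  then have "\<lfloor>2 ^ n * (of_int i / 2 ^ m :: real)\<rfloor> = 2 ^ k * i" by (metis floor_of_int)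
  then show ?thesis by (simp add: dyadic_floor_def n power_add)
qed

lemma dyadic_floor_idem: "m \<le> n \<Longrightarrow> dyadic_floor n (dyadic_floor m x) = dyadic_floor m x"
  unfolding dyadic_floor_def[of m x] by (rule dyadic_floor_of_dyadic)

lemma dyadic_floor_incseq: "incseq (\<lambda>n. dyadic_floor n x)"
proof (rule incseq_SucI)
  fix n
  have "dyadic_floor (Suc n) (dyadic_floor n x) \<le> dyadic_floor (Suc n) x"
    by (intro dyadic_floor_mono dyadic_floor_le)
  then show "dyadic_floor n x \<le> dyadic_floor (Suc n) x"
    by (simp add: dyadic_floor_idem)
qed

lemma dyadic_floor_abs_le: "\<bar>x\<bar> \<le> C \<Longrightarrow> \<bar>dyadic_floor n x\<bar> \<le> C + 1"
proof -
  assume a: "\<bar>x\<bar> \<le> C"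
  have "1 / 2 ^ n \<le> (1::real)" by simp
  then show ?thesis using a dyadic_floor_le[of n x] dyadic_floor_gt[of x n] by linarith
qed

lemma borel_measurable_dyadic_floor [measurable]: "dyadic_floor n \<in> borel_measurable borel"
  unfolding dyadic_floor_def by measurable

lemma bounded_measurable_dyadic_floor:
  assumes "bounded_measurable N X" shows "bounded_measurable N (\<lambda>\<omega>. dyadic_floor n (X \<omega>))"
proof -
  obtain C where "\<forall>\<omega>\<in>space N. \<bar>X \<omega>\<bar> \<le> C" and [measurable]: "X \<in> borel_measurable N"
    using assms by (auto simp: bounded_measurable_def)
  then have "\<forall>\<omega>\<in>space N. \<bar>dyadic_floor n (X \<omega>)\<bar> \<le> C + 1"
    by (auto intro: dyadic_floor_abs_le)
  then show ?thesis by (auto simp: bounded_measurable_def)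
qed

lemma finite_range_dyadic_floor:
  assumes "bounded_measurable N X"
  shows "finite ((\<lambda>\<omega>. dyadic_floor n (X \<omega>)) ` space N)"
proof -
  obtain C where C: "\<forall>\<omega>\<in>space N. \<bar>X \<omega>\<bar> \<le> C"
    using assms by (auto simp: bounded_measurable_def)
  have "(\<lambda>\<omega>. dyadic_floor n (X \<omega>)) ` space N
      \<subseteq> (\<lambda>i. of_int i / 2 ^ n) ` {\<lfloor>2 ^ n * (- C)\<rfloor> .. \<lfloor>2 ^ n * C\<rfloor>}"
  proof (intro subsetI, elim imageE)
    fix y \<omega> assume y: "y = dyadic_floor n (X \<omega>)" and "\<omega> \<in> space N"
    then have "\<bar>X \<omega>\<bar> \<le> C" using C by blast
    then have "- C \<le> X \<omega>" "X \<omega> \<le> C" by linarith+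
    then have "\<lfloor>2 ^ n * X \<omega>\<rfloor> \<in> {\<lfloor>2 ^ n * (- C)\<rfloor> .. \<lfloor>2 ^ n * C\<rfloor>}"
      by (simp only: atLeastAtMost_iff) (intro conjI floor_mono mult_left_mono; simp)
    then show "y \<in> (\<lambda>i. of_int i / 2 ^ n) ` {\<lfloor>2 ^ n * (- C)\<rfloor> .. \<lfloor>2 ^ n * C\<rfloor>}"
      unfolding y dyadic_floor_def by (rule imageI)
  qed
  then show ?thesis by (rule finite_subset) simp
qed

text \<open>The model is X |-> E[u(X)], which is additive when X is split along an event but not
  linear in X.\<close>

locale additive_functional =
  fixes N :: "'a measure" and V :: "('a \<Rightarrow> real) \<Rightarrow> real"
  assumes additive: "bounded_measurable N X \<Longrightarrow> A \<in> sets N \<Longrightarrow>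
      V X = V (mix A X (\<lambda>_. 0)) + V (mix A (\<lambda>_. 0) X)"
    and continuous: "(\<And>n. bounded_measurable N (Xs n)) \<Longrightarrow> bounded_measurable N X \<Longrightarrow>
      (\<And>n \<omega>. \<omega> \<in> space N \<Longrightarrow> \<bar>Xs n \<omega>\<bar> \<le> C) \<Longrightarrow>
      (\<And>\<omega>. \<omega> \<in> space N \<Longrightarrow> (\<lambda>n. Xs n \<omega>) \<longlonglongrightarrow> X \<omega>) \<Longrightarrow> (\<lambda>n. V (Xs n)) \<longlonglongrightarrow> V X"
begin

lemma zero [simp]: "V (\<lambda>_. 0) = 0"
  using additive[of "\<lambda>_. 0" "{}"] by (simp add: mix_def)

text \<open>Continuity applied to the constant sequence X, which converges to Y at every point of
  the space.\<close>

lemma cong_space: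
  assumes "bounded_measurable N X" "bounded_measurable N Y" "\<And>\<omega>. \<omega> \<in> space N \<Longrightarrow> X \<omega> = Y \<omega>"
  shows "V X = V Y"
proof -
  obtain C where "\<forall>\<omega>\<in>space N. \<bar>X \<omega>\<bar> \<le> C"
    using assms by (auto simp: bounded_measurable_def)
  then have "(\<lambda>n::nat. V X) \<longlonglongrightarrow> V Y"
    using assms by (intro continuous[where C = C]) auto
  then show ?thesis by (simp add: LIMSEQ_const_iff)
qed

lemma finite_range_sum:
  assumes X: "bounded_measurable N X" and fin: "finite (X ` space N)"
  shows "V X = (\<Sum>r\<in>X ` space N. V (mix {\<omega>\<in>space N. X \<omega> = r} (\<lambda>_. r) (\<lambda>_. 0)))"
proof -
  have [measurable]: "X \<in> borel_measurable N" using X by (simp add: bounded_measurable_def)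
  let ?M = "\<lambda>S. mix {\<omega>\<in>space N. X \<omega> \<in> S} X (\<lambda>_. 0)"
  have meas: "{\<omega>\<in>space N. X \<omega> \<in> S} \<in> sets N" if "finite S" for S
  proof -
    have "{\<omega>\<in>space N. X \<omega> \<in> S} = (\<Union>s\<in>S. {\<omega>\<in>space N. X \<omega> = s})" by auto
    also have "\<dots> \<in> sets N" using that by (intro sets.finite_UN) auto
    finally show ?thesis .
  qed
  have bm: "bounded_measurable N (?M S)" if "finite S" for S
    using that by (intro bounded_measurable_mix X meas) auto
  have "V (?M S) = (\<Sum>r\<in>S. V (mix {\<omega>\<in>space N. X \<omega> = r} (\<lambda>_. r) (\<lambda>_. 0)))" if "finite S" for S
    using that
  proof induction
    case empty
    then show ?case by (simp add: mix_def)
  next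
    case (insert s S)
    let ?A = "{\<omega>\<in>space N. X \<omega> = s}"
    have "V (?M (insert s S)) = V (mix ?A (?M (insert s S)) (\<lambda>_. 0)) + V (mix ?A (\<lambda>_. 0) (?M (insert s S)))"
      using insert by (intro additive bm) auto
    also have "mix ?A (?M (insert s S)) (\<lambda>_. 0) = mix ?A (\<lambda>_. s) (\<lambda>_. 0)"
      by (auto simp: mix_def)
    also have "mix ?A (\<lambda>_. 0) (?M (insert s S)) = ?M S"
      using insert by (auto simp: mix_def fun_eq_iff)
    finally show ?case using insert by simp
  qed
  from this[OF fin] show ?thesis
    using cong_space[OF X bm[OF fin]] by (simp add: mix_def)
qed

lemma dyadic_floor_tendsto_functional:
  assumes "bounded_measurable N X"
  shows "(\<lambda>n. V (\<lambda>\<omega>. dyadic_floor n (X \<omega>))) \<longlonglongrightarrow> V X"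
proof -
  obtain C where "\<forall>\<omega>\<in>space N. \<bar>X \<omega>\<bar> \<le> C"
    using assms by (auto simp: bounded_measurable_def)
  then show ?thesis
    using assms by (intro continuous[where C = "C + 1"])
      (auto intro: bounded_measurable_dyadic_floor dyadic_floor_abs_le dyadic_floor_tendsto)
qed

end

text \<open>Rounding and continuity reduce the claim to finite range, additivity reduces that to one
  dyadic constant on one event. This is the device for passing from constants to random arguments,
  both for densities and for comparing \<open>u\<close> with its conditional version.\<close>

lemma additive_functional_eqI:
  assumes "additive_functional N V" "additive_functional N W"
    and eq: "\<And>A n x. A \<in> sets N \<Longrightarrow>
      V (mix A (\<lambda>_. dyadic_floor n x) (\<lambda>_. 0)) = W (mix A (\<lambda>_. dyadic_floor n x) (\<lambda>_. 0))"
    and X: "bounded_measurable N X"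
  shows "V X = W X"
proof -
  interpret V: additive_functional N V by fact
  interpret W: additive_functional N W by fact
  have [measurable]: "X \<in> borel_measurable N" using X by (simp add: bounded_measurable_def)
  have "V (\<lambda>\<omega>. dyadic_floor n (X \<omega>)) = W (\<lambda>\<omega>. dyadic_floor n (X \<omega>))" for n
  proof -
    let ?Y = "\<lambda>\<omega>. dyadic_floor n (X \<omega>)"
    note Y = bounded_measurable_dyadic_floor[OF X] finite_range_dyadic_floor[OF X]
    have "V (mix {\<omega>\<in>space N. ?Y \<omega> = r} (\<lambda>_. r) (\<lambda>_. 0)) = W (mix {\<omega>\<in>space N. ?Y \<omega> = r} (\<lambda>_. r) (\<lambda>_. 0))"
      if r: "r \<in> ?Y ` space N" for r
    proof -
      from r obtain x where r: "r = dyadic_floor n x" by blast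
      have "{\<omega>\<in>space N. ?Y \<omega> = r} \<in> sets N" by measurable
      from eq[OF this, of n x] show ?thesis unfolding r .
    qed
    then have "(\<Sum>r\<in>?Y ` space N. V (mix {\<omega>\<in>space N. ?Y \<omega> = r} (\<lambda>_. r) (\<lambda>_. 0)))
        = (\<Sum>r\<in>?Y ` space N. W (mix {\<omega>\<in>space N. ?Y \<omega> = r} (\<lambda>_. r) (\<lambda>_. 0)))"
      by (intro sum.cong refl)
    then show ?thesis
      using V.finite_range_sum[OF Y, of n] W.finite_range_sum[OF Y, of n] by argo
  qed
  then have "(\<lambda>n. V (\<lambda>\<omega>. dyadic_floor n (X \<omega>))) \<longlonglongrightarrow> W X"
    using W.dyadic_floor_tendsto_functional[OF X] by presburger
  then show ?thesis
    by (rule LIMSEQ_unique[OF V.dyadic_floor_tendsto_functional[OF X]])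
qed

section \<open>Expected utility as an additive functional\<close>

definition utility :: "'a measure \<Rightarrow> ('a \<Rightarrow> real \<Rightarrow> real) \<Rightarrow> bool" where
  "utility N u \<longleftrightarrow>
     (\<forall>\<omega>\<in>space N. continuous_on UNIV (u \<omega>) \<and> strict_mono (u \<omega>) \<and> u \<omega> 0 = 0) \<and>
     (\<lambda>(\<omega>, x). u \<omega> x) \<in> borel_measurable (N \<Otimes>\<^sub>M borel) \<and> (\<forall>x. integrable N (\<lambda>\<omega>. u \<omega> x))"

lemma utility_measurable_comp:
  assumes "utility N u" and [measurable]: "X \<in> borel_measurable N"
  shows "(\<lambda>\<omega>. u \<omega> (X \<omega>)) \<in> borel_measurable N"
proof -
  have [measurable]: "(\<lambda>(\<omega>, x). u \<omega> x) \<in> borel_measurable (N \<Otimes>\<^sub>M borel)"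
    using assms by (simp add: utility_def)
  have "(\<lambda>\<omega>. (\<lambda>(\<omega>, x). u \<omega> x) (\<omega>, X \<omega>)) \<in> borel_measurable N" by measurable
  then show ?thesis by simp
qed

text \<open>By monotonicity, integrability at the two constants C and -C provides one dominating
  function for all variables bounded by C.\<close>

lemma utility_abs_le:
  assumes "utility N u" "\<omega> \<in> space N" "\<bar>x\<bar> \<le> C"
  shows "\<bar>u \<omega> x\<bar> \<le> \<bar>u \<omega> C\<bar> + \<bar>u \<omega> (- C)\<bar>"
proof -
  have "strict_mono (u \<omega>)" using assms by (auto simp: utility_def)
  then have "u \<omega> x \<le> u \<omega> C" "u \<omega> (- C) \<le> u \<omega> x"
    using assms(3) by (auto simp: strict_mono_less_eq)
  then show ?thesis by linarith
qed

lemma utility_integrable: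
  assumes u: "utility N u" and X: "bounded_measurable N X"
  shows "integrable N (\<lambda>\<omega>. u \<omega> (X \<omega>))"
proof -
  obtain C where "\<forall>\<omega>\<in>space N. \<bar>X \<omega>\<bar> \<le> C"
    using X by (auto simp: bounded_measurable_def)
  moreover have "integrable N (\<lambda>\<omega>. \<bar>u \<omega> C\<bar> + \<bar>u \<omega> (- C)\<bar>)"
    using u by (auto simp: utility_def)
  ultimately show ?thesis
    using X by (elim Bochner_Integration.integrable_bound)
      (auto simp: bounded_measurable_def intro!: AE_I2 utility_measurable_comp[OF u] utility_abs_le[OF u] order_trans[OF _ abs_ge_self])
qed

lemma utility_integral_tendsto:
  assumes u: "utility N u" and Xs: "\<And>n. bounded_measurable N (Xs n)" and X: "bounded_measurable N X"
    and bd: "\<And>n \<omega>. \<omega> \<in> space N \<Longrightarrow> \<bar>Xs n \<omega>\<bar> \<le> C"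
    and lim: "AE \<omega> in N. (\<lambda>n. Xs n \<omega>) \<longlonglongrightarrow> X \<omega>"
  shows "(\<lambda>n. \<integral>\<omega>. u \<omega> (Xs n \<omega>) \<partial>N) \<longlonglongrightarrow> (\<integral>\<omega>. u \<omega> (X \<omega>) \<partial>N)"
proof (rule integral_dominated_convergence)
  show "(\<lambda>\<omega>. u \<omega> (X \<omega>)) \<in> borel_measurable N" "(\<lambda>\<omega>. u \<omega> (Xs n \<omega>)) \<in> borel_measurable N" for n
    using X Xs by (auto simp: bounded_measurable_def intro!: utility_measurable_comp[OF u])
  show "integrable N (\<lambda>\<omega>. \<bar>u \<omega> C\<bar> + \<bar>u \<omega> (- C)\<bar>)"
    using u by (auto simp: utility_def)
  show "AE \<omega> in N. norm (u \<omega> (Xs n \<omega>)) \<le> \<bar>u \<omega> C\<bar> + \<bar>u \<omega> (- C)\<bar>" for n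
    using bd by (intro AE_I2) (auto intro!: utility_abs_le[OF u])
  show "AE \<omega> in N. (\<lambda>n. u \<omega> (Xs n \<omega>)) \<longlonglongrightarrow> u \<omega> (X \<omega>)"
    using lim
  proof (rule AE_mp[OF _ AE_I2], intro impI)
    fix \<omega> assume "\<omega> \<in> space N" "(\<lambda>n. Xs n \<omega>) \<longlonglongrightarrow> X \<omega>"
    then show "(\<lambda>n. u \<omega> (Xs n \<omega>)) \<longlonglongrightarrow> u \<omega> (X \<omega>)"
      using u by (intro continuous_on_tendsto_compose[of UNIV "u \<omega>"]) (auto simp: utility_def)
  qed
qed

lemma utility_additive_functional:
  assumes u: "utility N u"
  shows "additive_functional N (\<lambda>X. \<integral>\<omega>. u \<omega> (X \<omega>) \<partial>N)"
proof
  fix X A assume X: "bounded_measurable N X" and A: "A \<in> sets N"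
  have "(\<integral>\<omega>. u \<omega> (X \<omega>) \<partial>N) = (\<integral>\<omega>. u \<omega> (mix A X (\<lambda>_. 0) \<omega>) + u \<omega> (mix A (\<lambda>_. 0) X \<omega>) \<partial>N)"
    using u by (intro Bochner_Integration.integral_cong) (auto simp: mix_def utility_def)
  also have "\<dots> = (\<integral>\<omega>. u \<omega> (mix A X (\<lambda>_. 0) \<omega>) \<partial>N) + (\<integral>\<omega>. u \<omega> (mix A (\<lambda>_. 0) X \<omega>) \<partial>N)"
    by (intro Bochner_Integration.integral_add utility_integrable[OF u] bounded_measurable_mix X A) auto
  finally show "(\<integral>\<omega>. u \<omega> (X \<omega>) \<partial>N) = \<dots>" .
next
  fix Xs :: "nat \<Rightarrow> 'a \<Rightarrow> real" and X C
  assume "\<And>n. bounded_measurable N (Xs n)" "bounded_measurable N X"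
    "\<And>n \<omega>. \<omega> \<in> space N \<Longrightarrow> \<bar>Xs n \<omega>\<bar> \<le> C" "\<And>\<omega>. \<omega> \<in> space N \<Longrightarrow> (\<lambda>n. Xs n \<omega>) \<longlonglongrightarrow> X \<omega>"
  then show "(\<lambda>n. \<integral>\<omega>. u \<omega> (Xs n \<omega>) \<partial>N) \<longlonglongrightarrow> (\<integral>\<omega>. u \<omega> (X \<omega>) \<partial>N)"
    by (intro utility_integral_tendsto[OF u]) auto
qed

section \<open>Integral representation of additive functionals\<close>

text \<open>Finite additivity and continuity at the empty set are what V supplies; together they
  give countable additivity. The total mass is finite, so the density is finite almost everywhere
  and may be taken real.\<close>

lemma (in sigma_finite_measure) Radon_Nikodym_real:
  fixes \<mu> :: "'a set \<Rightarrow> real"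
  assumes nonneg: "\<And>A. A \<in> sets M \<Longrightarrow> 0 \<le> \<mu> A"
    and add: "\<And>A B. A \<in> sets M \<Longrightarrow> B \<in> sets M \<Longrightarrow> A \<inter> B = {} \<Longrightarrow> \<mu> (A \<union> B) = \<mu> A + \<mu> B"
    and cont: "\<And>A :: nat \<Rightarrow> 'a set. range A \<subseteq> sets M \<Longrightarrow> decseq A \<Longrightarrow> (\<Inter>i. A i) = {} \<Longrightarrow> (\<lambda>i. \<mu> (A i)) \<longlonglongrightarrow> 0"
    and null: "\<And>A. A \<in> null_sets M \<Longrightarrow> \<mu> A = 0"
  shows "\<exists>f. integrable M f \<and> (\<forall>A\<in>sets M. \<mu> A = (\<integral>\<omega>. f \<omega> * indicator A \<omega> \<partial>M))"
proof -
  let ?m = "\<lambda>A. ennreal (\<mu> A)"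
  have pos: "positive (sets M) ?m"
    using null[of "{}"] by (simp add: positive_def)
  have fin_add: "additive (sets M) ?m"
    unfolding additive_def using add nonneg by (simp add: ennreal_plus)
  have "countably_additive (sets M) ?m"
  proof (rule sets.empty_continuous_imp_countably_additive[OF pos fin_add])
    fix A :: "nat \<Rightarrow> 'a set"
    assume "range A \<subseteq> sets M" "decseq A" "(\<Inter>i. A i) = {}"
    from tendsto_ennrealI[OF cont[OF this]] show "(\<lambda>i. ?m (A i)) \<longlonglongrightarrow> 0" by simp
  qed simp
  define \<rho> where "\<rho> = measure_of (space M) (sets M) ?m"
  have sets_\<rho>: "sets \<rho> = sets M" unfolding \<rho>_def by simp
  have em: "emeasure \<rho> A = ?m A" if "A \<in> sets M" for A
    unfolding \<rho>_def
    by (rule emeasure_measure_of_sigma[OF sets.sigma_algebra_axioms pos]) fact+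
  have "absolutely_continuous M \<rho>"
    unfolding absolutely_continuous_def
    by (auto intro!: null_setsI simp: em null sets_\<rho> null_setsD2)
  from Radon_Nikodym[OF this sets_\<rho>] obtain g where
    g [measurable]: "g \<in> borel_measurable M" and dens: "density M g = \<rho>" by blast
  have nn: "(\<integral>\<^sup>+\<omega>. g \<omega> * indicator A \<omega> \<partial>M) = ?m A" if "A \<in> sets M" for A
    using emeasure_density[OF g that] em[OF that] dens by simp
  have "(\<integral>\<^sup>+\<omega>. g \<omega> \<partial>M) = (\<integral>\<^sup>+\<omega>. g \<omega> * indicator (space M) \<omega> \<partial>M)"
    by (intro nn_integral_cong) simp
  then have fin: "(\<integral>\<^sup>+\<omega>. g \<omega> \<partial>M) \<noteq> \<infinity>" using nn[of "space M"] by simp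
  from nn_integral_PInf_AE[OF g fin] have ae: "AE \<omega> in M. ennreal (enn2real (g \<omega>)) = g \<omega>"
    by eventually_elim (simp add: ennreal_enn2real_if)
  have nn': "(\<integral>\<^sup>+\<omega>. ennreal (enn2real (g \<omega>) * indicator A \<omega>) \<partial>M) = ?m A" if "A \<in> sets M" for A
  proof -
    have "(\<integral>\<^sup>+\<omega>. ennreal (enn2real (g \<omega>) * indicator A \<omega>) \<partial>M) = (\<integral>\<^sup>+\<omega>. g \<omega> * indicator A \<omega> \<partial>M)"
      using ae by (intro nn_integral_cong_AE, eventually_elim) (simp add: ennreal_mult' split: split_indicator)
    then show ?thesis using nn[OF that] by simp
  qed
  have int: "integrable M (\<lambda>\<omega>. enn2real (g \<omega>))"
  proof (rule integrableI_bounded)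
    have "(\<integral>\<^sup>+\<omega>. ennreal (norm (enn2real (g \<omega>))) \<partial>M) = (\<integral>\<^sup>+\<omega>. g \<omega> \<partial>M)"
      using ae by (intro nn_integral_cong_AE, eventually_elim) simp
    then show "(\<integral>\<^sup>+\<omega>. ennreal (norm (enn2real (g \<omega>))) \<partial>M) < \<infinity>"
      using fin by (simp add: top.not_eq_extremum)
  qed measurable
  have "\<mu> A = (\<integral>\<omega>. enn2real (g \<omega>) * indicator A \<omega> \<partial>M)" if A [measurable]: "A \<in> sets M" for A
  proof -
    have "(\<integral>\<omega>. enn2real (g \<omega>) * indicator A \<omega> \<partial>M)
        = enn2real (\<integral>\<^sup>+\<omega>. ennreal (enn2real (g \<omega>) * indicator A \<omega>) \<partial>M)"
      by (intro integral_eq_nn_integral) auto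
    then show ?thesis using nn'[OF A] nonneg[OF A] by simp
  qed
  with int show ?thesis by blast
qed

section \<open>Monotone functions on the dyadic rationals and their continuous extension\<close>

definition grid :: "nat \<Rightarrow> nat \<Rightarrow> nat \<Rightarrow> real" where
  "grid K n i = - real K + real i / 2 ^ n"

lemma grid_le_iff [simp]: "grid K n i \<le> grid K n j \<longleftrightarrow> i \<le> j"
  by (simp add: grid_def divide_le_cancel)

lemma grid_Rats [simp]: "grid K n i \<in> \<rat>"
  by (simp add: grid_def)

lemma grid_double: "grid K (Suc n) (2 * i) = grid K n i"
  by (simp add: grid_def)

lemma grid_eq_dyadic: "grid K n i = of_int (int i - int K * 2 ^ n) / 2 ^ n"
  by (simp add: grid_def diff_divide_distrib)

lemma dyadic_floor_grid: "dyadic_floor n (grid K n i) = grid K n i"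
  unfolding grid_eq_dyadic by (rule dyadic_floor_of_dyadic) simp

lemma abs_grid_le: "i \<le> 2 * K * 2 ^ n \<Longrightarrow> \<bar>grid K n i\<bar> \<le> real K"
proof -
  assume "i \<le> 2 * K * 2 ^ n"
  then have "real i \<le> real (2 * K * 2 ^ n)" by (rule of_nat_mono)
  then have "real i / 2 ^ n \<le> 2 * real K" by (simp add: divide_le_eq)
  moreover have "0 \<le> real i / 2 ^ n" by simp
  ultimately show ?thesis unfolding grid_def by linarith
qed

text \<open>This is what holds at almost every \<omega> for x |-> \<open>dens x \<omega>\<close>:
  each argument brings its own null set, so only countably many can be controlled. The second
  assumption is uniform continuity on [-K, K], phrased on grids.\<close>

locale dyadic_regular =
  fixes f :: "real \<Rightarrow> real"
  assumes mono_Rats: "r \<in> \<rat> \<Longrightarrow> s \<in> \<rat> \<Longrightarrow> r < s \<Longrightarrow> f r < f s"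
    and small_jumps: "\<exists>n. \<forall>i<2 * K * 2 ^ n. f (grid K n (Suc i)) - f (grid K n i) < 1 / real (Suc m)"
begin

definition extension :: "real \<Rightarrow> real" where
  "extension x = lim (\<lambda>n. f (dyadic_floor n x))"

lemma mono_Rats_le: "r \<in> \<rat> \<Longrightarrow> s \<in> \<rat> \<Longrightarrow> r \<le> s \<Longrightarrow> f r \<le> f s"
  using mono_Rats[of r s] by (cases "r = s") auto

lemma extension_lim: "(\<lambda>n. f (dyadic_floor n x)) \<longlonglongrightarrow> extension x"
proof -
  have "dyadic_floor n x \<le> of_int (\<lfloor>x\<rfloor> + 1)" for n
    using dyadic_floor_le[of n x] by linarith
  then have "f (dyadic_floor n x) \<le> f (of_int (\<lfloor>x\<rfloor> + 1))" for n
    by (intro mono_Rats_le) simp_all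
  moreover have "incseq (\<lambda>n. f (dyadic_floor n x))"
    using dyadic_floor_incseq[of x] by (auto simp: incseq_def intro!: mono_Rats_le)
  ultimately obtain L where "(\<lambda>n. f (dyadic_floor n x)) \<longlonglongrightarrow> L"
    using incseq_convergent by metis
  then show ?thesis unfolding extension_def by (simp add: limI)
qed

lemma extension_mono: "x \<le> y \<Longrightarrow> extension x \<le> extension y"
  by (rule LIMSEQ_le[OF extension_lim extension_lim])
    (auto intro!: mono_Rats_le dyadic_floor_mono)

lemma extension_dyadic_floor: "extension (dyadic_floor m x) = f (dyadic_floor m x)"
proof -
  have "\<forall>\<^sub>F n in sequentially. f (dyadic_floor n (dyadic_floor m x)) = f (dyadic_floor m x)"
    using eventually_ge_at_top[of m] by eventually_elim (simp add: dyadic_floor_idem)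
  then have "(\<lambda>n. f (dyadic_floor n (dyadic_floor m x))) \<longlonglongrightarrow> f (dyadic_floor m x)"
    by (rule tendsto_eventually)
  then show ?thesis by (rule LIMSEQ_unique[OF extension_lim])
qed

lemma extension_grid: "extension (grid K n i) = f (grid K n i)"
  using extension_dyadic_floor[of n "grid K n i"] by (simp add: dyadic_floor_grid)

lemma extension_strict_mono: "strict_mono extension"
proof (rule strict_monoI)
  fix x y :: real assume "x < y"
  then have "0 < (y - x) / 2" by simp
  then obtain m where m: "(1 / 2) ^ m < (y - x) / 2"
    using real_arch_pow_inv[of "(y - x) / 2" "1 / 2"] by auto
  \<comment> \<open>With mesh h and 2 h < y - x, the roundings of y - h and of y are two distinct
    grid points in (x, y]; strictness of f between them gives strictness between x and y.\<close>
  define h :: real where "h = 1 / 2 ^ m"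
  have h: "0 < h" "2 * h < y - x" using m by (auto simp: h_def power_one_over)
  have "x < dyadic_floor m (y - h)"
    using dyadic_floor_gt[of "y - h" m] h by (simp add: h_def)
  then have "extension x \<le> extension (dyadic_floor m (y - h))" by (intro extension_mono) simp
  also have "\<dots> = f (dyadic_floor m (y - h))" by (rule extension_dyadic_floor)
  also have "\<dots> < f (dyadic_floor m y)"
    using dyadic_floor_gt[of y m] dyadic_floor_le[of m "y - h"]
    by (intro mono_Rats) (auto simp: h_def)
  also have "\<dots> = extension (dyadic_floor m y)" by (rule extension_dyadic_floor[symmetric])
  also have "\<dots> \<le> extension y" by (intro extension_mono dyadic_floor_le)
  finally show "extension x < extension y" .
qed

lemma extension_continuous: "continuous_on UNIV extension"
proof -
  have "isCont extension x" for x
    unfolding continuous_at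
  proof (rule LIM_I)
    fix \<epsilon> :: real assume "0 < \<epsilon>"
    then obtain m :: nat where m: "1 / real (Suc m) < \<epsilon> / 2"
      using nat_approx_posE[of "\<epsilon> / 2"] by (metis half_gt_zero inverse_eq_divide)
    obtain K :: nat where K: "\<bar>x\<bar> + 1 < real K" using reals_Archimedean2 by blast
    obtain n where n: "\<And>i. i < 2 * K * 2 ^ n \<Longrightarrow> f (grid K n (Suc i)) - f (grid K n i) < 1 / real (Suc m)"
      using small_jumps[of K m] by blast
    \<comment> \<open>z is the position of x in units of the mesh and j its cell. Since x may be a
      grid point, the cell i = j - 1 to its left is added, so that x is interior to two consecutive
      cells, each rising by less than \<epsilon> / 2. The margin 1 in the choice of K leaves room
      for both.\<close>
    define z where "z = 2 ^ n * (x + real K)"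
    define j where "j = nat \<lfloor>z\<rfloor>"
    have two: "1 \<le> (2::real) ^ n" by simp
    have "1 \<le> x + real K" "x + real K \<le> 2 * real K - 1" using K by linarith+
    then have "2 ^ n * 1 \<le> z" "z \<le> 2 ^ n * (2 * real K - 1)"
      unfolding z_def by (intro mult_left_mono; simp)+
    then have z: "1 \<le> z" "z \<le> real (2 * K * 2 ^ n) - 1"
      using two by (simp_all add: algebra_simps del: one_le_power)
    have j: "real j \<le> z" "z < real j + 1" using z(1) unfolding j_def by linarith+
    have "1 \<le> j" using z(1) unfolding j_def by linarith
    then obtain i where i: "j = Suc i" by (cases j) auto
    have "real j + 1 \<le> real (2 * K * 2 ^ n)" using j z by linarith
    then have i2: "Suc i < 2 * K * 2 ^ n" unfolding i by linarith
    have x: "x = - real K + z / 2 ^ n" by (simp add: z_def)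
    have a: "grid K n i < x" unfolding x grid_def using j i by (simp add: divide_less_cancel)
    have b: "x < grid K n (Suc (Suc i))" unfolding x grid_def using j i by (simp add: divide_less_cancel)
    have "f (grid K n (Suc (Suc i))) - f (grid K n i) < \<epsilon>"
      using n[OF i2] n[of i] i2 m by linarith
    then have gap: "extension (grid K n (Suc (Suc i))) - extension (grid K n i) < \<epsilon>"
      by (simp add: extension_grid)
    show "\<exists>s>0. \<forall>y. y \<noteq> x \<and> norm (y - x) < s \<longrightarrow> norm (extension y - extension x) < \<epsilon>"
    proof (intro exI[of _ "min (x - grid K n i) (grid K n (Suc (Suc i)) - x)"] conjI allI impI)
      show "0 < min (x - grid K n i) (grid K n (Suc (Suc i)) - x)" using a b by simp
      fix y assume "y \<noteq> x \<and> norm (y - x) < min (x - grid K n i) (grid K n (Suc (Suc i)) - x)"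
      then have "grid K n i \<le> y" "y \<le> grid K n (Suc (Suc i))" by auto
      then have "extension (grid K n i) \<le> extension y" "extension y \<le> extension (grid K n (Suc (Suc i)))"
        by (auto intro: extension_mono)
      moreover have "extension (grid K n i) \<le> extension x" "extension x \<le> extension (grid K n (Suc (Suc i)))"
        using a b by (auto intro: extension_mono)
      ultimately show "norm (extension y - extension x) < \<epsilon>" using gap by (simp add: abs_less_iff)
    qed
  qed
  then show ?thesis by (simp add: continuous_on_eq_continuous_within)
qed

end

section \<open>Densities of a strictly increasing additive functional\<close>

locale strict_additive_functional = additive_functional N V + prob_space N
  for N :: "'a measure" and V +
  assumes strict: "A \<in> sets N \<Longrightarrow> 0 < measure N A \<Longrightarrow> x < y \<Longrightarrow>
      V (mix A (\<lambda>_. x) (\<lambda>_. 0)) < V (mix A (\<lambda>_. y) (\<lambda>_. 0))"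
    and null: "A \<in> sets N \<Longrightarrow> measure N A = 0 \<Longrightarrow> V (mix A (\<lambda>_. x) (\<lambda>_. 0)) = 0"
begin

lemma additive_events:
  assumes "A \<in> sets N" "B \<in> sets N" "A \<inter> B = {}"
  shows "V (mix (A \<union> B) (\<lambda>_. x) (\<lambda>_. 0)) = V (mix A (\<lambda>_. x) (\<lambda>_. 0)) + V (mix B (\<lambda>_. x) (\<lambda>_. 0))"
proof -
  have "mix A (mix (A \<union> B) (\<lambda>_. x) (\<lambda>_. 0)) (\<lambda>_. 0) = mix A (\<lambda>_. x) (\<lambda>_. 0)"
    "mix A (\<lambda>_. 0) (mix (A \<union> B) (\<lambda>_. x) (\<lambda>_. 0)) = mix B (\<lambda>_. x) (\<lambda>_. 0)"
    using assms by (auto simp: mix_def fun_eq_iff)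
  then show ?thesis
    using additive[of "mix (A \<union> B) (\<lambda>_. x) (\<lambda>_. 0)" A] assms
    by (simp add: bounded_measurable_mix)
qed

lemma continuous_events:
  fixes A :: "nat \<Rightarrow> 'a set"
  assumes "range A \<subseteq> sets N" "decseq A" "(\<Inter>i. A i) = {}"
  shows "(\<lambda>i. V (mix (A i) (\<lambda>_. x) (\<lambda>_. 0))) \<longlonglongrightarrow> 0"
proof -
  have "(\<lambda>i. mix (A i) (\<lambda>_. x) (\<lambda>_. 0) \<omega>) \<longlonglongrightarrow> 0" for \<omega>
  proof -
    obtain n where "\<omega> \<notin> A n" using assms by blast
    then have "\<forall>\<^sub>F i in sequentially. mix (A i) (\<lambda>_. x) (\<lambda>_. 0) \<omega> = 0"
      using decseqD[OF assms(2)] unfolding eventually_sequentially mix_def by (metis in_mono)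
    then show ?thesis by (rule tendsto_eventually)
  qed
  then have "(\<lambda>i. V (mix (A i) (\<lambda>_. x) (\<lambda>_. 0))) \<longlonglongrightarrow> V (\<lambda>_. 0)"
    using assms by (intro continuous[where C = "\<bar>x\<bar>"])
      (auto intro!: bounded_measurable_mix, auto simp: mix_def)
  then show ?thesis by simp
qed

lemma sign:
  assumes "A \<in> sets N"
  shows "0 \<le> x \<Longrightarrow> 0 \<le> V (mix A (\<lambda>_. x) (\<lambda>_. 0))" "x \<le> 0 \<Longrightarrow> V (mix A (\<lambda>_. x) (\<lambda>_. 0)) \<le> 0"
proof -
  have *: "mix A (\<lambda>_. 0) (\<lambda>_. 0) = (\<lambda>_. 0)" by (simp add: mix_def)
  have "measure N A = 0 \<or> 0 < measure N A" by (simp add: zero_less_measure_iff)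
  then show "0 \<le> x \<Longrightarrow> 0 \<le> V (mix A (\<lambda>_. x) (\<lambda>_. 0))" "x \<le> 0 \<Longrightarrow> V (mix A (\<lambda>_. x) (\<lambda>_. 0)) \<le> 0"
    using null[OF assms, of x] strict[OF assms, of 0 x] strict[OF assms, of x 0]
    by (cases "x = 0"; auto simp: *)+
qed

text \<open>At x = 0 the density is required to vanish everywhere rather than almost everywhere, so
  that \<open>util \<omega> 0 = 0\<close> will hold at every point.\<close>

lemma density_exists:
  "\<exists>f. integrable N f \<and> (x = 0 \<longrightarrow> f = (\<lambda>_. 0)) \<and>
    (\<forall>A\<in>sets N. V (mix A (\<lambda>_. x) (\<lambda>_. 0)) = (\<integral>\<omega>. f \<omega> * indicator A \<omega> \<partial>N))"
proof (cases "x = 0")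
  case True
  then show ?thesis by (intro exI[of _ "\<lambda>_. 0"]) (simp add: mix_def)
next
  case False
  \<comment> \<open>The value of x on A against 0 has the sign of x; the factor s makes the set
    function nonnegative, and s * s = 1 undoes it.\<close>
  define s :: real where "s = (if 0 < x then 1 else - 1)"
  have "\<exists>f. integrable N f \<and>
      (\<forall>A\<in>sets N. s * V (mix A (\<lambda>_. x) (\<lambda>_. 0)) = (\<integral>\<omega>. f \<omega> * indicator A \<omega> \<partial>N))"
  proof (rule Radon_Nikodym_real)
    show "0 \<le> s * V (mix A (\<lambda>_. x) (\<lambda>_. 0))" if "A \<in> sets N" for A
      using sign[OF that, of x] False by (auto simp: s_def)
    show "(\<lambda>i. s * V (mix (A i) (\<lambda>_. x) (\<lambda>_. 0))) \<longlonglongrightarrow> 0"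
      if "range A \<subseteq> sets N" "decseq A" "(\<Inter>i. A i) = {}" for A :: "nat \<Rightarrow> 'a set"
      using tendsto_mult_right_zero[OF continuous_events[OF that]] .
    show "s * V (mix A (\<lambda>_. x) (\<lambda>_. 0)) = 0" if "A \<in> null_sets N" for A
      using that null[of A x] by (simp add: measure_eq_0_null_sets null_setsD2)
  qed (simp add: additive_events distrib_left)
  then obtain f where f: "integrable N f"
    "\<And>A. A \<in> sets N \<Longrightarrow> s * V (mix A (\<lambda>_. x) (\<lambda>_. 0)) = (\<integral>\<omega>. f \<omega> * indicator A \<omega> \<partial>N)" by blast
  have "V (mix A (\<lambda>_. x) (\<lambda>_. 0)) = (\<integral>\<omega>. (s * f \<omega>) * indicator A \<omega> \<partial>N)" if "A \<in> sets N" for A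
  proof -
    have "(\<integral>\<omega>. (s * f \<omega>) * indicator A \<omega> \<partial>N) = s * (s * V (mix A (\<lambda>_. x) (\<lambda>_. 0)))"
      unfolding f(2)[OF that] by (simp add: mult.assoc)
    then show ?thesis by (simp add: s_def)
  qed
  then show ?thesis using f(1) False by (intro exI[of _ "\<lambda>\<omega>. s * f \<omega>"]) auto
qed

definition dens :: "real \<Rightarrow> 'a \<Rightarrow> real" where
  "dens x = (SOME f. integrable N f \<and> (x = 0 \<longrightarrow> f = (\<lambda>_. 0)) \<and>
    (\<forall>A\<in>sets N. V (mix A (\<lambda>_. x) (\<lambda>_. 0)) = (\<integral>\<omega>. f \<omega> * indicator A \<omega> \<partial>N)))"

lemma dens_props:
  "integrable N (dens x) \<and> (x = 0 \<longrightarrow> dens x = (\<lambda>_. 0)) \<and>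
    (\<forall>A\<in>sets N. V (mix A (\<lambda>_. x) (\<lambda>_. 0)) = (\<integral>\<omega>. dens x \<omega> * indicator A \<omega> \<partial>N))"
  unfolding dens_def by (rule someI_ex[OF density_exists])

lemma dens_integrable: "integrable N (dens x)"
  and dens_zero [simp]: "dens 0 = (\<lambda>_. 0)"
  and dens_integral: "A \<in> sets N \<Longrightarrow> V (mix A (\<lambda>_. x) (\<lambda>_. 0)) = (\<integral>\<omega>. dens x \<omega> * indicator A \<omega> \<partial>N)"
  using dens_props by blast+

lemma dens_measurable [measurable]: "dens x \<in> borel_measurable N"
  using dens_integrable by (rule borel_measurable_integrable)

lemma integrable_dens_indicator:
  "A \<in> sets N \<Longrightarrow> integrable N (\<lambda>\<omega>. dens x \<omega> * indicator A \<omega>)"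
  using integrable_mult_indicator[OF _ dens_integrable, of A x] by (simp add: mult.commute)

text \<open>On the event where the densities are in the wrong order, the value of y would not exceed
  that of x, contradicting strictness unless the event is null.\<close>

lemma dens_less:
  assumes "x < y" shows "AE \<omega> in N. dens x \<omega> < dens y \<omega>"
proof -
  define A where "A = {\<omega>\<in>space N. dens y \<omega> \<le> dens x \<omega>}"
  have A [measurable]: "A \<in> sets N" unfolding A_def by measurable
  have "(\<integral>\<omega>. dens y \<omega> * indicator A \<omega> \<partial>N) \<le> (\<integral>\<omega>. dens x \<omega> * indicator A \<omega> \<partial>N)"
    by (intro integral_mono integrable_dens_indicator A) (auto simp: A_def split: split_indicator)
  then have "\<not> 0 < measure N A"
    using strict[OF A _ assms] by (auto simp: dens_integral[OF A])
  then have "measure N A = 0" by (simp add: zero_less_measure_iff)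
  then have "A \<in> null_sets N" using A by (intro null_setsI) (simp_all add: emeasure_eq_measure)
  then show ?thesis by (rule AE_I') (auto simp: A_def)
qed

text \<open>Finitely many densities are involved, so substituting a random argument into them is
  harmless. This allows arguments that depend on \<omega>, such as the end points of a cell chosen
  at each \<omega>.\<close>

lemma finite_range_integral:
  assumes X: "bounded_measurable N X" and fin: "finite (X ` space N)"
  shows "integrable N (\<lambda>\<omega>. dens (X \<omega>) \<omega>)" "V X = (\<integral>\<omega>. dens (X \<omega>) \<omega> \<partial>N)"
proof -
  have [measurable]: "X \<in> borel_measurable N" using X by (simp add: bounded_measurable_def)
  let ?A = "\<lambda>r. {\<omega>\<in>space N. X \<omega> = r}"
  have A: "?A r \<in> sets N" for r by measurable
  have eq: "(\<Sum>r\<in>X ` space N. dens r \<omega> * indicator (?A r) \<omega>) = dens (X \<omega>) \<omega>" if "\<omega> \<in> space N" for \<omega>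
  proof -
    have "(\<Sum>r\<in>X ` space N. dens r \<omega> * indicator (?A r) \<omega>) = (\<Sum>r\<in>X ` space N. if r = X \<omega> then dens (X \<omega>) \<omega> else 0)"
      using that by (intro sum.cong) (auto simp: indicator_def)
    also have "\<dots> = dens (X \<omega>) \<omega>" using that fin by simp
    finally show ?thesis .
  qed
  have int: "integrable N (\<lambda>\<omega>. \<Sum>r\<in>X ` space N. dens r \<omega> * indicator (?A r) \<omega>)"
    by (intro Bochner_Integration.integrable_sum integrable_dens_indicator A)
  then show "integrable N (\<lambda>\<omega>. dens (X \<omega>) \<omega>)"
    by (subst (asm) Bochner_Integration.integrable_cong[OF refl eq])
  have "V X = (\<Sum>r\<in>X ` space N. \<integral>\<omega>. dens r \<omega> * indicator (?A r) \<omega> \<partial>N)"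
    unfolding finite_range_sum[OF X fin] by (intro sum.cong refl dens_integral A)
  also have "\<dots> = (\<integral>\<omega>. (\<Sum>r\<in>X ` space N. dens r \<omega> * indicator (?A r) \<omega>) \<partial>N)"
    by (intro Bochner_Integration.integral_sum[symmetric] integrable_dens_indicator A)
  also have "\<dots> = (\<integral>\<omega>. dens (X \<omega>) \<omega> \<partial>N)"
    by (intro Bochner_Integration.integral_cong eq refl)
  finally show "V X = (\<integral>\<omega>. dens (X \<omega>) \<omega> \<partial>N)" .
qed

text \<open>Quantifying over the type \<open>rat\<close> keeps the condition countable, hence
  measurable and open to intersecting the null sets.\<close>

definition increasing_at :: "'a \<Rightarrow> bool" where
  "increasing_at \<omega> \<longleftrightarrow> (\<forall>r s :: rat. r < s \<longrightarrow> dens (of_rat r) \<omega> < dens (of_rat s) \<omega>)"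

lemma increasing_at_measurable [measurable]: "Measurable.pred N increasing_at"
  unfolding increasing_at_def by measurable

lemma increasing_atD:
  assumes "increasing_at \<omega>" "r \<in> \<rat>" "s \<in> \<rat>"
  shows "r < s \<Longrightarrow> dens r \<omega> < dens s \<omega>" "r \<le> s \<Longrightarrow> dens r \<omega> \<le> dens s \<omega>"
proof -
  show *: "r < s \<Longrightarrow> dens r \<omega> < dens s \<omega>"
  proof -
    obtain p q where "r = of_rat p" "s = of_rat q" using assms by (metis Rats_cases)
    then show "r < s \<Longrightarrow> dens r \<omega> < dens s \<omega>"
      using assms(1) by (simp add: increasing_at_def of_rat_less)
  qed
  show "r \<le> s \<Longrightarrow> dens r \<omega> \<le> dens s \<omega>" using * by (cases "r = s") auto
qed

lemma AE_increasing_at: "AE \<omega> in N. increasing_at \<omega>"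
proof -
  have "AE \<omega> in N. r < s \<longrightarrow> dens (of_rat r) \<omega> < dens (of_rat s) \<omega>" for r s :: rat
    by (cases "r < s") (simp_all add: dens_less of_rat_less)
  then show ?thesis unfolding increasing_at_def by (simp add: AE_all_countable)
qed

text \<open>The index bound belongs to the predicate, so that a least index is automatically a cell
  of [-K, K]. Natural-number indices counted from -K make \<open>i div 2\<close> the parent of cell
  i.\<close>

definition jump :: "real \<Rightarrow> nat \<Rightarrow> nat \<Rightarrow> nat \<Rightarrow> 'a \<Rightarrow> bool" where
  "jump \<epsilon> K n i \<omega> \<longleftrightarrow> i < 2 * K * 2 ^ n \<and> \<epsilon> \<le> dens (grid K n (Suc i)) \<omega> - dens (grid K n i) \<omega>"

lemma jump_measurable [measurable]: "Measurable.pred N (jump \<epsilon> K n i)"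
  unfolding jump_def by measurable

text \<open>A monotone function rises over the parent cell at least as much as over the child
  contained in it.\<close>

lemma jump_parent:
  assumes "increasing_at \<omega>" "jump \<epsilon> K (Suc n) i \<omega>" shows "jump \<epsilon> K n (i div 2) \<omega>"
proof -
  have "grid K (Suc n) (2 * (i div 2)) \<le> grid K (Suc n) i"
    "grid K (Suc n) (Suc i) \<le> grid K (Suc n) (2 * Suc (i div 2))"
    unfolding grid_le_iff by presburger+
  then have "dens (grid K n (i div 2)) \<omega> \<le> dens (grid K (Suc n) i) \<omega>"
    "dens (grid K (Suc n) (Suc i)) \<omega> \<le> dens (grid K n (Suc (i div 2))) \<omega>"
    unfolding grid_double by (auto intro!: increasing_atD(2)[OF assms(1)])
  then show ?thesis using assms(2) unfolding jump_def by auto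
qed

text \<open>The left end point \<open>X n\<close> of the first cell of the \<open>n\<close>-th dyadic grid on which the density
  increases by at least \<open>\<epsilon>\<close> is nondecreasing in \<open>n\<close>, hence converges, and so does the right end
  point \<open>Y n\<close>, to the same limit. Continuity of \<open>V\<close> then forces \<open>V (Y n) - V (X n) \<longlonglongrightarrow> 0\<close>.\<close>

lemma AE_no_persistent_jump:
  assumes "0 < \<epsilon>"
  shows "AE \<omega> in N. \<exists>n. \<forall>i. \<not> jump \<epsilon> K n i \<omega>"
proof -
  define J where "J = {\<omega>\<in>space N. increasing_at \<omega> \<and> (\<forall>n. \<exists>i. jump \<epsilon> K n i \<omega>)}"
  have J [measurable]: "J \<in> sets N" unfolding J_def by measurable
  define L where "L = (\<lambda>n \<omega>. LEAST i. jump \<epsilon> K n i \<omega>)"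
  have L [measurable]: "L n \<in> measurable N (count_space UNIV)" for n
    unfolding L_def by measurable
  have jL: "jump \<epsilon> K n (L n \<omega>) \<omega>" if "\<omega> \<in> J" for n \<omega>
    using that unfolding J_def L_def by (auto intro: LeastI_ex)
  define X where "X = (\<lambda>n. mix J (\<lambda>\<omega>. grid K n (L n \<omega>)) (\<lambda>_. 0))"
  define Y where "Y = (\<lambda>n. mix J (\<lambda>\<omega>. grid K n (Suc (L n \<omega>))) (\<lambda>_. 0))"
  have [measurable]: "X n \<in> borel_measurable N" "Y n \<in> borel_measurable N" for n
    unfolding X_def Y_def mix_def by measurable
  have bdX: "\<bar>X n \<omega>\<bar> \<le> real K" and bdY: "\<bar>Y n \<omega>\<bar> \<le> real K" for n \<omega>
    using jL[of \<omega> n] by (auto simp: X_def Y_def mix_def jump_def intro!: abs_grid_le)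
  have bm: "bounded_measurable N (X n)" "bounded_measurable N (Y n)" for n
    using bdX[of n] bdY[of n] by (auto simp: bounded_measurable_def intro: exI[of _ "real K"])
  have "X n ` space N \<subseteq> insert 0 (grid K n ` {..2 * K * 2 ^ n})"
    "Y n ` space N \<subseteq> insert 0 (grid K n ` {..2 * K * 2 ^ n})" for n
    using jL[of _ n] by (fastforce simp: X_def Y_def mix_def jump_def)+
  then have fin: "finite (X n ` space N)" "finite (Y n ` space N)" for n
    by (meson finite_subset finite_insert finite_imageI finite_atMost)+
  have inc: "X n \<omega> \<le> X (Suc n) \<omega>" for n \<omega>
  proof (cases "\<omega> \<in> J")
    case True
    let ?i = "L (Suc n) \<omega>"
    have "jump \<epsilon> K n (?i div 2) \<omega>"
      using True jL[OF True] by (intro jump_parent) (auto simp: J_def)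
    \<comment> \<open>The parent of the first jump cell at level \<open>Suc n\<close> is a jump cell
      at level n, so the first one at level n lies no further to the right.\<close>
    then have "L n \<omega> \<le> ?i div 2" unfolding L_def by (rule Least_le)
    then have "grid K n (L n \<omega>) \<le> grid K (Suc n) (2 * (?i div 2))" by (simp add: grid_double)
    also have "\<dots> \<le> grid K (Suc n) ?i" unfolding grid_le_iff by simp
    finally show ?thesis using True by (simp add: X_def mix_def)
  qed (simp add: X_def mix_def)
  define Z where "Z = (\<lambda>\<omega>. lim (\<lambda>n. X n \<omega>))"
  have limX: "(\<lambda>n. X n \<omega>) \<longlonglongrightarrow> Z \<omega>" for \<omega>
  proof -
    have "incseq (\<lambda>n. X n \<omega>)" using inc by (intro incseq_SucI)
    moreover have "\<forall>n. X n \<omega> \<le> real K" using bdX abs_le_D1 by blast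
    ultimately obtain l where "(\<lambda>n. X n \<omega>) \<longlonglongrightarrow> l" using incseq_convergent by metis
    then show ?thesis unfolding Z_def by (simp add: limI)
  qed
  have limY: "(\<lambda>n. Y n \<omega>) \<longlonglongrightarrow> Z \<omega>" for \<omega>
  proof -
    have "(\<lambda>n. (1 / 2 :: real) ^ n * indicator J \<omega>) \<longlonglongrightarrow> 0 * indicator J \<omega>"
      by (intro tendsto_intros LIMSEQ_power_zero) simp
    from tendsto_add[OF limX[of \<omega>] this]
    have "(\<lambda>n. X n \<omega> + (1 / 2) ^ n * indicator J \<omega>) \<longlonglongrightarrow> Z \<omega>" by simp
    moreover have "X n \<omega> + (1 / 2) ^ n * indicator J \<omega> = Y n \<omega>" for n
      by (simp add: X_def Y_def mix_def grid_def add_divide_distrib power_one_over)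
    ultimately show ?thesis by simp
  qed
  have bmZ: "bounded_measurable N Z"
  proof -
    have "\<bar>Z \<omega>\<bar> \<le> real K" for \<omega>
      by (rule LIMSEQ_le_const2[OF tendsto_rabs[OF limX]]) (use bdX in auto)
    moreover have "Z \<in> borel_measurable N" unfolding Z_def by measurable
    ultimately show ?thesis by (auto simp: bounded_measurable_def)
  qed
  have "(\<lambda>n. V (Y n) - V (X n)) \<longlonglongrightarrow> V Z - V Z"
    using bdX bdY limX limY bmZ bm by (intro tendsto_diff continuous[where C = "real K"]) auto
  \<comment> \<open>On J the densities at the two ends of the chosen cell differ by at least
    \<epsilon>, off J both arguments are 0; the variables have finite range, so integrating the
    densities gives V.\<close>
  moreover have "\<epsilon> * measure N J \<le> V (Y n) - V (X n)" for n
  proof -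
    have "\<epsilon> * measure N J = (\<integral>\<omega>. \<epsilon> * indicator J \<omega> \<partial>N)" using J sets.sets_into_space[OF J]
      by (simp add: Int_absorb2)
    also have "\<dots> \<le> (\<integral>\<omega>. dens (Y n \<omega>) \<omega> - dens (X n \<omega>) \<omega> \<partial>N)"
      using jL[of _ n] integrable_real_indicator[OF J] by (intro integral_mono Bochner_Integration.integrable_diff finite_range_integral bm fin)
        (auto simp: jump_def X_def Y_def mix_def emeasure_eq_measure split: split_indicator)
    also have "\<dots> = V (Y n) - V (X n)"
      by (simp add: finite_range_integral bm fin)
    finally show ?thesis .
  qed
  ultimately have "\<epsilon> * measure N J \<le> 0" by (intro LIMSEQ_le_const[where X = "\<lambda>n. V (Y n) - V (X n)"]) auto
  then have "measure N J = 0" using assms by (simp add: mult_le_0_iff measure_le_0_iff)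
  then have "J \<in> null_sets N" using J by (intro null_setsI) (simp_all add: emeasure_eq_measure)
  then have "AE \<omega> in N. \<omega> \<notin> J" by (rule AE_not_in)
  then show ?thesis using AE_increasing_at AE_space by eventually_elim (auto simp: J_def)
qed

definition good :: "'a \<Rightarrow> bool" where
  "good \<omega> \<longleftrightarrow> increasing_at \<omega> \<and> (\<forall>K m. \<exists>n. \<forall>i. \<not> jump (1 / real (Suc m)) K n i \<omega>)"

lemma good_measurable [measurable]: "Measurable.pred N good"
  unfolding good_def by measurable

lemma AE_good: "AE \<omega> in N. good \<omega>"
  unfolding good_def by (simp add: AE_all_countable AE_increasing_at AE_no_persistent_jump)

lemma good_dyadic_regular: "good \<omega> \<Longrightarrow> dyadic_regular (\<lambda>x. dens x \<omega>)"
  by unfold_locales (auto simp: good_def jump_def not_le intro: increasing_atD)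

text \<open>Regularity is demanded at every \<omega>. On the exceptional null set the identity
  serves as a default that is continuous, strictly increasing and zero at 0.\<close>

definition util :: "'a \<Rightarrow> real \<Rightarrow> real" where
  "util \<omega> x = (if good \<omega> then lim (\<lambda>n. dens (dyadic_floor n x) \<omega>) else x)"

lemma util_good: "good \<omega> \<Longrightarrow> util \<omega> = dyadic_regular.extension (\<lambda>x. dens x \<omega>)"
  by (auto simp: util_def dyadic_regular.extension_def[OF good_dyadic_regular])

lemma util_regular: "continuous_on UNIV (util \<omega>)" "strict_mono (util \<omega>)" "util \<omega> 0 = 0"
proof -
  show "continuous_on UNIV (util \<omega>)"
    by (cases "good \<omega>") (simp_all add: util_good dyadic_regular.extension_continuous good_dyadic_regular, simp add: util_def[abs_def])
  show "strict_mono (util \<omega>)"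
    by (cases "good \<omega>") (simp_all add: util_good dyadic_regular.extension_strict_mono good_dyadic_regular, simp add: util_def[abs_def] strict_mono_def)
  show "util \<omega> 0 = 0" by (simp add: util_def)
qed

lemma util_dyadic_floor: "good \<omega> \<Longrightarrow> util \<omega> (dyadic_floor m x) = dens (dyadic_floor m x) \<omega>"
  using dyadic_regular.extension_dyadic_floor[OF good_dyadic_regular] by (simp add: util_good)

lemma util_measurable: "(\<lambda>(\<omega>, x). util \<omega> x) \<in> borel_measurable (N \<Otimes>\<^sub>M borel)"
proof -
  have [measurable]: "(\<lambda>p. dens (dyadic_floor n (snd p)) (fst p)) \<in> borel_measurable (N \<Otimes>\<^sub>M borel)" for n
  proof -
    \<comment> \<open>The densities are measurable in \<omega> for each fixed argument only; the
      rounded argument is indexed by an integer, so the joint function is a countable gluing of such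
      densities.\<close>
    have "(\<lambda>p. (\<lambda>i p. dens (of_int i / 2 ^ n) (fst p)) \<lfloor>2 ^ n * (snd p :: real)\<rfloor> p)
        \<in> borel_measurable (N \<Otimes>\<^sub>M borel)"
    proof (rule measurable_compose_countable[where g = "\<lambda>p. \<lfloor>2 ^ n * (snd p :: real)\<rfloor>"])
      show "(\<lambda>p. \<lfloor>2 ^ n * (snd p :: real)\<rfloor>) \<in> measurable (N \<Otimes>\<^sub>M borel) (count_space UNIV)"
        by measurable
    qed measurable
    then show ?thesis by (simp add: dyadic_floor_def)
  qed
  show ?thesis unfolding util_def case_prod_beta by measurable
qed

lemma util_integrable: "integrable N (\<lambda>\<omega>. util \<omega> x)"
proof (rule Bochner_Integration.integrable_bound)
  \<comment> \<open>These are integers enclosing x, where \<open>util\<close> coincides with an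
    integrable density; monotonicity bounds it in between.\<close>
  let ?a = "dyadic_floor 0 x" and ?b = "dyadic_floor 0 (x + 1)"
  show "integrable N (\<lambda>\<omega>. \<bar>dens ?a \<omega>\<bar> + \<bar>dens ?b \<omega>\<bar>)" by (simp add: dens_integrable)
  show "(\<lambda>\<omega>. util \<omega> x) \<in> borel_measurable N"
    using measurable_compose[OF measurable_Pair2'[of x borel N] util_measurable] by simp
  show "AE \<omega> in N. norm (util \<omega> x) \<le> norm (\<bar>dens ?a \<omega>\<bar> + \<bar>dens ?b \<omega>\<bar>)"
    using AE_good
  proof eventually_elim
    case (elim \<omega>)
    have "?a \<le> x" "x \<le> ?b" using dyadic_floor_le[of 0 x] dyadic_floor_gt[of "x + 1" 0] by auto
    then have "util \<omega> ?a \<le> util \<omega> x" "util \<omega> x \<le> util \<omega> ?b"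
      using util_regular(2)[of \<omega>] by (simp_all add: strict_mono_less_eq)
    then show ?case using util_dyadic_floor[OF elim] by simp
  qed
qed

lemma utility_util: "utility N util"
  using util_regular util_measurable util_integrable by (auto simp: utility_def)

text \<open>Both sides are additive functionals, so agreement on dyadic constants suffices, and
  there \<open>util\<close> is the original density almost everywhere.\<close>

theorem expected_utility_representation:
  assumes "bounded_measurable N X"
  shows "V X = (\<integral>\<omega>. util \<omega> (X \<omega>) \<partial>N)"
proof (rule additive_functional_eqI[OF additive_functional_axioms utility_additive_functional[OF utility_util] _ assms])
  fix A n and x :: real assume A: "A \<in> sets N"
  let ?r = "dyadic_floor n x"
  have "(\<integral>\<omega>. util \<omega> (mix A (\<lambda>_. ?r) (\<lambda>_. 0) \<omega>) \<partial>N) = (\<integral>\<omega>. dens ?r \<omega> * indicator A \<omega> \<partial>N)"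
  proof (rule integral_cong_AE)
    show "(\<lambda>\<omega>. util \<omega> (mix A (\<lambda>_. ?r) (\<lambda>_. 0) \<omega>)) \<in> borel_measurable N"
      using A bounded_measurable_mix[of N "\<lambda>_. ?r" "\<lambda>_. 0" A]
      by (intro utility_measurable_comp[OF utility_util]) (auto simp: bounded_measurable_def)
    show "AE \<omega> in N. util \<omega> (mix A (\<lambda>_. ?r) (\<lambda>_. 0) \<omega>) = dens ?r \<omega> * indicator A \<omega>"
      using AE_good by eventually_elim (simp add: mix_def util_dyadic_floor util_regular)
  qed (use A in measurable)
  then show "V (mix A (\<lambda>_. ?r) (\<lambda>_. 0)) = (\<integral>\<omega>. util \<omega> (mix A (\<lambda>_. ?r) (\<lambda>_. 0) \<omega>) \<partial>N)"
    using dens_integral[OF A, of ?r] by simp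
qed

end

section \<open>Qualitative probabilities on nonatomic spaces\<close>

text \<open>A greedy choice: \<open>F (Suc n)\<close> comes within 1 / (n + 1) of the largest
  measure available in S above \<open>F n\<close>. A member of S above the union competes at every
  stage, so it exceeds the union by measure zero.\<close>

lemma (in finite_measure) exhaustion:
  assumes C0: "C0 \<in> S" and S: "S \<subseteq> sets M"
    and closed: "\<And>F :: nat \<Rightarrow> 'a set. range F \<subseteq> S \<Longrightarrow> incseq F \<Longrightarrow> (\<Union>n. F n) \<in> S"
  shows "\<exists>C\<in>S. C0 \<subseteq> C \<and> (\<forall>D\<in>S. C \<subseteq> D \<longrightarrow> measure M (D - C) = 0)"
proof -
  have step: "\<exists>D. D \<in> S \<and> C \<subseteq> D \<and> (\<forall>D'\<in>S. C \<subseteq> D' \<longrightarrow> measure M D' \<le> measure M D + 1 / real (Suc n))"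
    if C: "C \<in> S" for C n
  proof -
    let ?T = "{D \<in> S. C \<subseteq> D}"
    have bdd: "bdd_above (measure M ` ?T)" by (auto intro!: bdd_aboveI2[of _ _ "measure M (space M)"] bounded_measure)
    have "(SUP D\<in>?T. measure M D) - 1 / real (Suc n) < (SUP D\<in>?T. measure M D)" by simp
    then obtain D where D: "D \<in> ?T" "(SUP D\<in>?T. measure M D) - 1 / real (Suc n) < measure M D"
      using C by (subst (asm) less_cSUP_iff[OF _ bdd]) auto
    have "measure M D' \<le> measure M D + 1 / real (Suc n)" if "D' \<in> S" "C \<subseteq> D'" for D'
      using cSUP_upper[OF _ bdd, of D'] that D(2) by auto
    with D show ?thesis by blast
  qed
  have "\<exists>F. \<forall>n. F n \<in> {D \<in> S. C0 \<subseteq> D} \<and>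
      (F n \<subseteq> F (Suc n) \<and> (\<forall>D'\<in>S. F n \<subseteq> D' \<longrightarrow> measure M D' \<le> measure M (F (Suc n)) + 1 / real (Suc n)))"
  proof (rule dependent_nat_choice)
    fix C n assume "C \<in> {D \<in> S. C0 \<subseteq> D}"
    then show "\<exists>D. D \<in> {D \<in> S. C0 \<subseteq> D} \<and> (C \<subseteq> D \<and> (\<forall>D'\<in>S. C \<subseteq> D' \<longrightarrow> measure M D' \<le> measure M D + 1 / real (Suc n)))"
      using step[of C n] by blast
  qed (use C0 in auto)
  then obtain F where F: "\<And>n. F n \<in> S" "\<And>n. C0 \<subseteq> F n" "\<And>n. F n \<subseteq> F (Suc n)"
    "\<And>n D'. D' \<in> S \<Longrightarrow> F n \<subseteq> D' \<Longrightarrow> measure M D' \<le> measure M (F (Suc n)) + 1 / real (Suc n)" by blast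
  define C where "C = (\<Union>n. F n)"
  have CS: "C \<in> S" unfolding C_def using F(1) by (intro closed incseq_SucI F(3)) auto
  have "measure M (D - C) = 0" if D: "D \<in> S" "C \<subseteq> D" for D
  proof -
    have "measure M D \<le> measure M C + 1 / real (Suc n)" for n
    proof -
      have "measure M D \<le> measure M (F (Suc n)) + 1 / real (Suc n)"
        using D by (intro F(4)) (auto simp: C_def)
      also have "measure M (F (Suc n)) \<le> measure M C"
        using CS S by (intro finite_measure_mono) (auto simp: C_def)
      finally show ?thesis by simp
    qed
    then have "measure M D - measure M C \<le> 0"
      using LIMSEQ_le_const[OF LIMSEQ_Suc[OF lim_1_over_n[where 'a = real]], of "measure M D - measure M C"]
      by (auto simp: algebra_simps)
    moreover have "measure M (D - C) = measure M D - measure M C"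
      using CS D S by (intro finite_measure_Diff) auto
    ultimately show ?thesis using measure_nonneg[of M "D - C"] by linarith
  qed
  moreover have "C0 \<subseteq> C" using F(2)[of 0] by (auto simp: C_def)
  ultimately show ?thesis using CS by blast
qed

text \<open>A maximal \<open>C\<close> with \<open>q C \<le> v\<close> and, above it, a minimal \<open>D\<close> with \<open>v \<le> q D\<close> differ by a
  null set, since nonatomicity would otherwise provide a set strictly in between.\<close>

lemma (in prob_space) nonatomic_intermediate_value:
  fixes q :: "'a set \<Rightarrow> real"
  assumes nonatomic: "nonatomic M"
    and A: "A \<in> sets M" and B: "B \<in> sets M" and AB: "A \<subseteq> B" and v: "q A \<le> v" "v \<le> q B"
    and q_null: "\<And>C D. C \<in> sets M \<Longrightarrow> D \<in> sets M \<Longrightarrow> C \<subseteq> D \<Longrightarrow> D \<subseteq> B \<Longrightarrow> measure M (D - C) = 0 \<Longrightarrow> q C = q D"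
    and q_incseq: "\<And>F :: nat \<Rightarrow> 'a set. range F \<subseteq> sets M \<Longrightarrow> incseq F \<Longrightarrow> (\<And>n. F n \<subseteq> B) \<Longrightarrow> (\<lambda>n. q (F n)) \<longlonglongrightarrow> q (\<Union>n. F n)"
    and q_decseq: "\<And>F :: nat \<Rightarrow> 'a set. range F \<subseteq> sets M \<Longrightarrow> decseq F \<Longrightarrow> (\<And>n. F n \<subseteq> B) \<Longrightarrow> (\<lambda>n. q (F n)) \<longlonglongrightarrow> q (\<Inter>n. F n)"
  obtains C where "C \<in> sets M" "A \<subseteq> C" "C \<subseteq> B" "q C = v"
proof -
  let ?S = "{C \<in> sets M. A \<subseteq> C \<and> C \<subseteq> B \<and> q C \<le> v}"
  have "\<exists>C\<in>?S. A \<subseteq> C \<and> (\<forall>D\<in>?S. C \<subseteq> D \<longrightarrow> measure M (D - C) = 0)"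
  proof (rule exhaustion)
    fix F :: "nat \<Rightarrow> 'a set" assume F: "range F \<subseteq> ?S" "incseq F"
    then have "q (\<Union>n. F n) \<le> v"
      by (intro LIMSEQ_le_const2[OF q_incseq]) auto
    then show "(\<Union>n. F n) \<in> ?S" using F by auto
  qed (use A AB v in auto)
  then obtain C where C: "C \<in> ?S" and "\<forall>D\<in>?S. C \<subseteq> D \<longrightarrow> measure M (D - C) = 0"
    by (elim bexE conjE)
  note Cmax = mp[OF bspec[OF this(2)]]
  \<comment> \<open>Exhaustion produces maximal sets, so a minimal D above C is obtained as the
    complement in B of a maximal E.\<close>
  let ?T = "{E \<in> sets M. E \<subseteq> B - C \<and> v \<le> q (B - E)}"
  have "\<exists>E\<in>?T. {} \<subseteq> E \<and> (\<forall>D\<in>?T. E \<subseteq> D \<longrightarrow> measure M (D - E) = 0)"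
  proof (rule exhaustion)
    fix F :: "nat \<Rightarrow> 'a set" assume F: "range F \<subseteq> ?T" "incseq F"
    have "(\<lambda>n. q (B - F n)) \<longlonglongrightarrow> q (\<Inter>n. B - F n)"
      using F B by (intro q_decseq) (auto simp: decseq_def dest: monoD[of F])
    then have "v \<le> q (\<Inter>n. B - F n)" using F by (intro LIMSEQ_le_const) auto
    moreover have "(\<Inter>n. B - F n) = B - (\<Union>n. F n)" by auto
    ultimately show "(\<Union>n. F n) \<in> ?T" using F by auto
  qed (use v in auto)
  then obtain E where E: "E \<in> ?T" and "\<forall>D\<in>?T. E \<subseteq> D \<longrightarrow> measure M (D - E) = 0"
    by (elim bexE conjE)
  note Emax = mp[OF bspec[OF this(2)]]
  define D where "D = B - E"
  have D: "D \<in> sets M" "C \<subseteq> D" "D \<subseteq> B" "v \<le> q D" using E B C by (auto simp: D_def)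
  have "measure M (D - C) = 0"
  proof (rule ccontr)
    assume "measure M (D - C) \<noteq> 0"
    then have "0 < measure M (D - C)" by (simp add: zero_less_measure_iff)
    \<comment> \<open>F is a piece of D - C with positive measure and positive remainder. If the
      value at C \<union> F is at most v, then F enlarges C; otherwise the remainder enlarges E.
      Either contradicts maximality.\<close>
    then obtain F where F: "F \<in> sets M" "F \<subseteq> D - C" "0 < measure M F" "measure M F < measure M (D - C)"
      using nonatomic[unfolded nonatomic_def, rule_format, of "D - C"] D(1) C by auto
    show False
    proof (cases "q (C \<union> F) \<le> v")
      case True
      then have "measure M ((C \<union> F) - C) = 0" using C D F by (intro Cmax) auto
      moreover have "(C \<union> F) - C = F" using F by auto
      ultimately show False using F by simp
    next
      case False
      let ?E = "E \<union> (D - C - F)"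
      have "B - ?E = C \<union> F" using C D F E by (auto simp: D_def)
      then have "measure M (?E - E) = 0" using False C D F E by (intro Emax) auto
      moreover have "?E - E = (D - C) - F" by (auto simp: D_def)
      moreover have "measure M ((D - C) - F) = measure M (D - C) - measure M F"
        using C D F by (intro finite_measure_Diff) auto
      ultimately show False using F by simp
    qed
  qed
  then have "q C = q D" using C D by (intro q_null) auto
  then have "q C = v" using C D by auto
  then show ?thesis using C that by auto
qed

text \<open>Here q encodes a likelihood order and its values need not be additive.
  \<open>q_Un_iff\<close> is de Finetti's axiom: adding a common disjoint event preserves
  comparisons.\<close>

locale qualitative_probability = prob_space M for M :: "'a measure" +
  fixes q :: "'a set \<Rightarrow> real"
  assumes nonatomic: "nonatomic M"
    and q_less: "A \<in> sets M \<Longrightarrow> B \<in> sets M \<Longrightarrow> A \<subseteq> B \<Longrightarrow> 0 < measure M (B - A) \<Longrightarrow> q A < q B"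
    and q_null: "A \<in> sets M \<Longrightarrow> B \<in> sets M \<Longrightarrow> A \<subseteq> B \<Longrightarrow> measure M (B - A) = 0 \<Longrightarrow> q A = q B"
    and q_Un_iff: "A \<in> sets M \<Longrightarrow> B \<in> sets M \<Longrightarrow> C \<in> sets M \<Longrightarrow> A \<inter> C = {} \<Longrightarrow> B \<inter> C = {} \<Longrightarrow>
      q (A \<union> C) \<le> q (B \<union> C) \<longleftrightarrow> q A \<le> q B"
    and q_incseq: "range F \<subseteq> sets M \<Longrightarrow> incseq F \<Longrightarrow> (\<lambda>n. q (F n)) \<longlonglongrightarrow> q (\<Union>n. F n)"
    and q_decseq: "range F \<subseteq> sets M \<Longrightarrow> decseq F \<Longrightarrow> (\<lambda>n. q (F n)) \<longlonglongrightarrow> q (\<Inter>n. F n)"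
begin

lemma q_mono: "A \<in> sets M \<Longrightarrow> B \<in> sets M \<Longrightarrow> A \<subseteq> B \<Longrightarrow> q A \<le> q B"
  using q_less[of A B] q_null[of A B] by (cases "measure M (B - A) = 0") (auto simp: zero_less_measure_iff)

lemma intermediate_value:
  assumes "A \<in> sets M" "B \<in> sets M" "A \<subseteq> B" "q A \<le> v" "v \<le> q B"
  obtains C where "C \<in> sets M" "A \<subseteq> C" "C \<subseteq> B" "q C = v"
proof (rule nonatomic_intermediate_value[OF nonatomic assms])
  show "q C = q D" if "C \<in> sets M" "D \<in> sets M" "C \<subseteq> D" "D \<subseteq> B" "measure M (D - C) = 0" for C D
    using that(1,2,3,5) by (rule q_null)
qed (rule q_incseq q_decseq that; assumption)+

text \<open>The axiom adds a common event, but A' may meet B and A may meet B'. The comparison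
  passes through A' \<union> B: adding B - A' to A' and A gives A' \<union> B against A \<union> (B
  - A'), adding A' - B to B' and B gives B' \<union> (A' - B) against A' \<union> B; finally A'
  \<inter> B, disjoint from both outer events, is added back.\<close>

lemma q_Un_le:
  assumes sets: "A \<in> sets M" "B \<in> sets M" "A' \<in> sets M" "B' \<in> sets M"
    and disj: "A \<inter> B = {}" "A' \<inter> B' = {}"
    and le: "q A' \<le> q A" "q B' \<le> q B"
  shows "q (A' \<union> B') \<le> q (A \<union> B)" "q A' < q A \<or> q B' < q B \<Longrightarrow> q (A' \<union> B') < q (A \<union> B)"
proof -
  have 1: "q (A' \<union> (B - A')) \<le> q (A \<union> (B - A')) \<longleftrightarrow> q A' \<le> q A"
    "q (A \<union> (B - A')) \<le> q (A' \<union> (B - A')) \<longleftrightarrow> q A \<le> q A'"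
    using sets disj by (intro q_Un_iff; auto)+
  have 2: "q (B' \<union> (A' - B)) \<le> q (B \<union> (A' - B)) \<longleftrightarrow> q B' \<le> q B"
    "q (B \<union> (A' - B)) \<le> q (B' \<union> (A' - B)) \<longleftrightarrow> q B \<le> q B'"
    using sets disj by (intro q_Un_iff; auto)+
  have 3: "q ((B' \<union> (A' - B)) \<union> (A' \<inter> B)) \<le> q ((A \<union> (B - A')) \<union> (A' \<inter> B))
      \<longleftrightarrow> q (B' \<union> (A' - B)) \<le> q (A \<union> (B - A'))"
    "q ((A \<union> (B - A')) \<union> (A' \<inter> B)) \<le> q ((B' \<union> (A' - B)) \<union> (A' \<inter> B))
      \<longleftrightarrow> q (A \<union> (B - A')) \<le> q (B' \<union> (A' - B))"
    using sets disj by (intro q_Un_iff; auto)+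
  have eq: "A' \<union> (B - A') = B \<union> (A' - B)" "(B' \<union> (A' - B)) \<union> (A' \<inter> B) = A' \<union> B'"
    "(A \<union> (B - A')) \<union> (A' \<inter> B) = A \<union> B" by auto
  show "q (A' \<union> B') \<le> q (A \<union> B)" using 1 2 3 le unfolding eq by linarith
  show "q (A' \<union> B') < q (A \<union> B)" if "q A' < q A \<or> q B' < q B"
    using 1 2 3 le that unfolding eq by linarith
qed

lemma q_Un_cong:
  assumes "A \<in> sets M" "B \<in> sets M" "A' \<in> sets M" "B' \<in> sets M" "A \<inter> B = {}" "A' \<inter> B' = {}"
    and "q A' = q A" "q B' = q B"
  shows "q (A' \<union> B') = q (A \<union> B)"
  using assms by (intro antisym q_Un_le) auto

section \<open>Dyadic equipartitions into equally likely cells\<close>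

definition half :: "'a set \<Rightarrow> 'a set" where
  "half A = (SOME B. B \<in> sets M \<and> B \<subseteq> A \<and> q B = q (A - B))"

lemma half:
  assumes A: "A \<in> sets M"
  shows "half A \<in> sets M" "half A \<subseteq> A" "q (half A) = q (A - half A)"
proof -
  \<comment> \<open>The balance between a part and its complement in A changes sign between the
    empty set and A; a zero is a bisection.\<close>
  let ?d = "\<lambda>B. q B - q (A - B)"
  have "\<exists>B. B \<in> sets M \<and> B \<subseteq> A \<and> q B = q (A - B)"
  proof (rule nonatomic_intermediate_value[OF nonatomic, of "{}" A ?d 0])
    show "?d C = ?d D" if "C \<in> sets M" "D \<in> sets M" "C \<subseteq> D" "D \<subseteq> A" "measure M (D - C) = 0" for C D
    proof -
      have "(A - C) - (A - D) = D - C" using that by auto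
      then have "q (A - D) = q (A - C)" using that A by (intro q_null) auto
      then show ?thesis using q_null[of C D] that by simp
    qed
    show "(\<lambda>n. ?d (F n)) \<longlonglongrightarrow> ?d (\<Union>n. F n)" if F: "range F \<subseteq> sets M" "incseq F" for F :: "nat \<Rightarrow> 'a set"
    proof -
      have "(\<lambda>n. q (A - F n)) \<longlonglongrightarrow> q (\<Inter>n. A - F n)"
        using F A by (intro q_decseq) (auto simp: decseq_def incseq_def)
      moreover have "(\<Inter>n. A - F n) = A - (\<Union>n. F n)" by auto
      ultimately show ?thesis using q_incseq[OF F] by (intro tendsto_diff) auto
    qed
    show "(\<lambda>n. ?d (F n)) \<longlonglongrightarrow> ?d (\<Inter>n. F n)" if F: "range F \<subseteq> sets M" "decseq F" for F :: "nat \<Rightarrow> 'a set"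
    proof -
      have "(\<lambda>n. q (A - F n)) \<longlonglongrightarrow> q (\<Union>n. A - F n)"
        using F A by (intro q_incseq) (auto simp: decseq_def incseq_def)
      moreover have "(\<Union>n. A - F n) = A - (\<Inter>n. F n)" by auto
      ultimately show ?thesis using q_decseq[OF F] by (intro tendsto_diff) auto
    qed
  qed (use A q_mono[of "{}" A] in auto)
  from someI_ex[OF this] show "half A \<in> sets M" "half A \<subseteq> A" "q (half A) = q (A - half A)"
    unfolding half_def by auto
qed

text \<open>If one half of A were strictly more likely than one half of B, so would be the other
  halves, and then A would be strictly more likely than B.\<close>

lemma half_mono:
  assumes "A \<in> sets M" "B \<in> sets M" "q A \<le> q B"
  shows "q (half A) \<le> q (half B)"
proof (rule ccontr)
  assume less: "\<not> q (half A) \<le> q (half B)"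
  have "q (half B \<union> (B - half B)) < q (half A \<union> (A - half A))"
    using half[OF assms(1)] half[OF assms(2)] assms less by (intro q_Un_le(2)) auto
  moreover have "half B \<union> (B - half B) = B" "half A \<union> (A - half A) = A"
    using half[OF assms(1)] half[OF assms(2)] by auto
  ultimately show False using assms by simp
qed

text \<open>The children of cell k are 2 k and 2 k + 1. Distinct cells at level n have indices below
  2 ^ n; larger indices repeat them.\<close>

primrec cell :: "nat \<Rightarrow> nat \<Rightarrow> 'a set" where
  "cell 0 i = space M"
| "cell (Suc n) i = (if even i then half (cell n (i div 2)) else cell n (i div 2) - half (cell n (i div 2)))"

lemma cell_sets [measurable]: "cell n i \<in> sets M"
  by (induction n arbitrary: i) (auto simp: half)

lemma q_cell: "q (cell n i) = q (cell n j)"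
proof (induction n arbitrary: i j)
  case (Suc n)
  have "q (half (cell n i)) = q (half (cell n j))" for i j
    using Suc[of i j] by (intro antisym half_mono) auto
  moreover have "q (cell (Suc n) i) = q (half (cell n (i div 2)))" for i
    using half(3)[of "cell n (i div 2)"] by simp
  ultimately show ?case by metis
qed simp

lemma cell_disjoint: "i < 2 ^ n \<Longrightarrow> j < 2 ^ n \<Longrightarrow> i \<noteq> j \<Longrightarrow> cell n i \<inter> cell n j = {}"
proof (induction n arbitrary: i j)
  case (Suc n)
  have sub: "cell (Suc n) i \<subseteq> cell n (i div 2)" for i
    using half(2)[of "cell n (i div 2)"] by auto
  show ?case
  proof (cases "i div 2 = j div 2")
    case True
    then have "even i \<noteq> even j" using Suc.prems by presburger
    then show ?thesis using True by auto
  next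
    case False
    then have "cell n (i div 2) \<inter> cell n (j div 2) = {}" using Suc.prems by (intro Suc.IH) auto
    then show ?thesis using sub[of i] sub[of j] by blast
  qed
qed simp

definition strip :: "nat \<Rightarrow> nat \<Rightarrow> nat \<Rightarrow> 'a set" where
  "strip n j k = (\<Union>i\<in>{j..<j + k}. cell n i)"

abbreviation initial :: "nat \<Rightarrow> nat \<Rightarrow> 'a set" where
  "initial n k \<equiv> strip n 0 k"

lemma strip_sets [measurable]: "strip n j k \<in> sets M"
  unfolding strip_def by auto

lemma strip_0 [simp]: "strip n j 0 = {}"
  by (simp add: strip_def)

lemma strip_Suc: "strip n j (Suc k) = strip n j k \<union> cell n (j + k)"
  by (auto simp: strip_def less_Suc_eq atLeastLessThanSuc)

lemma strip_add: "strip n j (k + l) = strip n j k \<union> strip n (j + k) l"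
  by (induction l) (auto simp: strip_Suc add.assoc)

lemma strip_disjoint: "j + k + l \<le> 2 ^ n \<Longrightarrow> strip n j k \<inter> strip n (j + k) l = {}"
proof -
  assume "j + k + l \<le> 2 ^ n"
  then have "cell n i \<inter> cell n i' = {}" if "i \<in> {j..<j + k}" "i' \<in> {j + k..<j + k + l}" for i i'
    using that by (intro cell_disjoint) auto
  then show ?thesis unfolding strip_def by blast
qed

lemma initial_double: "initial (Suc n) (2 * k) = initial n k"
proof (induction k)
  case (Suc k)
  have "initial (Suc n) (2 * Suc k) = initial (Suc n) (2 * k) \<union> cell (Suc n) (2 * k) \<union> cell (Suc n) (Suc (2 * k))"
    by (simp add: strip_Suc del: cell.simps)
  also have "cell (Suc n) (2 * k) = half (cell n k)" by simp
  also have "cell (Suc n) (Suc (2 * k)) = cell n k - half (cell n k)" by simp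
  also have "initial (Suc n) (2 * k) \<union> half (cell n k) \<union> (cell n k - half (cell n k)) = initial n k \<union> cell n k"
    unfolding Suc using half(2)[OF cell_sets[of n k]] by blast
  finally show ?case by (simp add: strip_Suc)
qed simp

lemma initial_full: "initial n (2 ^ n) = space M"
proof (induction n)
  case 0
  then show ?case by (simp add: strip_def)
next
  case (Suc n)
  then show ?case using initial_double[of n "2 ^ n"] by simp
qed

lemma q_strip: "j + k \<le> 2 ^ n \<Longrightarrow> q (strip n j k) = q (initial n k)"
proof (induction k)
  case (Suc k)
  have "q (strip n j k \<union> cell n (j + k)) = q (initial n k \<union> cell n (0 + k))"
  proof (rule q_Un_cong)
    show "initial n k \<inter> cell n (0 + k) = {}" "strip n j k \<inter> cell n (j + k) = {}"
      using strip_disjoint[of 0 k 1 n] strip_disjoint[of j k 1 n] Suc.prems by (auto simp: strip_Suc)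
  qed (use Suc q_cell in auto)
  then show ?case by (simp add: strip_Suc)
qed simp

text \<open>One null cell would be as likely as the empty set, hence so would all cells of its
  level; all would be null, although they cover the space.\<close>

lemma cell_pos: "0 < measure M (cell n i)"
proof (rule ccontr)
  assume "\<not> 0 < measure M (cell n i)"
  then have "measure M (cell n i) = 0" by (simp add: zero_less_measure_iff)
  then have "q {} = q (cell n i)" by (intro q_null) auto
  then have "measure M (cell n j) = 0" for j
    using q_less[of "{}" "cell n j"] q_cell[of n i j] by (auto simp: zero_less_measure_iff)
  then have "measure M (initial n k) = 0" for k
  proof (induction k)
    case (Suc k)
    have "measure M (initial n (Suc k)) \<le> measure M (initial n k) + measure M (cell n k)"
      by (simp add: strip_Suc measure_Un_le)
    then show ?case using Suc by (simp add: measure_le_0_iff)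
  qed simp
  then show False using prob_space initial_full[of n] by (metis zero_neq_one)
qed

lemma q_initial_less:
  assumes "j < k" "k \<le> 2 ^ n" shows "q (initial n j) < q (initial n k)"
proof -
  have k: "initial n k = initial n j \<union> strip n j (k - j)"
    using strip_add[of n 0 j "k - j"] assms by simp
  have "strip n j (k - j) \<inter> initial n j = {}"
    using strip_disjoint[of 0 j "k - j" n] assms by auto
  then have "initial n k - initial n j = strip n j (k - j)" using k by auto
  moreover have "cell n j \<subseteq> strip n j (k - j)" using assms by (auto simp: strip_def)
  ultimately have "measure M (cell n j) \<le> measure M (initial n k - initial n j)"
    by (intro finite_measure_mono) auto
  then show ?thesis using cell_pos[of n j] k by (intro q_less) auto
qed

lemma q_initial_le: "j \<le> k \<Longrightarrow> k \<le> 2 ^ n \<Longrightarrow> q (initial n j) \<le> q (initial n k)"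
  using q_initial_less[of j k n] by (cases "j = k") auto

section \<open>The subjective probability of an event, measured by counting cells\<close>

definition level :: "nat \<Rightarrow> 'a set \<Rightarrow> nat" where
  "level n A = Max {k. k \<le> 2 ^ n \<and> q (initial n k) \<le> q A}"

context
  fixes A assumes A: "A \<in> sets M"
begin

lemma level_in: "level n A \<in> {k. k \<le> 2 ^ n \<and> q (initial n k) \<le> q A}"
  unfolding level_def
proof (rule Max_in)
  show "{k. k \<le> 2 ^ n \<and> q (initial n k) \<le> q A} \<noteq> {}"
    using q_mono[of "{}" A] A by (auto intro!: exI[of _ 0])
qed simp

lemma level_le: "level n A \<le> 2 ^ n"
  and q_level: "q (initial n (level n A)) \<le> q A"
  using level_in by auto

lemma level_ge: "k \<le> 2 ^ n \<Longrightarrow> q (initial n k) \<le> q A \<Longrightarrow> k \<le> level n A"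
  unfolding level_def by (intro Max_ge) simp_all

lemma q_Suc_level: "level n A < 2 ^ n \<Longrightarrow> q A < q (initial n (Suc (level n A)))"
  using level_ge[of "Suc (level n A)" n] by (meson Suc_leI Suc_n_not_le_n not_le)

lemma level_double: "2 * level n A \<le> level (Suc n) A"
  using level_le[of n] q_level[of n] by (intro level_ge) (auto simp: initial_double)

end

lemma level_superadditive:
  assumes A: "A \<in> sets M" and B: "B \<in> sets M" and disj: "A \<inter> B = {}"
  shows "level n A + level n B \<le> level n (A \<union> B)"
proof -
  define j k where "j = level n A" and "k = level n B"
  have jk: "j \<le> 2 ^ n" "k \<le> 2 ^ n" "q (initial n j) \<le> q A" "q (initial n k) \<le> q B"
    using level_le q_level A B by (auto simp: j_def k_def)
  have "j + k \<le> 2 ^ n"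
  proof (rule ccontr)
    assume "\<not> j + k \<le> 2 ^ n"
    \<comment> \<open>If j + k cells did not fit, the k' < k cells left after the first j would be
      strictly less likely than B, making the whole space strictly less likely than A \<union>
      B.\<close>
    define k' where "k' = 2 ^ n - j"
    have k': "k' < k" "j + k' = 2 ^ n" using \<open>\<not> j + k \<le> 2 ^ n\<close> jk by (auto simp: k'_def)
    have "q (strip n j k') < q B"
      using q_initial_less[of k' k n] q_strip[of j k' n] k' jk by simp
    then have "q (initial n j \<union> strip n j k') < q (A \<union> B)"
      using strip_disjoint[of 0 j k' n] jk k' A B disj by (intro q_Un_le(2)) auto
    moreover have "initial n j \<union> strip n j k' = space M"
      using strip_add[of n 0 j k'] initial_full[of n] k' by simp
    moreover have "q (A \<union> B) \<le> q (space M)"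
      using A B sets.sets_into_space by (intro q_mono) auto
    ultimately show False by simp
  qed
  moreover have "q (initial n j \<union> strip n (0 + j) k) \<le> q (A \<union> B)"
    using strip_disjoint[of 0 j k n] jk \<open>j + k \<le> 2 ^ n\<close> A B disj q_strip[of j k n] by (intro q_Un_le(1)) auto
  ultimately show ?thesis
    using A B unfolding j_def[symmetric] k_def[symmetric] by (intro level_ge) (auto simp: strip_add)
qed

text \<open>One more cell overshoots each of A and B, so A \<union> B is less likely than j + k + 2
  cells. The defect 1 disappears after division by 2 ^ n.\<close>

lemma level_subadditive:
  assumes A: "A \<in> sets M" and B: "B \<in> sets M" and disj: "A \<inter> B = {}"
  shows "level n (A \<union> B) \<le> level n A + level n B + 1"
proof (rule ccontr)
  define j k where "j = level n A" and "k = level n B"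
  assume "\<not> ?thesis"
  then have le: "Suc j + Suc k \<le> level n (A \<union> B)" by (simp add: j_def k_def)
  moreover have "level n (A \<union> B) \<le> 2 ^ n" using A B by (intro level_le) auto
  ultimately have le': "Suc j + Suc k \<le> 2 ^ n" by linarith
  have "q A < q (initial n (Suc j))" "q B < q (initial n (Suc k))"
    using le' q_Suc_level[OF A, of n] q_Suc_level[OF B, of n] by (auto simp: j_def k_def)
  then have "q (A \<union> B) < q (initial n (Suc j) \<union> strip n (0 + Suc j) (Suc k))"
    using strip_disjoint[of 0 "Suc j" "Suc k" n] le' A B disj q_strip[of "Suc j" "Suc k" n]
    by (intro q_Un_le(2)) auto
  also have "\<dots> = q (initial n (Suc j + Suc k))" by (simp only: strip_add)
  also have "\<dots> \<le> q (initial n (level n (A \<union> B)))"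
    using le A B level_le by (intro q_initial_le) auto
  also have "\<dots> \<le> q (A \<union> B)" using A B by (intro q_level) auto
  finally show False by simp
qed

definition qprob :: "'a set \<Rightarrow> real" where
  "qprob A = lim (\<lambda>n. level n A / 2 ^ n)"

lemma level_incseq: "A \<in> sets M \<Longrightarrow> incseq (\<lambda>n. level n A / 2 ^ n)"
proof (rule incseq_SucI)
  fix n assume "A \<in> sets M"
  then have "real (2 * level n A) \<le> real (level (Suc n) A)" by (intro of_nat_mono level_double)
  then show "level n A / 2 ^ n \<le> level (Suc n) A / 2 ^ Suc n" by (simp add: field_simps)
qed

lemma level_lim:
  assumes A: "A \<in> sets M" shows "(\<lambda>n. level n A / 2 ^ n) \<longlonglongrightarrow> qprob A"
proof -
  have "real (level n A) \<le> real (2 ^ n)" for n using level_le[OF A] by (intro of_nat_mono)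
  then have "\<forall>n. level n A / 2 ^ n \<le> 1" by (simp add: divide_le_eq)
  then obtain L where "(\<lambda>n. level n A / 2 ^ n) \<longlonglongrightarrow> L"
    using incseq_convergent[OF level_incseq[OF A]] by metis
  then show ?thesis unfolding qprob_def by (simp add: limI)
qed

lemma level_le_qprob: "A \<in> sets M \<Longrightarrow> level n A / 2 ^ n \<le> qprob A"
  using incseq_le[OF level_incseq level_lim] .

lemma inverse_two_power_lim: "(\<lambda>n. 1 / 2 ^ n :: real) \<longlonglongrightarrow> 0"
  using LIMSEQ_power_zero[of "1 / 2 :: real"] by (simp add: power_one_over)

lemma qprob_additive:
  assumes A: "A \<in> sets M" and B: "B \<in> sets M" and disj: "A \<inter> B = {}"
  shows "qprob (A \<union> B) = qprob A + qprob B"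
proof (rule antisym)
  have "level n (A \<union> B) / 2 ^ n \<le> level n A / 2 ^ n + level n B / 2 ^ n + 1 / 2 ^ n" for n
  proof -
    have "real (level n (A \<union> B)) \<le> real (level n A + level n B + 1)"
      by (intro of_nat_mono level_subadditive assms)
    then have "level n (A \<union> B) / 2 ^ n \<le> real (level n A + level n B + 1) / 2 ^ n"
      by (intro divide_right_mono) auto
    then show ?thesis by (simp add: add_divide_distrib)
  qed
  moreover have "(\<lambda>n. level n A / 2 ^ n + level n B / 2 ^ n + 1 / 2 ^ n) \<longlonglongrightarrow> qprob A + qprob B + 0"
    using A B by (intro tendsto_add level_lim inverse_two_power_lim)
  ultimately show "qprob (A \<union> B) \<le> qprob A + qprob B"
    using A B by (intro LIMSEQ_le[OF level_lim]) auto
  have "level n A / 2 ^ n + level n B / 2 ^ n \<le> level n (A \<union> B) / 2 ^ n" for n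
  proof -
    have "real (level n A + level n B) \<le> real (level n (A \<union> B))"
      by (intro of_nat_mono level_superadditive assms)
    then have "real (level n A + level n B) / 2 ^ n \<le> level n (A \<union> B) / 2 ^ n"
      by (intro divide_right_mono) auto
    then show ?thesis by (simp add: add_divide_distrib)
  qed
  then show "qprob A + qprob B \<le> qprob (A \<union> B)"
    using A B by (intro LIMSEQ_le[OF tendsto_add[OF level_lim level_lim] level_lim]) auto
qed

lemma qprob_mono:
  assumes "A \<in> sets M" "B \<in> sets M" "q A \<le> q B" shows "qprob A \<le> qprob B"
proof (rule LIMSEQ_le[OF level_lim level_lim])
  have "level n A \<le> level n B" for n
    using assms q_level[of A n] level_le[of A n] by (intro level_ge) auto
  then show "\<exists>N. \<forall>n\<ge>N. level n A / 2 ^ n \<le> level n B / 2 ^ n"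
    by (auto intro!: divide_right_mono)
qed (use assms in auto)

lemma level_space: "level n (space M) = 2 ^ n"
  by (intro antisym level_le level_ge) (auto simp: initial_full)

lemma qprob_space: "qprob (space M) = 1"
  using level_lim[of "space M"] by (simp add: level_space LIMSEQ_const_iff)

context
  fixes \<nu> :: "'a set \<Rightarrow> real"
  assumes \<nu>_add: "\<And>A B. A \<in> sets M \<Longrightarrow> B \<in> sets M \<Longrightarrow> A \<inter> B = {} \<Longrightarrow> \<nu> (A \<union> B) = \<nu> A + \<nu> B"
    and \<nu>_mono: "\<And>A B. A \<in> sets M \<Longrightarrow> B \<in> sets M \<Longrightarrow> q A \<le> q B \<Longrightarrow> \<nu> A \<le> \<nu> B"
begin

lemma additive_initial: "k \<le> 2 ^ n \<Longrightarrow> \<nu> (initial n k) = k / 2 ^ n * \<nu> (space M)"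
proof -
  have cell: "\<nu> (cell n i) = \<nu> (cell n 0)" for i
    using q_cell[of n i 0] by (intro antisym \<nu>_mono) auto
  have *: "k \<le> 2 ^ n \<Longrightarrow> \<nu> (initial n k) = k * \<nu> (cell n 0)" for k
  proof (induction k)
    case 0
    then show ?case using \<nu>_add[of "{}" "{}"] by simp
  next
    case (Suc k)
    have "\<nu> (initial n k \<union> cell n (0 + k)) = \<nu> (initial n k) + \<nu> (cell n (0 + k))"
      using strip_disjoint[of 0 k 1 n] Suc.prems by (intro \<nu>_add) (auto simp: strip_Suc)
    then show ?case using Suc cell[of k] by (simp add: strip_Suc algebra_simps)
  qed
  have "\<nu> (space M) = 2 ^ n * \<nu> (cell n 0)" using *[of "2 ^ n"] by (simp add: initial_full)
  then show "k \<le> 2 ^ n \<Longrightarrow> \<nu> (initial n k) = k / 2 ^ n * \<nu> (space M)" using *[of k] by simp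
qed

text \<open>Equally likely cells force \<nu> on initial segments, and A lies between two consecutive
  segments at every level. This yields the affine uniqueness of valuations.\<close>

lemma qprob_unique:
  assumes A: "A \<in> sets M" shows "\<nu> A = qprob A * \<nu> (space M)"
proof -
  have lower: "level n A / 2 ^ n * \<nu> (space M) \<le> \<nu> A" for n
    using additive_initial[OF level_le[OF A], of n] \<nu>_mono[OF strip_sets A q_level[OF A, of n]] by simp
  have "\<nu> {} = 0" using \<nu>_add[of "{}" "{}"] by simp
  then have pos: "0 \<le> \<nu> (space M)" using \<nu>_mono[of "{}" "space M"] q_mono[of "{}" "space M"] by simp
  have upper: "\<nu> A \<le> (level n A / 2 ^ n + 1 / 2 ^ n) * \<nu> (space M)" for n
  proof (cases "level n A < 2 ^ n")
    case True
    then have "\<nu> A \<le> \<nu> (initial n (Suc (level n A)))"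
      using q_Suc_level[OF A True] A by (intro \<nu>_mono) auto
    also have "\<dots> = Suc (level n A) / 2 ^ n * \<nu> (space M)" using True by (intro additive_initial) simp
    finally show ?thesis by (simp add: add_divide_distrib add.commute)
  next
    case False
    then have "level n A = 2 ^ n" using level_le[OF A, of n] by simp
    then have "1 * \<nu> (space M) \<le> (level n A / 2 ^ n + 1 / 2 ^ n) * \<nu> (space M)"
      using pos by (intro mult_right_mono) auto
    moreover have "\<nu> A \<le> \<nu> (space M)"
      using A sets.sets_into_space[OF A] by (intro \<nu>_mono q_mono) auto
    ultimately show ?thesis by simp
  qed
  have "(\<lambda>n. (level n A / 2 ^ n + 1 / 2 ^ n) * \<nu> (space M)) \<longlonglongrightarrow> (qprob A + 0) * \<nu> (space M)"
    by (intro tendsto_intros level_lim A inverse_two_power_lim)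
  then have "\<nu> A \<le> (qprob A + 0) * \<nu> (space M)" using upper by (intro LIMSEQ_le_const) auto
  moreover have "(\<lambda>n. level n A / 2 ^ n * \<nu> (space M)) \<longlonglongrightarrow> qprob A * \<nu> (space M)"
    by (intro tendsto_intros level_lim A)
  then have "qprob A * \<nu> (space M) \<le> \<nu> A" using lower by (intro LIMSEQ_le_const2) auto
  ultimately show ?thesis by simp
qed

end

lemma qprob_initial: "k \<le> 2 ^ n \<Longrightarrow> qprob (initial n k) = k / 2 ^ n"
  using additive_initial[of qprob k n] by (simp add: qprob_additive qprob_mono qprob_space)

text \<open>Used to separate two values by an event, which transfers limits from \<open>e\<close> to
  the value. The k in the proof is the first integer beyond 2 ^ n * a.\<close>

lemma qprob_dense:
  assumes "0 \<le> a" "a < b" "b \<le> 1"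
  obtains A where "A \<in> sets M" "a < qprob A" "qprob A < b"
proof -
  have "0 < b - a" using assms by simp
  then obtain n where "(1 / 2) ^ n < b - a" using real_arch_pow_inv[of "b - a" "1 / 2"] by auto
  then have n: "1 / 2 ^ n < b - a" by (simp add: power_one_over)
  define k where "k = nat (\<lfloor>2 ^ n * a\<rfloor> + 1)"
  have "0 \<le> 2 ^ n * a" using assms by simp
  then have k: "2 ^ n * a < real k" "real k \<le> 2 ^ n * a + 1" unfolding k_def by linarith+
  have lo: "a < k / 2 ^ n" using k by (simp add: less_divide_eq mult.commute)
  have "k / 2 ^ n \<le> (2 ^ n * a + 1) / 2 ^ n" using k by (intro divide_right_mono) auto
  also have "\<dots> = a + 1 / 2 ^ n" by (simp add: add_divide_distrib)
  also have "\<dots> < b" using n by simp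
  finally have hi: "k / 2 ^ n < b" .
  then have "real k / 2 ^ n < 1" using assms(3) by (rule less_le_trans)
  then have "real k < real (2 ^ n)" by (simp add: divide_less_eq)
  then have "k \<le> 2 ^ n" by linarith
  then show ?thesis using lo hi that[of "initial n k"] by (simp add: qprob_initial)
qed

text \<open>An Archimedean property. The nested leftmost cells need not shrink to the empty set, but
  their siblings \<open>cell (Suc m) 1\<close> are pairwise disjoint, so the tail unions
  \<open>T n\<close> do, and q of them tends to that of the empty set. Each \<open>T n\<close>
  contains a sibling as likely as the leftmost cell of its level.\<close>

lemma initial_small:
  assumes B: "B \<in> sets M" and pos: "0 < measure M B"
  obtains n where "q (initial n 1) \<le> q B"
proof -
  define T where "T n = (\<Union>m\<in>{n..}. cell (Suc m) 1)" for n
  have dec: "decseq (\<lambda>n. cell n 0)"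
    by (rule decseq_SucI) (simp add: half(2))
  have "cell (Suc m) 1 \<inter> cell (Suc m') 1 = {}" if "m < m'" for m m'
  proof -
    have "cell (Suc m') 1 \<subseteq> cell m' 0" by auto
    also have "\<dots> \<subseteq> cell (Suc m) 0" using decseqD[OF dec, of "Suc m" m'] that by simp
    finally show ?thesis using cell_disjoint[of 0 "Suc m" 1] by auto
  qed
  then have unique: "m = m'" if "\<omega> \<in> cell (Suc m) 1" "\<omega> \<in> cell (Suc m') 1" for \<omega> m m'
    using that by (metis IntI empty_iff linorder_neqE_nat)
  have "(\<Inter>n. T n) = {}"
  proof (rule ccontr)
    assume "(\<Inter>n. T n) \<noteq> {}"
    then obtain \<omega> where \<omega>: "\<And>n. \<omega> \<in> T n" by auto
    obtain m where m: "\<omega> \<in> cell (Suc m) 1" using \<omega>[of 0] unfolding T_def by blast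
    obtain m' where "m' \<ge> Suc m" "\<omega> \<in> cell (Suc m') 1" using \<omega>[of "Suc m"] unfolding T_def by blast
    then show False using unique[OF m, of m'] by simp
  qed
  moreover have T: "T n \<in> sets M" for n unfolding T_def by (intro sets.countable_UN'') (auto simp del: cell.simps)
  moreover have "decseq T" unfolding T_def decseq_def by (auto intro: le_trans)
  ultimately have "(\<lambda>n. q (T n)) \<longlonglongrightarrow> q {}" using q_decseq[of T] by auto
  moreover have "q {} < q B" using B pos by (intro q_less) auto
  ultimately have "\<forall>\<^sub>F n in sequentially. q (T n) < q B" by (rule order_tendstoD)
  then obtain n where n: "q (T n) < q B" by (auto simp: eventually_sequentially)
  have "q (initial (Suc n) 1) = q (cell (Suc n) 0)" by (simp add: strip_def)
  also have "\<dots> = q (cell (Suc n) 1)" by (rule q_cell)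
  also have "\<dots> \<le> q (T n)" using T by (intro q_mono) (auto simp: T_def simp del: cell.simps)
  finally show ?thesis using n that[of "Suc n"] by simp
qed

text \<open>B contains a copy B' as likely as A, and the remainder is not null, so it outweighs some
  cell and has positive probability.\<close>

lemma qprob_less:
  assumes A: "A \<in> sets M" and B: "B \<in> sets M" and less: "q A < q B"
  shows "qprob A < qprob B"
proof -
  obtain B' where B': "B' \<in> sets M" "B' \<subseteq> B" "q B' = q A"
    using intermediate_value[of "{}" B "q A"] q_mono[of "{}" A] A B less by auto
  have "0 < measure M (B - B')"
    using q_null[of B' B] B' B less by (auto simp: zero_less_measure_iff)
  then obtain n where "q (initial n 1) \<le> q (B - B')"
    using initial_small[of "B - B'"] B B' by auto
  then have "qprob (initial n 1) \<le> qprob (B - B')" using B B' by (intro qprob_mono) auto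
  moreover have "0 < qprob (initial n 1)" using qprob_initial[of 1 n] by simp
  moreover have "qprob (B' \<union> (B - B')) = qprob B' + qprob (B - B')"
    using B B' by (intro qprob_additive) auto
  moreover have "B' \<union> (B - B') = B" using B' by auto
  moreover have "qprob B' = qprob A" using A B' by (intro antisym qprob_mono) auto
  ultimately show ?thesis by simp
qed

end

section \<open>Additive values from the sure-thing principle\<close>

locale nonlinear_expectation = prob_space M for M :: "'a measure" +
  fixes e :: "('a \<Rightarrow> real) \<Rightarrow> real"
  assumes nonatomic: "nonatomic M"
    and e_cong: "bounded_measurable M X \<Longrightarrow> bounded_measurable M Y \<Longrightarrow>
      (AE \<omega> in M. X \<omega> = Y \<omega>) \<Longrightarrow> e X = e Y"
    and sure_thing: "A \<in> sets M \<Longrightarrow> bounded_measurable M X \<Longrightarrow> bounded_measurable M Y \<Longrightarrow>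
      bounded_measurable M Z \<Longrightarrow> bounded_measurable M W \<Longrightarrow>
      e (mix A X Z) \<le> e (mix A Y Z) \<Longrightarrow> e (mix A X W) \<le> e (mix A Y W)"
    and dichotomic: "x < y \<Longrightarrow> bounded_measurable M Z \<Longrightarrow> A \<in> sets M \<Longrightarrow> 0 < measure M A \<Longrightarrow>
      e (mix A (\<lambda>_. x) Z) < e (mix A (\<lambda>_. y) Z)"
    and e_continuous: "(\<And>n. bounded_measurable M (Xs n)) \<Longrightarrow> bounded_measurable M X \<Longrightarrow>
      (\<And>n \<omega>. \<omega> \<in> space M \<Longrightarrow> \<bar>Xs n \<omega>\<bar> \<le> C) \<Longrightarrow>
      (\<And>\<omega>. \<omega> \<in> space M \<Longrightarrow> (\<lambda>n. Xs n \<omega>) \<longlonglongrightarrow> X \<omega>) \<Longrightarrow> (\<lambda>n. e (Xs n)) \<longlonglongrightarrow> e X"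
begin

lemma e_cong_space:
  assumes "bounded_measurable M X" "bounded_measurable M Y" "\<And>\<omega>. \<omega> \<in> space M \<Longrightarrow> X \<omega> = Y \<omega>"
  shows "e X = e Y"
  using assms by (intro e_cong) auto

lemma mix_null_cong:
  assumes "A \<in> sets M" "measure M A = 0" "bounded_measurable M X" "bounded_measurable M Y" "bounded_measurable M Z"
  shows "e (mix A X Z) = e (mix A Y Z)"
proof -
  have "A \<in> null_sets M" using assms by (intro null_setsI) (simp_all add: emeasure_eq_measure)
  then have "AE \<omega> in M. \<omega> \<notin> A" by (rule AE_not_in)
  then have "AE \<omega> in M. mix A X Z \<omega> = mix A Y Z \<omega>" by eventually_elim (simp add: mix_def)
  then show ?thesis using assms by (intro e_cong bounded_measurable_mix)
qed

lemma sure_thing_compl: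
  assumes A: "A \<in> sets M" and bm: "bounded_measurable M X" "bounded_measurable M Y"
    "bounded_measurable M Z" "bounded_measurable M W"
    and le: "e (mix A Z X) \<le> e (mix A Z Y)"
  shows "e (mix A W X) \<le> e (mix A W Y)"
proof -
  have swap: "e (mix A U U') = e (mix (space M - A) U' U)" if "bounded_measurable M U" "bounded_measurable M U'" for U U'
    using A that by (intro e_cong_space bounded_measurable_mix) (auto simp: mix_def)
  show ?thesis
    using sure_thing[of "space M - A" X Y Z W] A bm le by (simp add: swap)
qed

lemma sure_thing_eq:
  assumes "A \<in> sets M" "bounded_measurable M X" "bounded_measurable M Y"
    "bounded_measurable M Z" "bounded_measurable M W"
  shows "e (mix A X Z) = e (mix A Y Z) \<Longrightarrow> e (mix A X W) = e (mix A Y W)"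
    and "e (mix A Z X) = e (mix A Z Y) \<Longrightarrow> e (mix A W X) = e (mix A W Y)"
  using sure_thing[of A X Y Z W] sure_thing[of A Y X Z W]
    sure_thing_compl[of A X Y Z W] sure_thing_compl[of A Y X Z W] assms
  by (auto intro: antisym)

lemma dichotomic_le:
  assumes "x \<le> y" "bounded_measurable M Z" "A \<in> sets M"
  shows "e (mix A (\<lambda>_. x) Z) \<le> e (mix A (\<lambda>_. y) Z)"
proof (cases "x < y \<and> 0 < measure M A")
  case True
  then show ?thesis using dichotomic assms by (simp add: less_imp_le)
next
  case False
  then have "x = y \<or> measure M A = 0" using assms by (auto simp: zero_less_measure_iff)
  then show ?thesis using mix_null_cong[of A "\<lambda>_. x" "\<lambda>_. y" Z] assms by auto
qed

text \<open>Where the pair (X, Y) is constant, replacing X by Y compares two constants on one event,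
  which is the dichotomic case; finitely many replacements lead from X to Y.\<close>

lemma e_mono_finite_range:
  assumes X: "bounded_measurable M X" and Y: "bounded_measurable M Y"
    and fin: "finite (X ` space M)" "finite (Y ` space M)"
    and le: "\<And>\<omega>. \<omega> \<in> space M \<Longrightarrow> X \<omega> \<le> Y \<omega>"
  shows "e X \<le> e Y"
proof -
  have [measurable]: "X \<in> borel_measurable M" "Y \<in> borel_measurable M"
    using X Y by (auto simp: bounded_measurable_def)
  let ?P = "(\<lambda>\<omega>. (X \<omega>, Y \<omega>)) ` space M"
  let ?B = "\<lambda>S. {\<omega>\<in>space M. (X \<omega>, Y \<omega>) \<in> S}"
  have meas: "?B S \<in> sets M" if "finite S" for S
  proof -
    have "?B S = (\<Union>s\<in>S. {\<omega>\<in>space M. X \<omega> = fst s \<and> Y \<omega> = snd s})" by auto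
    also have "\<dots> \<in> sets M" using that by (intro sets.finite_UN) auto
    finally show ?thesis .
  qed
  have "e X \<le> e (mix (?B S) Y X)" if "finite S" "S \<subseteq> ?P" for S
    using that
  proof induction
    case empty
    then show ?case by (simp add: mix_def)
  next
    case (insert s S)
    let ?A = "{\<omega>\<in>space M. (X \<omega>, Y \<omega>) = s}"
    have A: "?A \<in> sets M" using meas[of "{s}"] by simp
    have Z: "bounded_measurable M (mix (?B S) Y X)" using insert X Y by (intro bounded_measurable_mix meas)
    have "fst s \<le> snd s" using insert.prems le by auto
    then have "e (mix ?A (\<lambda>_. fst s) (mix (?B S) Y X)) \<le> e (mix ?A (\<lambda>_. snd s) (mix (?B S) Y X))"
      by (rule dichotomic_le[OF _ Z A])
    moreover have "mix ?A (\<lambda>_. fst s) (mix (?B S) Y X) = mix (?B S) Y X"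
      "mix ?A (\<lambda>_. snd s) (mix (?B S) Y X) = mix (?B (insert s S)) Y X"
      using insert.hyps by (auto simp: mix_def fun_eq_iff)
    ultimately show ?case using insert by simp
  qed
  moreover have P: "finite ?P"
    by (rule finite_subset[OF _ finite_cartesian_product[OF fin]]) auto
  ultimately have "e X \<le> e (mix (?B ?P) Y X)" by blast
  also have "\<dots> = e Y" using X Y P by (intro e_cong_space bounded_measurable_mix meas) (auto simp: mix_def)
  finally show ?thesis .
qed

text \<open>Rounding preserves the order and gives finite range; continuity removes the
  rounding.\<close>

lemma e_mono:
  assumes X: "bounded_measurable M X" and Y: "bounded_measurable M Y"
    and le: "\<And>\<omega>. \<omega> \<in> space M \<Longrightarrow> X \<omega> \<le> Y \<omega>"
  shows "e X \<le> e Y"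
proof -
  have lim: "(\<lambda>n. e (\<lambda>\<omega>. dyadic_floor n (U \<omega>))) \<longlonglongrightarrow> e U" if U: "bounded_measurable M U" for U
  proof -
    obtain C where "\<forall>\<omega>\<in>space M. \<bar>U \<omega>\<bar> \<le> C" using U by (auto simp: bounded_measurable_def)
    then show ?thesis
      using U by (intro e_continuous[where C = "C + 1"])
        (auto intro: bounded_measurable_dyadic_floor dyadic_floor_abs_le dyadic_floor_tendsto)
  qed
  have "e (\<lambda>\<omega>. dyadic_floor n (X \<omega>)) \<le> e (\<lambda>\<omega>. dyadic_floor n (Y \<omega>))" for n
    by (intro e_mono_finite_range bounded_measurable_dyadic_floor finite_range_dyadic_floor X Y
        dyadic_floor_mono le)
  then show ?thesis by (intro LIMSEQ_le[OF lim[OF X] lim[OF Y]]) auto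
qed

section \<open>Bets and the values of variables bounded by K\<close>

abbreviation bet :: "real \<Rightarrow> 'a set \<Rightarrow> 'a \<Rightarrow> real" where
  "bet K A \<equiv> mix A (\<lambda>_. K) (\<lambda>_. - K)"

text \<open>De Finetti's axiom is the sure-thing principle for bets: adding C to both events changes
  both bets in the same way on C and nowhere else.\<close>

lemma qualitative_probability_bet:
  assumes K: "0 < K" shows "qualitative_probability M (\<lambda>A. e (bet K A))"
proof
  show "nonatomic M" by (rule nonatomic)
next
  fix A B assume AB: "A \<in> sets M" "B \<in> sets M" "A \<subseteq> B"
  have eq: "mix (B - A) (\<lambda>_. - K) (bet K A) = bet K A" "mix (B - A) (\<lambda>_. K) (bet K A) = bet K B"
    using AB by (auto simp: mix_def fun_eq_iff)
  have bm: "bounded_measurable M (bet K A)" using AB by (intro bounded_measurable_mix) auto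
  show "e (bet K A) < e (bet K B)" if "0 < measure M (B - A)"
    using dichotomic[of "- K" K "bet K A" "B - A"] K AB that bm by (simp add: eq)
  show "e (bet K A) = e (bet K B)" if "measure M (B - A) = 0"
    using mix_null_cong[of "B - A" "\<lambda>_. - K" "\<lambda>_. K" "bet K A"] AB that bm by (simp add: eq)
next
  fix A B C assume ABC: "A \<in> sets M" "B \<in> sets M" "C \<in> sets M" "A \<inter> C = {}" "B \<inter> C = {}"
  have eq: "mix C (\<lambda>_. - K) (bet K A) = bet K A" "mix C (\<lambda>_. K) (bet K A) = bet K (A \<union> C)"
    "mix C (\<lambda>_. - K) (bet K B) = bet K B" "mix C (\<lambda>_. K) (bet K B) = bet K (B \<union> C)"
    using ABC by (auto simp: mix_def fun_eq_iff)
  have bm: "bounded_measurable M (bet K A)" "bounded_measurable M (bet K B)"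
    using ABC by (auto intro: bounded_measurable_mix)
  show "e (bet K (A \<union> C)) \<le> e (bet K (B \<union> C)) \<longleftrightarrow> e (bet K A) \<le> e (bet K B)"
    using sure_thing_compl[of C "bet K A" "bet K B" "\<lambda>_. K" "\<lambda>_. - K"]
      sure_thing_compl[of C "bet K A" "bet K B" "\<lambda>_. - K" "\<lambda>_. K"] ABC bm by (auto simp: eq)
next
  fix F :: "nat \<Rightarrow> 'a set" assume F: "range F \<subseteq> sets M" "incseq F"
  show "(\<lambda>n. e (bet K (F n))) \<longlonglongrightarrow> e (bet K (\<Union>n. F n))"
  proof (rule e_continuous)
    fix \<omega>
    have "\<forall>\<^sub>F n in sequentially. bet K (F n) \<omega> = bet K (\<Union>n. F n) \<omega>"
    proof (cases "\<omega> \<in> (\<Union>n. F n)")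
      case True
      then obtain m where "\<omega> \<in> F m" by blast
      then have "\<omega> \<in> F n" if "m \<le> n" for n using incseqD[OF F(2) that] by blast
      then show ?thesis using True by (auto simp: mix_def eventually_sequentially)
    qed (auto simp: mix_def)
    then show "(\<lambda>n. bet K (F n) \<omega>) \<longlonglongrightarrow> bet K (\<Union>n. F n) \<omega>" by (rule tendsto_eventually)
    show "\<bar>bet K (F n) \<omega>\<bar> \<le> \<bar>K\<bar>" for n by (simp add: mix_def)
  qed (use F in \<open>auto intro!: bounded_measurable_mix\<close>)
next
  fix F :: "nat \<Rightarrow> 'a set" assume F: "range F \<subseteq> sets M" "decseq F"
  show "(\<lambda>n. e (bet K (F n))) \<longlonglongrightarrow> e (bet K (\<Inter>n. F n))"
  proof (rule e_continuous)
    fix \<omega>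
    have "\<forall>\<^sub>F n in sequentially. bet K (F n) \<omega> = bet K (\<Inter>n. F n) \<omega>"
    proof (cases "\<omega> \<in> (\<Inter>n. F n)")
      case False
      then obtain m where "\<omega> \<notin> F m" by blast
      then have "\<omega> \<notin> F n" if "m \<le> n" for n using decseqD[OF F(2) that] by blast
      then show ?thesis using False by (auto simp: mix_def eventually_sequentially)
    qed (auto simp: mix_def)
    then show "(\<lambda>n. bet K (F n) \<omega>) \<longlonglongrightarrow> bet K (\<Inter>n. F n) \<omega>" by (rule tendsto_eventually)
    show "\<bar>bet K (F n) \<omega>\<bar> \<le> \<bar>K\<bar>" for n by (simp add: mix_def)
  qed (use F in \<open>auto intro!: bounded_measurable_mix\<close>)
qed

definition bounded_by :: "real \<Rightarrow> ('a \<Rightarrow> real) \<Rightarrow> bool" where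
  "bounded_by K X \<longleftrightarrow> X \<in> borel_measurable M \<and> (\<forall>\<omega>\<in>space M. \<bar>X \<omega>\<bar> \<le> K)"

lemma bounded_by_bounded: "bounded_by K X \<Longrightarrow> bounded_measurable M X"
  by (auto simp: bounded_by_def bounded_measurable_def)

lemma bounded_by_mix: "bounded_by K X \<Longrightarrow> bounded_by K Y \<Longrightarrow> A \<in> sets M \<Longrightarrow> bounded_by K (mix A X Y)"
  using bounded_measurable_mix[of M X Y A] bounded_by_bounded[of K X] bounded_by_bounded[of K Y]
  by (auto simp: bounded_by_def bounded_measurable_def mix_def)

lemma bounded_by_const: "\<bar>c\<bar> \<le> K \<Longrightarrow> bounded_by K (\<lambda>_. c)"
  by (simp add: bounded_by_def)

lemma bounded_by_bet: "0 < K \<Longrightarrow> A \<in> sets M \<Longrightarrow> bounded_by K (bet K A)"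
  by (intro bounded_by_mix bounded_by_const) auto

text \<open>Additivity is written as a modular identity without a reference variable. It is
  therefore stable under affine changes of V and under lowering K, which the comparison of different
  bounds requires.\<close>

definition order_valuation :: "real \<Rightarrow> (('a \<Rightarrow> real) \<Rightarrow> real) \<Rightarrow> bool" where
  "order_valuation K V \<longleftrightarrow>
     (\<forall>X Y. bounded_by K X \<longrightarrow> bounded_by K Y \<longrightarrow> e X \<le> e Y \<longrightarrow> V X \<le> V Y) \<and>
     (\<forall>X Y A. bounded_by K X \<longrightarrow> bounded_by K Y \<longrightarrow> A \<in> sets M \<longrightarrow> V (mix A X Y) + V (mix A Y X) = V X + V Y)"

text \<open>Every \<open>X\<close> with values in \<open>[-K, K]\<close> is indifferent to a bet \<open>K\<close> on \<open>A\<close>, \<open>-K\<close> off \<open>A\<close>, and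
  gets the subjective probability of \<open>A\<close> as its value. The bets replacing the two parts of a
  mixture over \<open>B\<close> can be chosen inside \<open>B\<close> and inside its complement, so that additivity
  over events gives additivity over mixtures.\<close>

lemma order_valuation_exists:
  assumes K: "0 < K"
  shows "\<exists>V. order_valuation K V \<and>
    (\<forall>X Y. bounded_by K X \<longrightarrow> bounded_by K Y \<longrightarrow> e X < e Y \<longrightarrow> V X < V Y) \<and>
    (\<forall>Xs X. (\<forall>n. bounded_by K (Xs n)) \<longrightarrow> bounded_by K X \<longrightarrow> (\<lambda>n. e (Xs n)) \<longlonglongrightarrow> e X \<longrightarrow> (\<lambda>n. V (Xs n)) \<longlonglongrightarrow> V X) \<and>
    (\<forall>V'. order_valuation K V' \<longrightarrow> (\<exists>c d. \<forall>X. bounded_by K X \<longrightarrow> V' X = c * V X + d))"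
proof -
  define q where "q A = e (bet K A)" for A
  interpret Q: qualitative_probability M q
    unfolding q_def by (rule qualitative_probability_bet[OF K])
  have wK: "bounded_by K (\<lambda>_. K)" "bounded_by K (\<lambda>_. - K)" using K by (auto intro: bounded_by_const)
  have bm: "bounded_measurable M X" if "bounded_by K X" for X using that by (rule bounded_by_bounded)
  have e_mono': "e X \<le> e Y" if "bounded_by K X" "bounded_by K Y" "\<And>\<omega>. \<omega> \<in> space M \<Longrightarrow> X \<omega> \<le> Y \<omega>" for X Y
    using that by (intro e_mono bm)
  have bounds: "- K \<le> X \<omega>" "X \<omega> \<le> K" if "bounded_by K X" "\<omega> \<in> space M" for X \<omega>
    using that by (auto simp: bounded_by_def abs_le_iff)
  have part: "\<exists>A. A \<in> sets M \<and> A \<subseteq> B \<and> q A = e (mix B X (\<lambda>_. - K))" if X: "bounded_by K X" and B: "B \<in> sets M" for X B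
  proof (rule Q.intermediate_value[of "{}" B "e (mix B X (\<lambda>_. - K))"])
    show "q {} \<le> e (mix B X (\<lambda>_. - K))" "e (mix B X (\<lambda>_. - K)) \<le> q B"
      unfolding q_def using X B bounds[OF X]
      by (intro e_mono' bounded_by_mix wK; simp add: mix_def)+
  qed (use B in auto)
  define a where "a X = (SOME A. A \<in> sets M \<and> q A = e X)" for X
  have a: "a X \<in> sets M" "q (a X) = e X" if X: "bounded_by K X" for X
  proof -
    have "e (mix (space M) X (\<lambda>_. - K)) = e X"
      using X wK by (intro e_cong_space bounded_measurable_mix bm) (auto simp: mix_def)
    then have "\<exists>A. A \<in> sets M \<and> q A = e X" using part[OF X, of "space M"] by auto
    from someI_ex[OF this] show "a X \<in> sets M" "q (a X) = e X" by (auto simp: a_def)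
  qed
  define V where "V X = Q.qprob (a X)" for X
  have V_eq: "V X = Q.qprob A" if "bounded_by K X" "A \<in> sets M" "q A = e X" for X A
    unfolding V_def using a[OF that(1)] that by (intro antisym Q.qprob_mono) auto
  have V_mono: "V X \<le> V Y" if "bounded_by K X" "bounded_by K Y" "e X \<le> e Y" for X Y
    unfolding V_def using a that by (intro Q.qprob_mono) auto
  have V_less: "V X < V Y" if "bounded_by K X" "bounded_by K Y" "e X < e Y" for X Y
    unfolding V_def using a that by (intro Q.qprob_less) auto
  have V_split: "V (mix B X Y) = V (mix B X (\<lambda>_. - K)) + V (mix B (\<lambda>_. - K) Y)"
    if X: "bounded_by K X" and Y: "bounded_by K Y" and B: "B \<in> sets M" for X Y B
  proof -
    obtain A1 where A1: "A1 \<in> sets M" "A1 \<subseteq> B" "q A1 = e (mix B X (\<lambda>_. - K))"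
      using part[OF X B] by blast
    obtain A2 where A2: "A2 \<in> sets M" "A2 \<subseteq> space M - B" "q A2 = e (mix (space M - B) Y (\<lambda>_. - K))"
      using part[OF Y, of "space M - B"] B by blast
    have A2': "q A2 = e (mix B (\<lambda>_. - K) Y)"
      unfolding A2(3) using Y B wK by (intro e_cong_space bounded_measurable_mix bm) (auto simp: mix_def)
    have eq: "mix B (bet K A1) (\<lambda>_. - K) = bet K A1" "mix B (\<lambda>_. - K) (bet K A2) = bet K A2"
      "mix B (bet K A1) (bet K A2) = bet K (A1 \<union> A2)"
      using A1 A2 by (auto simp: mix_def fun_eq_iff)
    have w: "bounded_by K (bet K A1)" "bounded_by K (bet K A2)" using A1 A2 K by (auto intro: bounded_by_bet)
    have "e (mix B X Y) = e (mix B (bet K A1) Y)"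
      by (rule sure_thing_eq(1)[OF B bm[OF X] bm[OF w(1)] bm[OF wK(2)] bm[OF Y]])
        (simp only: eq A1(3)[symmetric] q_def)
    also have "\<dots> = e (mix B (bet K A1) (bet K A2))"
      by (rule sure_thing_eq(2)[OF B bm[OF Y] bm[OF w(2)] bm[OF wK(2)] bm[OF w(1)]])
        (simp only: eq A2'[symmetric] q_def)
    finally have "q (A1 \<union> A2) = e (mix B X Y)" by (simp add: q_def eq)
    then have "V (mix B X Y) = Q.qprob (A1 \<union> A2)"
      using A1 A2 X Y B by (intro V_eq bounded_by_mix) auto
    also have "\<dots> = Q.qprob A1 + Q.qprob A2" using A1 A2 by (intro Q.qprob_additive) auto
    also have "Q.qprob A1 = V (mix B X (\<lambda>_. - K))"
      using A1 X B wK by (intro V_eq[symmetric] bounded_by_mix) auto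
    also have "Q.qprob A2 = V (mix B (\<lambda>_. - K) Y)"
      using A2 A2' Y B wK by (intro V_eq[symmetric] bounded_by_mix) auto
    finally show ?thesis .
  qed
  have V_val: "V (mix A X Y) + V (mix A Y X) = V X + V Y" if "bounded_by K X" "bounded_by K Y" "A \<in> sets M" for X Y A
  proof -
    have "mix A X X = X" "mix A Y Y = Y" by (simp_all add: mix_def)
    then show ?thesis
      using V_split[of X Y A] V_split[of Y X A] V_split[of X X A] V_split[of Y Y A] that by simp
  qed
  have V01: "0 \<le> V X" "V X \<le> 1" if "bounded_by K X" for X
  proof -
    have "0 \<le> Q.level 0 (a X) / 2 ^ 0" by simp
    then show "0 \<le> V X" unfolding V_def using Q.level_le_qprob[OF a(1)[OF that], of 0] by linarith
    have "a X \<subseteq> space M" using a(1)[OF that] by (rule sets.sets_into_space)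
    then show "V X \<le> 1"
      unfolding V_def Q.qprob_space[symmetric] using a[OF that] by (intro Q.qprob_mono Q.q_mono) auto
  qed
  \<comment> \<open>An event A of probability strictly between v and V X translates the bound v into
    a bound on \<open>e\<close>, where the limit is known; bounds outside [0, 1] are
    trivial.\<close>
  have V_cont: "(\<lambda>n. V (Xs n)) \<longlonglongrightarrow> V X"
    if Xs: "\<And>n. bounded_by K (Xs n)" and X: "bounded_by K X" and lim: "(\<lambda>n. e (Xs n)) \<longlonglongrightarrow> e X" for Xs X
  proof (rule order_tendstoI)
    fix v assume v: "v < V X"
    show "\<forall>\<^sub>F n in sequentially. v < V (Xs n)"
    proof (cases "0 \<le> v")
      case True
      obtain A where A: "A \<in> sets M" "v < Q.qprob A" "Q.qprob A < V X"
        using Q.qprob_dense[OF True v V01(2)[OF X]] by blast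
      then have "q A < e X"
        using Q.qprob_mono[OF a(1)[OF X] A(1)] a(2)[OF X] by (force simp: V_def)
      from order_tendstoD(1)[OF lim this] show ?thesis
      proof eventually_elim
        case (elim n)
        then have "Q.qprob A \<le> V (Xs n)"
          unfolding V_def using a[OF Xs] A by (intro Q.qprob_mono) auto
        then show ?case using A by simp
      qed
    next
      case False
      then show ?thesis using V01(1)[OF Xs] by (intro always_eventually allI) (meson less_le_trans not_le)
    qed
  next
    fix v assume v: "V X < v"
    show "\<forall>\<^sub>F n in sequentially. V (Xs n) < v"
    proof (cases "v \<le> 1")
      case True
      obtain A where A: "A \<in> sets M" "V X < Q.qprob A" "Q.qprob A < v"
        using Q.qprob_dense[OF V01(1)[OF X] v True] by blast
      then have "e X < q A"
        using Q.qprob_mono[OF A(1) a(1)[OF X]] a(2)[OF X] by (force simp: V_def)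
      from order_tendstoD(2)[OF lim this] show ?thesis
      proof eventually_elim
        case (elim n)
        then have "V (Xs n) \<le> Q.qprob A"
          unfolding V_def using a[OF Xs] A by (intro Q.qprob_mono) auto
        then show ?case using A by simp
      qed
    next
      case False
      then show ?thesis using V01(2)[OF Xs] by (intro always_eventually allI) (meson le_less_trans not_le)
    qed
  qed
  have V_unique: "\<exists>c d. \<forall>X. bounded_by K X \<longrightarrow> V' X = c * V X + d" if V': "order_valuation K V'" for V'
  proof -
    have V'_mono: "V' X \<le> V' Y" if "bounded_by K X" "bounded_by K Y" "e X \<le> e Y" for X Y
      using V' that by (auto simp: order_valuation_def)
    \<comment> \<open>Subtracting the value of the bet on the empty event turns the modular identity
      into additivity over disjoint events, so \<nu> is a multiple of \<open>qprob\<close>; that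
      multiple and the subtracted constant become c and d.\<close>
    define \<nu> where "\<nu> A = V' (bet K A) - V' (\<lambda>_. - K)" for A
    have "\<nu> A = Q.qprob A * \<nu> (space M)" if "A \<in> sets M" for A
    proof (rule Q.qprob_unique[OF _ _ that])
      fix A B assume AB: "A \<in> sets M" "B \<in> sets M" "A \<inter> B = {}"
      have "V' (mix A (bet K (A \<union> B)) (\<lambda>_. - K)) + V' (mix A (\<lambda>_. - K) (bet K (A \<union> B)))
          = V' (bet K (A \<union> B)) + V' (\<lambda>_. - K)"
        using V' AB K wK bounded_by_bet[of K "A \<union> B"] unfolding order_valuation_def by auto
      moreover have "mix A (bet K (A \<union> B)) (\<lambda>_. - K) = bet K A" "mix A (\<lambda>_. - K) (bet K (A \<union> B)) = bet K B"
        using AB by (auto simp: mix_def fun_eq_iff)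
      ultimately show "\<nu> (A \<union> B) = \<nu> A + \<nu> B" by (simp add: \<nu>_def)
    next
      fix A B assume "A \<in> sets M" "B \<in> sets M" "q A \<le> q B"
      then have "V' (bet K A) \<le> V' (bet K B)" using K by (intro V'_mono bounded_by_bet) (auto simp: q_def)
      then show "\<nu> A \<le> \<nu> B" by (simp add: \<nu>_def)
    qed
    moreover have "V' X = V' (bet K (a X))" if X: "bounded_by K X" for X
    proof -
      have "e (bet K (a X)) = e X" "bounded_by K (bet K (a X))"
        using a[OF X] K by (auto simp: q_def intro: bounded_by_bet)
      then show ?thesis using V'_mono X by (intro antisym) auto
    qed
    ultimately have "V' X = \<nu> (space M) * V X + V' (\<lambda>_. - K)" if "bounded_by K X" for X
      using a(1)[OF that] that unfolding V_def by (metis \<nu>_def diff_add_cancel mult.commute)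
    then show ?thesis by blast
  qed
  show ?thesis
    by (intro exI[of _ V] conjI) (use V_mono V_val V_less V_cont V_unique in \<open>auto simp: order_valuation_def\<close>)
qed

section \<open>Normalisation and independence of the bound\<close>

definition normalized_valuation :: "real \<Rightarrow> (('a \<Rightarrow> real) \<Rightarrow> real) \<Rightarrow> bool" where
  "normalized_valuation K V \<longleftrightarrow> order_valuation K V \<and> V (\<lambda>_. 0) = 0 \<and> V (\<lambda>_. 1) = 1 \<and>
    (\<forall>X Y. bounded_by K X \<longrightarrow> bounded_by K Y \<longrightarrow> e X < e Y \<longrightarrow> V X < V Y) \<and>
    (\<forall>Xs X. (\<forall>n. bounded_by K (Xs n)) \<longrightarrow> bounded_by K X \<longrightarrow> (\<lambda>n. e (Xs n)) \<longlonglongrightarrow> e X \<longrightarrow> (\<lambda>n. V (Xs n)) \<longlonglongrightarrow> V X)"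

lemma normalized_valuation_exists:
  assumes K: "1 \<le> K" shows "\<exists>V. normalized_valuation K V"
proof -
  obtain V where V: "order_valuation K V"
    "\<And>X Y. bounded_by K X \<Longrightarrow> bounded_by K Y \<Longrightarrow> e X < e Y \<Longrightarrow> V X < V Y"
    "\<And>Xs X. (\<And>n. bounded_by K (Xs n)) \<Longrightarrow> bounded_by K X \<Longrightarrow> (\<lambda>n. e (Xs n)) \<longlonglongrightarrow> e X \<Longrightarrow> (\<lambda>n. V (Xs n)) \<longlonglongrightarrow> V X"
    using order_valuation_exists[of K] K by auto
  have "e (mix (space M) (\<lambda>_. 0) (\<lambda>_. 0)) < e (mix (space M) (\<lambda>_. 1) (\<lambda>_. 0))"
    by (intro dichotomic) (auto simp: prob_space)
  also have "mix (space M) (\<lambda>_. 0) (\<lambda>_. 0) = (\<lambda>_. 0)" by (simp add: mix_def)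
  also have "e (mix (space M) (\<lambda>_. 1) (\<lambda>_. 0)) = e (\<lambda>_. 1)"
    by (intro e_cong_space bounded_measurable_mix) (auto simp: mix_def)
  finally have "V (\<lambda>_. 0) < V (\<lambda>_. 1)" using K by (intro V(2) bounded_by_const) auto
  define c where "c = V (\<lambda>_. 1) - V (\<lambda>_. 0)"
  have c: "0 < c" using \<open>V (\<lambda>_. 0) < V (\<lambda>_. 1)\<close> by (simp add: c_def)
  define W where "W X = (V X - V (\<lambda>_. 0)) / c" for X
  have "W (mix A X Y) + W (mix A Y X) = W X + W Y" if "bounded_by K X" "bounded_by K Y" "A \<in> sets M" for X Y A
  proof -
    have "V (mix A X Y) + V (mix A Y X) = V X + V Y" using V(1) that by (auto simp: order_valuation_def)
    then have "(V (mix A X Y) - V (\<lambda>_. 0)) + (V (mix A Y X) - V (\<lambda>_. 0)) = (V X - V (\<lambda>_. 0)) + (V Y - V (\<lambda>_. 0))"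
      by simp
    then show ?thesis unfolding W_def add_divide_distrib[symmetric] by simp
  qed
  moreover have "(\<lambda>n. W (Xs n)) \<longlonglongrightarrow> W X"
    if "\<And>n. bounded_by K (Xs n)" "bounded_by K X" "(\<lambda>n. e (Xs n)) \<longlonglongrightarrow> e X" for Xs X
    unfolding W_def using c by (intro tendsto_divide tendsto_diff V(3) that tendsto_const) auto
  moreover have "W (\<lambda>_. 0) = 0" "W (\<lambda>_. 1) = 1" using c by (auto simp: W_def c_def)
  moreover have "W X \<le> W Y" if "bounded_by K X" "bounded_by K Y" "e X \<le> e Y" for X Y
    unfolding W_def using V(1) that c by (intro divide_right_mono) (auto simp: order_valuation_def)
  moreover have "W X < W Y" if "bounded_by K X" "bounded_by K Y" "e X < e Y" for X Y
    unfolding W_def using V(2)[OF that] c by (intro divide_strict_right_mono) auto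
  ultimately have "normalized_valuation K W" unfolding normalized_valuation_def order_valuation_def by blast
  then show ?thesis by blast
qed

text \<open>The valuation for L restricts to one for K, so both are affine in a common valuation;
  their values at the constants 0 and 1, which lie in [-K, K], determine the coefficients.\<close>

lemma normalized_valuation_unique:
  assumes K: "1 \<le> K" "K \<le> L" and V: "normalized_valuation K V" and W: "normalized_valuation L W" and X: "bounded_by K X"
  shows "V X = W X"
proof -
  have bounded_by_mono: "bounded_by L X" if "bounded_by K X" for X using that K by (auto simp: bounded_by_def)
  have "order_valuation K W"
    using W bounded_by_mono unfolding normalized_valuation_def order_valuation_def by blast
  moreover have "order_valuation K V" using V by (simp add: normalized_valuation_def)
  moreover obtain U where U: "\<And>V'. order_valuation K V' \<Longrightarrow> \<exists>c d. \<forall>X. bounded_by K X \<longrightarrow> V' X = c * U X + d"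
    using order_valuation_exists[of K] K by auto
  ultimately obtain c d c' d' where cd: "\<And>X. bounded_by K X \<Longrightarrow> V X = c * U X + d" "\<And>X. bounded_by K X \<Longrightarrow> W X = c' * U X + d'"
    by metis
  let ?u = "U (\<lambda>_. 1) - U (\<lambda>_. 0)"
  have "bounded_by K (\<lambda>_. 0)" "bounded_by K (\<lambda>_. 1)" using K by (auto intro: bounded_by_const)
  then have n: "c * U (\<lambda>_. 0) + d = 0" "c' * U (\<lambda>_. 0) + d' = 0" "c * U (\<lambda>_. 1) + d = 1" "c' * U (\<lambda>_. 1) + d' = 1"
    using V W cd unfolding normalized_valuation_def by metis+
  then have "c * ?u = 1" "c' * ?u = 1" by (simp_all add: algebra_simps)
  then have "c = c'" by (metis mult_cancel_right zero_neq_one mult_zero_right)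
  moreover have "d = d'" using n \<open>c = c'\<close> by simp
  ultimately show ?thesis using cd X by simp
qed

text \<open>The choice of K and V is immaterial by uniqueness, which glues the valuations into one
  functional on all bounded variables.\<close>

definition val :: "('a \<Rightarrow> real) \<Rightarrow> real" where
  "val X = (SOME v. \<exists>K V. 1 \<le> K \<and> bounded_by K X \<and> normalized_valuation K V \<and> v = V X)"

lemma val_eq:
  assumes K: "1 \<le> K" and X: "bounded_by K X" and V: "normalized_valuation K V"
  shows "val X = V X"
proof -
  have "\<exists>v K V. 1 \<le> K \<and> bounded_by K X \<and> normalized_valuation K V \<and> v = V X" using assms by blast
  from someI_ex[OF this] obtain L W where L: "1 \<le> L" "bounded_by L X" "normalized_valuation L W" "val X = W X"
    unfolding val_def by blast
  have "V X = W X"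
  proof (cases "K \<le> L")
    case True
    then show ?thesis using normalized_valuation_unique[of K L V W X] assms L by simp
  next
    case False
    then show ?thesis using normalized_valuation_unique[of L K W V X] assms L by simp
  qed
  then show ?thesis using L by simp
qed

lemma bounded_by_exists:
  assumes "bounded_measurable M X" obtains K where "C \<le> K" "bounded_by K X"
proof -
  obtain D where "\<forall>\<omega>\<in>space M. \<bar>X \<omega>\<bar> \<le> D" "X \<in> borel_measurable M"
    using assms by (auto simp: bounded_measurable_def)
  then show ?thesis using that[of "max C D"] by (auto simp: bounded_by_def le_max_iff_disj)
qed

lemma val_order:
  assumes X: "bounded_measurable M X" and Y: "bounded_measurable M Y"
  shows "e X < e Y \<Longrightarrow> val X < val Y" "e X = e Y \<Longrightarrow> val X = val Y"
proof -
  obtain K where K: "1 \<le> K" "bounded_by K X" using bounded_by_exists[OF X] by blast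
  obtain L where L: "K \<le> L" "bounded_by L Y" using bounded_by_exists[OF Y] by blast
  then have w: "1 \<le> L" "bounded_by L X" "bounded_by L Y" using K by (auto simp: bounded_by_def)
  obtain V where V: "normalized_valuation L V" using normalized_valuation_exists w by blast
  have "val X = V X" "val Y = V Y" using val_eq V w by auto
  then show "e X < e Y \<Longrightarrow> val X < val Y" "e X = e Y \<Longrightarrow> val X = val Y"
    using V w by (auto simp: normalized_valuation_def order_valuation_def intro!: antisym)
qed

lemma val_additive_functional: "additive_functional M val"
proof
  fix X A assume X: "bounded_measurable M X" and A: "A \<in> sets M"
  obtain K where K: "1 \<le> K" "bounded_by K X" using bounded_by_exists[OF X] by blast
  obtain V where V: "normalized_valuation K V" using normalized_valuation_exists K by blast
  have w: "bounded_by K (\<lambda>_. 0)" using K by (intro bounded_by_const) simp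
  have "val X = V X" "val (mix A X (\<lambda>_. 0)) = V (mix A X (\<lambda>_. 0))" "val (mix A (\<lambda>_. 0) X) = V (mix A (\<lambda>_. 0) X)"
    using K A w by (auto intro!: val_eq[OF K(1) _ V] bounded_by_mix)
  moreover have "V (mix A X (\<lambda>_. 0)) + V (mix A (\<lambda>_. 0) X) = V X + V (\<lambda>_. 0)"
    using V K A w by (auto simp: normalized_valuation_def order_valuation_def)
  moreover have "V (\<lambda>_. 0) = 0" using V by (simp add: normalized_valuation_def)
  ultimately show "val X = val (mix A X (\<lambda>_. 0)) + val (mix A (\<lambda>_. 0) X)" by simp
next
  fix Xs :: "nat \<Rightarrow> 'a \<Rightarrow> real" and X C
  assume Xs: "\<And>n. bounded_measurable M (Xs n)" and X: "bounded_measurable M X"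
    and bd: "\<And>n \<omega>. \<omega> \<in> space M \<Longrightarrow> \<bar>Xs n \<omega>\<bar> \<le> C"
    and lim: "\<And>\<omega>. \<omega> \<in> space M \<Longrightarrow> (\<lambda>n. Xs n \<omega>) \<longlonglongrightarrow> X \<omega>"
  obtain K where K: "max 1 C \<le> K" "bounded_by K X" using bounded_by_exists[OF X] by blast
  then have K1: "1 \<le> K" by simp
  obtain V where V: "normalized_valuation K V" using normalized_valuation_exists K1 by blast
  have w: "bounded_by K (Xs n)" for n
    using Xs[of n] bd[of _ n] K by (force simp: bounded_by_def bounded_measurable_def)
  have "(\<lambda>n. e (Xs n)) \<longlonglongrightarrow> e X" using Xs X bd lim by (rule e_continuous)
  then have "(\<lambda>n. V (Xs n)) \<longlonglongrightarrow> V X" using V w K by (auto simp: normalized_valuation_def)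
  then show "(\<lambda>n. val (Xs n)) \<longlonglongrightarrow> val X"
    using val_eq[OF K1 _ V] w K by simp
qed

end

section \<open>Conditional nonlinear expectations\<close>

text \<open>\<open>msp M G\<close> records the measurable sets only; this one also carries the
  restriction of M, so that the density theorem can be applied on G.\<close>

abbreviation sub :: "'a measure \<Rightarrow> 'a set set \<Rightarrow> 'a measure" where
  "sub M G \<equiv> restr_to_subalg M (msp M G)"

lemma space_msp [simp]: "space (msp M G) = space M"
  by (simp add: msp_def space_measure_of_conv)

lemma sets_msp: "subsigma M G \<Longrightarrow> sets (msp M G) = G"
  by (simp add: msp_def subsigma_def sigma_algebra.sets_measure_of_eq)

lemma subsigma_sets [simp]: "subsigma M (sets M)"
  by (simp add: subsigma_def sets.sigma_algebra_axioms)

lemma subsigma_triv [simp]: "subsigma M (triv M)"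
  by (simp add: subsigma_def triv_def sigma_algebra_trivial)

lemma subsigmaD: "subsigma M G \<Longrightarrow> A \<in> G \<Longrightarrow> A \<in> sets M"
  by (auto simp: subsigma_def)

lemma subalgebra_msp: "subsigma M G \<Longrightarrow> subalgebra M (msp M G)"
  by (auto simp: subalgebra_def sets_msp subsigmaD)

lemma space_sub [simp]: "space (sub M G) = space M"
  by (simp add: space_restr_to_subalg)

lemma sets_sub: "subsigma M G \<Longrightarrow> sets (sub M G) = G"
  by (simp add: sets_restr_to_subalg subalgebra_msp sets_msp)

lemma measure_sub: "subsigma M G \<Longrightarrow> A \<in> G \<Longrightarrow> measure (sub M G) A = measure M A"
  by (simp add: measure_def emeasure_restr_to_subalg subalgebra_msp sets_msp)

lemma measurable_sub: "subsigma M G \<Longrightarrow> measurable (sub M G) N = measurable (msp M G) N"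
  by (intro measurable_cong_sets) (simp_all add: sets_sub sets_msp)

lemma Linf_iff: "subsigma M G \<Longrightarrow> Linf M G X \<longleftrightarrow> bounded_measurable (sub M G) X"
  by (simp add: Linf_def bounded_measurable_def measurable_sub)

lemma measurable_msp_sets: "measurable (msp M (sets M)) N = measurable M N"
  by (intro measurable_cong_sets) (simp_all add: sets_msp)

lemma Linf_sets_iff: "Linf M (sets M) X \<longleftrightarrow> bounded_measurable M X"
  by (simp add: Linf_def bounded_measurable_def measurable_msp_sets)

lemma bounded_measurable_sub:
  assumes "subsigma M G" "bounded_measurable (sub M G) X" shows "bounded_measurable M X"
proof -
  have "X \<in> borel_measurable (msp M G)"
    using assms(2) by (simp add: bounded_measurable_def measurable_sub[OF assms(1)])
  then have "X \<in> borel_measurable M" by (rule measurable_from_subalg[OF subalgebra_msp[OF assms(1)]])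
  then show ?thesis using assms(2) by (simp add: bounded_measurable_def)
qed

lemma utility_sub_iff:
  assumes G: "subsigma M G"
  shows "utility (sub M G) u \<longleftrightarrow> regular M G u \<and> (\<forall>x. integrable M (\<lambda>\<omega>. u \<omega> x))"
proof -
  have joint: "borel_measurable (sub M G \<Otimes>\<^sub>M borel) = borel_measurable (msp M G \<Otimes>\<^sub>M borel)"
    by (intro measurable_cong_sets sets_pair_measure_cong) (simp_all add: sets_sub sets_msp G)
  have "integrable (sub M G) (\<lambda>\<omega>. u \<omega> x) \<longleftrightarrow> integrable M (\<lambda>\<omega>. u \<omega> x)"
    if "(\<lambda>(\<omega>, x). u \<omega> x) \<in> borel_measurable (msp M G \<Otimes>\<^sub>M borel)" for x
  proof -
    have "(\<lambda>\<omega>. u \<omega> x) \<in> borel_measurable (msp M G)"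
      using measurable_compose[OF measurable_Pair2'[of x borel "msp M G"] that] by simp
    then show ?thesis
      using integrable_from_subalg[OF subalgebra_msp[OF G]] integrable_in_subalg[OF subalgebra_msp[OF G]] by blast
  qed
  then show ?thesis unfolding utility_def regular_def joint by auto
qed

lemma utility_iff: "utility M u \<longleftrightarrow> regular M (sets M) u \<and> (\<forall>x. integrable M (\<lambda>\<omega>. u \<omega> x))"
proof -
  have joint: "borel_measurable (msp M (sets M) \<Otimes>\<^sub>M borel) = borel_measurable (M \<Otimes>\<^sub>M borel)"
    by (intro measurable_cong_sets sets_pair_measure_cong) (simp_all add: sets_msp)
  show ?thesis unfolding utility_def regular_def joint by auto
qed

lemma utility_sub_measurable:
  assumes "subsigma M G" "utility (sub M G) v" "bounded_measurable (sub M G) Y"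
  shows "(\<lambda>\<omega>. v \<omega> (Y \<omega>)) \<in> borel_measurable (msp M G)"
  using utility_measurable_comp[OF assms(2), of Y] assms
  by (simp add: bounded_measurable_def measurable_sub)

lemma utility_sub_integrable:
  assumes "subsigma M G" "utility (sub M G) v" "bounded_measurable (sub M G) Y"
  shows "integrable M (\<lambda>\<omega>. v \<omega> (Y \<omega>))"
    and "(\<integral>\<omega>. v \<omega> (Y \<omega>) \<partial>sub M G) = (\<integral>\<omega>. v \<omega> (Y \<omega>) \<partial>M)"
  using integrable_from_subalg[OF subalgebra_msp utility_integrable] assms
    integral_subalgebra2[OF subalgebra_msp utility_sub_measurable, OF assms(1) assms] by auto

lemma integral_mix_zero:
  assumes "\<And>\<omega>. \<omega> \<in> space M \<Longrightarrow> v \<omega> 0 = 0"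
  shows "(\<integral>\<omega>. v \<omega> (mix A X (\<lambda>_. 0) \<omega>) \<partial>M) = (\<integral>\<omega>\<in>A. v \<omega> (X \<omega>) \<partial>M)"
  unfolding set_lebesgue_integral_def
  by (intro Bochner_Integration.integral_cong) (auto simp: mix_def assms)

text \<open>By strict monotonicity the set under the infimum is the open half-line above y.\<close>

lemma Phi_eq: "strict_mono (v \<omega>) \<Longrightarrow> Phi v \<omega> (v \<omega> y) = y"
  by (simp add: Phi_def strict_mono_less greaterThan_def[symmetric])

context prob_space
begin

lemma finite_measure_subalgebra_msp: "subsigma M G \<Longrightarrow> finite_measure_subalgebra M (msp M G)"
  by (intro finite_measure_subalgebra.intro finite_measure_subalgebra_axioms.intro)
    (auto simp: subalgebra_msp finite_measure_axioms)

lemma cond_exp_versionI: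
  assumes G: "subsigma M G" and h: "h \<in> borel_measurable (msp M G)" "integrable M h" "integrable M f"
    and eq: "\<And>A. A \<in> G \<Longrightarrow> (\<integral>\<omega>\<in>A. f \<omega> \<partial>M) = (\<integral>\<omega>\<in>A. h \<omega> \<partial>M)"
  shows "cond_exp_version M G f h"
proof -
  interpret finite_measure_subalgebra M "msp M G" by (rule finite_measure_subalgebra_msp[OF G])
  have "AE \<omega> in M. real_cond_exp M (msp M G) f \<omega> = h \<omega>"
    using h eq by (intro real_cond_exp_charact) (auto simp: sets_msp[OF G])
  then show ?thesis using h by (auto simp: cond_exp_version_def)
qed

lemma cond_exp_versionD:
  assumes G: "subsigma M G" and h: "cond_exp_version M G f h" "integrable M f" and A: "A \<in> G"
  shows "(\<integral>\<omega>\<in>A. f \<omega> \<partial>M) = (\<integral>\<omega>\<in>A. h \<omega> \<partial>M)"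
proof -
  interpret finite_measure_subalgebra M "msp M G" by (rule finite_measure_subalgebra_msp[OF G])
  have [measurable]: "h \<in> borel_measurable M"
    using h measurable_from_subalg[OF subalg] by (auto simp: cond_exp_version_def)
  have "(\<integral>\<omega>\<in>A. f \<omega> \<partial>M) = (\<integral>\<omega>\<in>A. real_cond_exp M (msp M G) f \<omega> \<partial>M)"
    using h A by (intro real_cond_exp_intA) (auto simp: sets_msp[OF G])
  also have "\<dots> = (\<integral>\<omega>\<in>A. h \<omega> \<partial>M)"
    using h(1) A subsigmaD[OF G] by (intro set_lebesgue_integral_cong_AE) (auto simp: cond_exp_version_def)
  finally show ?thesis .
qed

lemma utility_integral_less:
  assumes u: "utility M u" and X: "bounded_measurable M X" and Y: "bounded_measurable M Y"
    and le: "\<And>\<omega>. \<omega> \<in> space M \<Longrightarrow> X \<omega> \<le> Y \<omega>"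
    and A: "A \<in> sets M" "0 < measure M A" "\<And>\<omega>. \<omega> \<in> A \<Longrightarrow> X \<omega> < Y \<omega>"
  shows "(\<integral>\<omega>. u \<omega> (X \<omega>) \<partial>M) < (\<integral>\<omega>. u \<omega> (Y \<omega>) \<partial>M)"
proof (rule integral_less_AE[OF utility_integrable[OF u X] utility_integrable[OF u Y], of A])
  have mono: "strict_mono (u \<omega>)" if "\<omega> \<in> space M" for \<omega> using u that by (auto simp: utility_def)
  show "AE \<omega> in M. u \<omega> (X \<omega>) \<le> u \<omega> (Y \<omega>)"
    using mono le by (intro AE_I2) (simp add: strict_mono_less_eq)
  show "AE \<omega> in M. \<omega> \<in> A \<longrightarrow> u \<omega> (X \<omega>) \<noteq> u \<omega> (Y \<omega>)"
    using mono A by (intro AE_I2) (metis less_irrefl strict_monoD)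
qed (use A in \<open>auto simp: emeasure_eq_measure\<close>)

end

text \<open>The value is constructed on the whole nonatomic space; its defining properties pass to
  any G, atoms or not, and each restriction then has its own density-based utility.\<close>

lemma (in nonlinear_expectation) strict_additive_functional_sub:
  assumes G: "subsigma M G" shows "strict_additive_functional (sub M G) val"
proof -
  interpret V: additive_functional M val by (rule val_additive_functional)
  interpret S: prob_space "sub M G"
    by (rule prob_space_restr_to_subalg[OF subalgebra_msp[OF G] prob_space_axioms])
  note bm = bounded_measurable_sub[OF G]
  show ?thesis
  proof
    fix X A assume "bounded_measurable (sub M G) X" "A \<in> sets (sub M G)"
    then show "val X = val (mix A X (\<lambda>_. 0)) + val (mix A (\<lambda>_. 0) X)"
      using bm subsigmaD[OF G] by (intro V.additive) (auto simp: sets_sub G)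
  next
    fix Xs :: "nat \<Rightarrow> 'a \<Rightarrow> real" and X C
    assume "\<And>n. bounded_measurable (sub M G) (Xs n)" "bounded_measurable (sub M G) X"
      "\<And>n \<omega>. \<omega> \<in> space (sub M G) \<Longrightarrow> \<bar>Xs n \<omega>\<bar> \<le> C"
      "\<And>\<omega>. \<omega> \<in> space (sub M G) \<Longrightarrow> (\<lambda>n. Xs n \<omega>) \<longlonglongrightarrow> X \<omega>"
    then show "(\<lambda>n. val (Xs n)) \<longlonglongrightarrow> val X"
      using bm by (intro V.continuous[where C = C]) auto
  next
    fix A and x y :: real assume "A \<in> sets (sub M G)" "0 < measure (sub M G) A" "x < y"
    then show "val (mix A (\<lambda>_. x) (\<lambda>_. 0)) < val (mix A (\<lambda>_. y) (\<lambda>_. 0))"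
      using subsigmaD[OF G, of A]
      by (intro val_order(1) dichotomic bounded_measurable_mix) (auto simp: sets_sub measure_sub G)
  next
    fix A and x :: real assume "A \<in> sets (sub M G)" "measure (sub M G) A = 0"
    then have "e (mix A (\<lambda>_. x) (\<lambda>_. 0)) = e (mix A (\<lambda>_. 0) (\<lambda>_. 0))" and A: "A \<in> sets M"
      using subsigmaD[OF G, of A] by (auto intro!: mix_null_cong simp: sets_sub measure_sub G)
    then have "val (mix A (\<lambda>_. x) (\<lambda>_. 0)) = val (mix A (\<lambda>_. 0) (\<lambda>_. 0))"
      by (intro val_order(2) bounded_measurable_mix) auto
    also have "mix A (\<lambda>_. 0) (\<lambda>_. 0) = (\<lambda>_. 0)" by (simp add: mix_def)
    finally show "val (mix A (\<lambda>_. x) (\<lambda>_. 0)) = 0" by simp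
  qed
qed

lemma (in nonlinear_expectation) utility_representation:
  assumes G: "subsigma M G"
  shows "\<exists>v. utility (sub M G) v \<and> (\<forall>X. bounded_measurable (sub M G) X \<longrightarrow> val X = (\<integral>\<omega>. v \<omega> (X \<omega>) \<partial>M))"
proof -
  interpret S: strict_additive_functional "sub M G" val by (rule strict_additive_functional_sub[OF G])
  show ?thesis
    using S.utility_util S.expected_utility_representation utility_sub_integrable(2)[OF G S.utility_util] by auto
qed

section \<open>Families of conditional nonlinear expectations\<close>

locale expectation_family = prob_space M for M :: "'a measure" +
  fixes E :: "'a set set \<Rightarrow> ('a \<Rightarrow> real) \<Rightarrow> 'a \<Rightarrow> real"
  assumes nonatomic: "nonatomic M"
    and E_bounded: "subsigma M G \<Longrightarrow> bounded_measurable M X \<Longrightarrow> bounded_measurable (sub M G) (E G X)"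
    and E_cong: "subsigma M G \<Longrightarrow> bounded_measurable M X \<Longrightarrow> bounded_measurable M Y \<Longrightarrow>
      (AE \<omega> in M. X \<omega> = Y \<omega>) \<Longrightarrow> (AE \<omega> in M. E G X \<omega> = E G Y \<omega>)"
begin

lemma E_level_set:
  assumes "subsigma M G" "bounded_measurable M X" shows "{\<omega>\<in>space M. E G X \<omega> = c} \<in> G"
proof -
  have [measurable]: "E G X \<in> borel_measurable (sub M G)"
    using E_bounded[OF assms] by (simp add: bounded_measurable_def)
  have "{\<omega>\<in>space (sub M G). E G X \<omega> = c} \<in> sets (sub M G)" by measurable
  then show ?thesis by (simp add: sets_sub assms)
qed

text \<open>A level set measurable for the trivial \<sigma>-algebra is empty or everything, so the
  choice of evaluation point in \<open>E0\<close> does not matter.\<close>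

lemma E_triv:
  assumes X: "bounded_measurable M X" and \<omega>: "\<omega> \<in> space M" shows "E (triv M) X \<omega> = E0 M E X"
proof -
  let ?\<omega> = "SOME \<omega>. \<omega> \<in> space M"
  have \<omega>': "?\<omega> \<in> space M" using \<omega> by (rule someI)
  have "{\<omega>\<in>space M. E (triv M) X \<omega> = E (triv M) X ?\<omega>} \<in> triv M" by (intro E_level_set X) simp
  then have "{\<omega>\<in>space M. E (triv M) X \<omega> = E (triv M) X ?\<omega>} = space M" using \<omega>' by (auto simp: triv_def)
  then show ?thesis using \<omega> by (auto simp: E0_def)
qed

lemma E0_cong:
  assumes "bounded_measurable M X" "bounded_measurable M Y" "AE \<omega> in M. X \<omega> = Y \<omega>"
  shows "E0 M E X = E0 M E Y"
proof -
  have "AE \<omega> in M. E (triv M) X \<omega> = E (triv M) Y \<omega>" using assms by (intro E_cong) auto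
  then have "AE \<omega> in M. E0 M E X = E0 M E Y"
    using AE_space by eventually_elim (simp add: E_triv assms)
  then show ?thesis by (simp add: AE_const)
qed

lemma E0_cong_space:
  assumes "bounded_measurable M X" "bounded_measurable M Y" "\<And>\<omega>. \<omega> \<in> space M \<Longrightarrow> X \<omega> = Y \<omega>"
  shows "E0 M E X = E0 M E Y"
  using assms by (intro E0_cong) auto

lemma mix_eq_indicator:
  "\<omega> \<in> space M \<Longrightarrow> mix A X Z \<omega> = X \<omega> * indicator A \<omega> + Z \<omega> * indicator (space M - A) \<omega>"
  by (simp add: mix_def)

lemma mix_zero_eq_indicator: "mix A X (\<lambda>_. 0) = (\<lambda>\<omega>. X \<omega> * indicator A \<omega>)"
  by (auto simp: mix_def)

lemma bounded_measurable_dichotomic: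
  assumes "bounded_measurable M X" "bounded_measurable M Z" "A \<in> sets M"
  shows "bounded_measurable M (\<lambda>\<omega>. X \<omega> * indicator A \<omega> + Z \<omega> * indicator (space M - A) \<omega>)"
proof -
  have "bounded_measurable M (mix A X Z)" using assms by (intro bounded_measurable_mix)
  moreover have "(\<lambda>\<omega>. X \<omega> * indicator A \<omega> + Z \<omega> * indicator (space M - A) \<omega>) \<in> borel_measurable M
      \<longleftrightarrow> mix A X Z \<in> borel_measurable M"
    by (intro measurable_cong) (simp add: mix_eq_indicator)
  ultimately show ?thesis by (simp add: bounded_measurable_def mix_eq_indicator cong: ball_cong)
qed

lemma E0_dichotomic:
  assumes "bounded_measurable M X" "bounded_measurable M Z" "A \<in> sets M"
  shows "E0 M E (\<lambda>\<omega>. X \<omega> * indicator A \<omega> + Z \<omega> * indicator (space M - A) \<omega>) = E0 M E (mix A X Z)"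
  using assms by (intro E0_cong_space bounded_measurable_dichotomic bounded_measurable_mix)
    (auto simp: mix_eq_indicator)

lemma E0_strict_mono:
  assumes mono: "strictly_monotone_dichotomic M (E0 M E)"
    and "x < y" "bounded_measurable M Z" "A \<in> sets M" "0 < measure M A"
  shows "E0 M E (mix A (\<lambda>_. x) Z) < E0 M E (mix A (\<lambda>_. y) Z)"
  using mono[unfolded strictly_monotone_dichotomic_def Linf_sets_iff, rule_format, OF assms(2-5)]
    E0_dichotomic[of "\<lambda>_. x" Z A] E0_dichotomic[of "\<lambda>_. y" Z A] assms by simp

text \<open>The conditional expectation of \<open>mix A X Z\<close> given \<open>\<sigma>(A)\<close> is constant on \<open>A\<close>, with a value
  depending on \<open>X\<close> only; time consistency reduces the comparison to that of these constants.\<close>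

lemma E0_sure_thing:
  assumes cne: "cond_nonlin_exp M E" and tc: "time_consistent M E"
    and mono: "strictly_monotone_dichotomic M (E0 M E)"
    and A: "A \<in> sets M" and bm: "bounded_measurable M X" "bounded_measurable M Y" "bounded_measurable M Z" "bounded_measurable M W"
    and le: "E0 M E (mix A X Z) \<le> E0 M E (mix A Y Z)"
  shows "E0 M E (mix A X W) \<le> E0 M E (mix A Y W)"
proof (cases "measure M A = 0")
  case True
  then have "A \<in> null_sets M" using A by (intro null_setsI) (simp_all add: emeasure_eq_measure)
  then have "AE \<omega> in M. \<omega> \<notin> A" by (rule AE_not_in)
  then have "AE \<omega> in M. mix A X W \<omega> = mix A Y W \<omega>" by eventually_elim (simp add: mix_def)
  then have "E0 M E (mix A X W) = E0 M E (mix A Y W)"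
    using A bm by (intro E0_cong bounded_measurable_mix)
  then show ?thesis by simp
next
  case False
  then have pos: "0 < measure M A" by (simp add: zero_less_measure_iff)
  then have "A \<noteq> {}" by auto
  then obtain \<omega>0 where \<omega>0: "\<omega>0 \<in> A" by auto
  define G where "G = {{}, A, space M - A, space M}"
  have A_sub: "A \<subseteq> space M" using A by (rule sets.sets_into_space)
  have G: "subsigma M G"
    unfolding subsigma_def G_def using A sigma_algebra_single_set[OF A_sub] by auto
  have AG: "A \<in> G" "space M - A \<in> G" by (auto simp: G_def)
  have bmE: "bounded_measurable M (E G U)" if "bounded_measurable M U" for U
    using bounded_measurable_sub[OF G E_bounded[OF G that]] .
  have const: "E G U \<omega> = E G U \<omega>0" if U: "bounded_measurable M U" and "\<omega> \<in> A" for U \<omega>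
  proof -
    have "{\<omega>\<in>space M. E G U \<omega> = E G U \<omega>0} \<in> G" by (rule E_level_set[OF G U])
    moreover have "\<omega>0 \<in> {\<omega>\<in>space M. E G U \<omega> = E G U \<omega>0}" using \<omega>0 A_sub by auto
    ultimately have "A \<subseteq> {\<omega>\<in>space M. E G U \<omega> = E G U \<omega>0}" unfolding G_def using \<omega>0 A_sub by blast
    then show ?thesis using that by blast
  qed
  \<comment> \<open>Locality: on an event B of G the conditional value depends on the variable
    through its restriction to B alone, because multiplying by the indicator of B commutes with
    \<open>E G\<close>.\<close>
  have loc: "AE \<omega> in M. \<omega> \<in> B \<longrightarrow> E G U \<omega> = E G U' \<omega>"
    if "bounded_measurable M U" "bounded_measurable M U'" "B \<in> G" "\<And>\<omega>. \<omega> \<in> B \<Longrightarrow> U \<omega> = U' \<omega>" for B U U'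
  proof -
    have "AE \<omega> in M. E G (\<lambda>\<omega>. U \<omega> * indicator B \<omega>) \<omega> = E G U \<omega> * indicator B \<omega>"
      "AE \<omega> in M. E G (\<lambda>\<omega>. U' \<omega> * indicator B \<omega>) \<omega> = E G U' \<omega> * indicator B \<omega>"
      using cne G that by (auto simp: cond_nonlin_exp_def Linf_sets_iff)
    moreover have "(\<lambda>\<omega>. U \<omega> * indicator B \<omega>) = (\<lambda>\<omega>. U' \<omega> * indicator B \<omega> :: real)"
      using that by (auto simp: fun_eq_iff indicator_def)
    ultimately show ?thesis by (auto elim!: AE_mp simp: indicator_def)
  qed
  have red: "E0 M E (mix A U U') = E0 M E (mix A (\<lambda>_. E G U \<omega>0) (E G U'))"
    if U: "bounded_measurable M U" and U': "bounded_measurable M U'" for U U'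
  proof -
    have UU': "bounded_measurable M (mix A U U')" using U U' A by (intro bounded_measurable_mix)
    have "AE \<omega> in M. \<omega> \<in> A \<longrightarrow> E G (mix A U U') \<omega> = E G U \<omega>"
      by (rule loc[OF UU' U AG(1)]) (simp add: mix_def)
    moreover have "AE \<omega> in M. \<omega> \<in> space M - A \<longrightarrow> E G (mix A U U') \<omega> = E G U' \<omega>"
      by (rule loc[OF UU' U' AG(2)]) (simp add: mix_def)
    ultimately have "AE \<omega> in M. E G (mix A U U') \<omega> = mix A (\<lambda>_. E G U \<omega>0) (E G U') \<omega>"
      using AE_space by eventually_elim (auto simp: mix_def const[OF U])
    then have "E0 M E (E G (mix A U U')) = E0 M E (mix A (\<lambda>_. E G U \<omega>0) (E G U'))"
      using UU' U U' A by (intro E0_cong bounded_measurable_mix bmE) auto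
    then show ?thesis using tc G UU' by (auto simp: time_consistent_def Linf_sets_iff)
  qed
  have less: "E0 M E (mix A (\<lambda>_. x) U) < E0 M E (mix A (\<lambda>_. y) U)" if "x < y" "bounded_measurable M U" for x y U
    using E0_strict_mono[OF mono that A pos] .
  \<comment> \<open>By \<open>red\<close> both sides carry constants on A against the same
    \<open>E G Z\<close>, so strict monotonicity extracts the order of the constants; the same order
    then applies against \<open>E G W\<close>.\<close>
  have "E G X \<omega>0 \<le> E G Y \<omega>0"
    using le less[of "E G Y \<omega>0" "E G X \<omega>0" "E G Z"] bmE bm by (force simp: red)
  then show ?thesis
    using less[of "E G X \<omega>0" "E G Y \<omega>0" "E G W"] bmE bm by (cases "E G X \<omega>0 = E G Y \<omega>0") (auto simp: red)
qed

lemma nonlinear_expectation_E0: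
  assumes cne: "cond_nonlin_exp M E" and tc: "time_consistent M E"
    and mono: "strictly_monotone_dichotomic M (E0 M E)" and cont: "pointwise_continuous M (E0 M E)"
  shows "nonlinear_expectation M (E0 M E)"
proof
  show "nonatomic M" by (rule nonatomic)
next
  fix X Y assume "bounded_measurable M X" "bounded_measurable M Y" "AE \<omega> in M. X \<omega> = Y \<omega>"
  then show "E0 M E X = E0 M E Y" by (rule E0_cong)
next
  fix A X Y Z W
  assume "A \<in> sets M" "bounded_measurable M X" "bounded_measurable M Y" "bounded_measurable M Z" "bounded_measurable M W"
    "E0 M E (mix A X Z) \<le> E0 M E (mix A Y Z)"
  then show "E0 M E (mix A X W) \<le> E0 M E (mix A Y W)" by (rule E0_sure_thing[OF cne tc mono])
next
  fix x y :: real and Z A assume "x < y" "bounded_measurable M Z" "A \<in> sets M" "0 < measure M A"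
  then show "E0 M E (mix A (\<lambda>_. x) Z) < E0 M E (mix A (\<lambda>_. y) Z)" by (rule E0_strict_mono[OF mono])
next
  fix Xs :: "nat \<Rightarrow> 'a \<Rightarrow> real" and X C
  assume "\<And>n. bounded_measurable M (Xs n)" "bounded_measurable M X"
    "\<And>n \<omega>. \<omega> \<in> space M \<Longrightarrow> \<bar>Xs n \<omega>\<bar> \<le> C" "\<And>\<omega>. \<omega> \<in> space M \<Longrightarrow> (\<lambda>n. Xs n \<omega>) \<longlonglongrightarrow> X \<omega>"
  then show "(\<lambda>n. E0 M E (Xs n)) \<longlonglongrightarrow> E0 M E X"
    by (intro cont[unfolded pointwise_continuous_def Linf_sets_iff, rule_format] AE_I2) auto
qed

section \<open>From the axioms to the representation\<close>

definition represented_by :: "('a \<Rightarrow> real \<Rightarrow> real) \<Rightarrow> bool" where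
  "represented_by u \<longleftrightarrow> (\<forall>G. subsigma M G \<longrightarrow>
      (\<exists>uG. regular M G uG \<and>
         (\<forall>x. integrable M (\<lambda>\<omega>. uG \<omega> x) \<and> cond_exp_version M G (\<lambda>\<omega>. u \<omega> x) (\<lambda>\<omega>. uG \<omega> x)) \<and>
         (\<forall>X. Linf M (sets M) X \<longrightarrow>
            (\<exists>h. cond_exp_version M G (\<lambda>\<omega>. u \<omega> (X \<omega>)) h \<and>
                 (\<forall>\<omega>\<in>space M. h \<omega> \<in> range (uG \<omega>)) \<and>
                 (AE \<omega> in M. E G X \<omega> = Phi uG \<omega> (h \<omega>))))))"

theorem representation:
  assumes cne: "cond_nonlin_exp M E" and tc: "time_consistent M E"
    and mono: "strictly_monotone_dichotomic M (E0 M E)" and cont: "pointwise_continuous M (E0 M E)"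
  shows "\<exists>u. utility M u \<and> represented_by u"
proof -
  interpret NE: nonlinear_expectation M "E0 M E" by (rule nonlinear_expectation_E0[OF assms])
  have bm_sets: "bounded_measurable (sub M (sets M)) X \<longleftrightarrow> bounded_measurable M X" for X
    using Linf_iff[OF subsigma_sets, of M X] by (simp add: Linf_sets_iff)
  obtain u where "utility (sub M (sets M)) u"
    and repu: "\<And>X. bounded_measurable M X \<Longrightarrow> NE.val X = (\<integral>\<omega>. u \<omega> (X \<omega>) \<partial>M)"
    using NE.utility_representation[OF subsigma_sets] by (auto simp: bm_sets)
  then have u: "utility M u" unfolding utility_sub_iff[OF subsigma_sets] utility_iff[of M] by blast
  have u0: "u \<omega> 0 = 0" if "\<omega> \<in> space M" for \<omega> using u that by (simp add: utility_def)
  have "represented_by u"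
    unfolding represented_by_def
  proof (intro allI impI)
    fix G assume G: "subsigma M G"
    obtain v where v: "utility (sub M G) v"
      and repv: "\<And>X. bounded_measurable (sub M G) X \<Longrightarrow> NE.val X = (\<integral>\<omega>. v \<omega> (X \<omega>) \<partial>M)"
      using NE.utility_representation[OF G] by blast
    have v0: "v \<omega> 0 = 0" and v_mono: "strict_mono (v \<omega>)" if "\<omega> \<in> space M" for \<omega>
      using v that by (simp_all add: utility_def)
    \<comment> \<open>Equal values on all events of G mean equal integrals of u(X) and v(Y) over
      them. With X and Y the same constant this identifies v as a conditional version of u; with Y =
      \<open>E G X\<close> it gives the formula.\<close>
    have version: "cond_exp_version M G (\<lambda>\<omega>. u \<omega> (X \<omega>)) (\<lambda>\<omega>. v \<omega> (Y \<omega>))"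
      if X: "bounded_measurable M X" and Y: "bounded_measurable (sub M G) Y"
        and eq: "\<And>A. A \<in> G \<Longrightarrow> NE.val (mix A X (\<lambda>_. 0)) = NE.val (mix A Y (\<lambda>_. 0))" for X Y
    proof (rule cond_exp_versionI[OF G utility_sub_measurable[OF G v Y] utility_sub_integrable(1)[OF G v Y] utility_integrable[OF u X]])
      fix A assume A: "A \<in> G"
      have "(\<integral>\<omega>\<in>A. u \<omega> (X \<omega>) \<partial>M) = NE.val (mix A X (\<lambda>_. 0))"
        using X A subsigmaD[OF G] u0 by (simp add: repu bounded_measurable_mix integral_mix_zero)
      also have "\<dots> = (\<integral>\<omega>\<in>A. v \<omega> (Y \<omega>) \<partial>M)"
        using Y A v0 by (simp add: eq repv bounded_measurable_mix sets_sub G integral_mix_zero)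
      finally show "(\<integral>\<omega>\<in>A. u \<omega> (X \<omega>) \<partial>M) = (\<integral>\<omega>\<in>A. v \<omega> (Y \<omega>) \<partial>M)" .
    qed
    show "\<exists>uG. regular M G uG \<and>
         (\<forall>x. integrable M (\<lambda>\<omega>. uG \<omega> x) \<and> cond_exp_version M G (\<lambda>\<omega>. u \<omega> x) (\<lambda>\<omega>. uG \<omega> x)) \<and>
         (\<forall>X. Linf M (sets M) X \<longrightarrow>
            (\<exists>h. cond_exp_version M G (\<lambda>\<omega>. u \<omega> (X \<omega>)) h \<and>
                 (\<forall>\<omega>\<in>space M. h \<omega> \<in> range (uG \<omega>)) \<and>
                 (AE \<omega> in M. E G X \<omega> = Phi uG \<omega> (h \<omega>))))"
    proof (intro exI[of _ v] conjI allI impI)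
      show "regular M G v" "integrable M (\<lambda>\<omega>. v \<omega> x)" for x
        using v by (simp_all add: utility_sub_iff G)
      show "cond_exp_version M G (\<lambda>\<omega>. u \<omega> x) (\<lambda>\<omega>. v \<omega> x)" for x
        by (rule version[of "\<lambda>_. x" "\<lambda>_. x"]) simp_all
    next
      fix X assume "Linf M (sets M) X"
      then have X: "bounded_measurable M X" by (simp add: Linf_sets_iff)
      note EX = E_bounded[OF G X]
      show "\<exists>h. cond_exp_version M G (\<lambda>\<omega>. u \<omega> (X \<omega>)) h \<and>
                 (\<forall>\<omega>\<in>space M. h \<omega> \<in> range (v \<omega>)) \<and> (AE \<omega> in M. E G X \<omega> = Phi v \<omega> (h \<omega>))"
      \<comment> \<open>Taking h as v evaluated at \<open>E G X\<close> puts it in the range of v at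
        every point, where \<open>Phi\<close> is the exact inverse.\<close>
      proof (intro exI[of _ "\<lambda>\<omega>. v \<omega> (E G X \<omega>)"] conjI ballI)
        show "AE \<omega> in M. E G X \<omega> = Phi v \<omega> (v \<omega> (E G X \<omega>))"
          using v_mono by (intro AE_I2) (simp add: Phi_eq)
        show "cond_exp_version M G (\<lambda>\<omega>. u \<omega> (X \<omega>)) (\<lambda>\<omega>. v \<omega> (E G X \<omega>))"
        proof (rule version[OF X EX])
          fix A assume A: "A \<in> G"
          note bmA = bounded_measurable_mix[OF _ bounded_measurable_const subsigmaD[OF G A], of _ 0]
          have "E0 M E (mix A X (\<lambda>_. 0)) = E0 M E (E G (mix A X (\<lambda>_. 0)))"
            using tc G bmA[OF X] by (simp add: time_consistent_def Linf_sets_iff)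
          also have "\<dots> = E0 M E (mix A (E G X) (\<lambda>_. 0))"
          proof (rule E0_cong)
            show "bounded_measurable M (E G (mix A X (\<lambda>_. 0)))"
              by (rule bounded_measurable_sub[OF G E_bounded[OF G bmA[OF X]]])
            show "bounded_measurable M (mix A (E G X) (\<lambda>_. 0))"
              by (rule bmA[OF bounded_measurable_sub[OF G EX]])
            show "AE \<omega> in M. E G (mix A X (\<lambda>_. 0)) \<omega> = mix A (E G X) (\<lambda>_. 0) \<omega>"
              using cne G X A by (simp add: cond_nonlin_exp_def Linf_sets_iff mix_zero_eq_indicator)
          qed
          finally show "NE.val (mix A X (\<lambda>_. 0)) = NE.val (mix A (E G X) (\<lambda>_. 0))"
            using bmA[OF X] bmA[OF bounded_measurable_sub[OF G EX]] by (intro NE.val_order(2))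
        qed
      qed simp
    qed
  qed
  with u show ?thesis by blast
qed

section \<open>From the representation back to the axioms\<close>

context
  fixes u assumes u: "utility M u" and rep: "represented_by u"
begin

text \<open>The formula makes v(E_G(X)) a version of E[u(X) | G], but v is tied to u at constant
  arguments only. As functionals on G-measurable variables both integrals are additive, so the
  agreement extends to the random argument \<open>E G X\<close>.\<close>

lemma integral_E:
  assumes G: "subsigma M G" and X: "bounded_measurable M X" and A: "A \<in> G"
  shows "(\<integral>\<omega>. u \<omega> (mix A (E G X) (\<lambda>_. 0) \<omega>) \<partial>M) = (\<integral>\<omega>. u \<omega> (mix A X (\<lambda>_. 0) \<omega>) \<partial>M)"
proof -
  have u0: "u \<omega> 0 = 0" if "\<omega> \<in> space M" for \<omega> using u that by (simp add: utility_def)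
  from rep[unfolded represented_by_def Linf_sets_iff, rule_format, OF G] obtain v where
    "regular M G v" "\<forall>x. integrable M (\<lambda>\<omega>. v \<omega> x) \<and> cond_exp_version M G (\<lambda>\<omega>. u \<omega> x) (\<lambda>\<omega>. v \<omega> x)"
    and ex: "\<forall>X. bounded_measurable M X \<longrightarrow> (\<exists>h. cond_exp_version M G (\<lambda>\<omega>. u \<omega> (X \<omega>)) h \<and>
      (\<forall>\<omega>\<in>space M. h \<omega> \<in> range (v \<omega>)) \<and> (AE \<omega> in M. E G X \<omega> = Phi v \<omega> (h \<omega>)))"
    by (elim exE conjE)
  then have v: "utility (sub M G) v"
    and version: "\<And>x. cond_exp_version M G (\<lambda>\<omega>. u \<omega> x) (\<lambda>\<omega>. v \<omega> x)"
    by (simp_all add: utility_sub_iff G)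
  from ex[rule_format, OF X] obtain h where h: "cond_exp_version M G (\<lambda>\<omega>. u \<omega> (X \<omega>)) h"
    "\<forall>\<omega>\<in>space M. h \<omega> \<in> range (v \<omega>)" "AE \<omega> in M. E G X \<omega> = Phi v \<omega> (h \<omega>)"
    by (elim exE conjE)
  have v0: "v \<omega> 0 = 0" and v_mono: "strict_mono (v \<omega>)" if "\<omega> \<in> space M" for \<omega>
    using v that by (simp_all add: utility_def)
  note EX = E_bounded[OF G X]
  have Y: "bounded_measurable (sub M G) (mix A (E G X) (\<lambda>_. 0))"
    using EX A by (intro bounded_measurable_mix) (simp_all add: sets_sub G)
  have "additive_functional (sub M G) (\<lambda>Y. \<integral>\<omega>. u \<omega> (Y \<omega>) \<partial>M)"
  proof -
    interpret U: additive_functional M "\<lambda>Y. \<integral>\<omega>. u \<omega> (Y \<omega>) \<partial>M" by (rule utility_additive_functional[OF u])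
    show ?thesis
      by standard (auto intro!: U.additive U.continuous bounded_measurable_sub[OF G] simp: sets_sub G subsigmaD[OF G])
  qed
  then have "(\<integral>\<omega>. u \<omega> (mix A (E G X) (\<lambda>_. 0) \<omega>) \<partial>M) = (\<integral>\<omega>. v \<omega> (mix A (E G X) (\<lambda>_. 0) \<omega>) \<partial>sub M G)"
  proof (rule additive_functional_eqI[OF _ utility_additive_functional[OF v] _ Y])
    fix B n and x :: real assume "B \<in> sets (sub M G)"
    then have B: "B \<in> G" by (simp add: sets_sub G)
    let ?r = "dyadic_floor n x"
    have "(\<integral>\<omega>\<in>B. u \<omega> ?r \<partial>M) = (\<integral>\<omega>\<in>B. v \<omega> ?r \<partial>M)"
      using u by (intro cond_exp_versionD[OF G version _ B]) (simp add: utility_def)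
    moreover have "bounded_measurable (sub M G) (mix B (\<lambda>_. ?r) (\<lambda>_. 0))"
      using B by (intro bounded_measurable_mix) (simp_all add: sets_sub G)
    ultimately show "(\<integral>\<omega>. u \<omega> (mix B (\<lambda>_. ?r) (\<lambda>_. 0) \<omega>) \<partial>M) = (\<integral>\<omega>. v \<omega> (mix B (\<lambda>_. ?r) (\<lambda>_. 0) \<omega>) \<partial>sub M G)"
      using u0 v0 by (simp add: utility_sub_integrable(2)[OF G v] integral_mix_zero)
  qed
  also have "\<dots> = (\<integral>\<omega>. v \<omega> (mix A (E G X) (\<lambda>_. 0) \<omega>) \<partial>M)" by (rule utility_sub_integrable(2)[OF G v Y])
  also have "\<dots> = (\<integral>\<omega>\<in>A. v \<omega> (E G X \<omega>) \<partial>M)" using v0 by (rule integral_mix_zero)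
  also have "\<dots> = (\<integral>\<omega>\<in>A. h \<omega> \<partial>M)"
  proof (rule set_lebesgue_integral_cong_AE)
    show "A \<in> sets M" by (rule subsigmaD[OF G A])
    show "(\<lambda>\<omega>. v \<omega> (E G X \<omega>)) \<in> borel_measurable M"
      using utility_sub_integrable(1)[OF G v EX] by (rule borel_measurable_integrable)
    show "h \<in> borel_measurable M"
      using h(1) measurable_from_subalg[OF subalgebra_msp[OF G]] by (auto simp: cond_exp_version_def)
    show "AE \<omega> \<in> A in M. v \<omega> (E G X \<omega>) = h \<omega>"
      using h(3) AE_space
    proof eventually_elim
      case (elim \<omega>)
      obtain y where "h \<omega> = v \<omega> y" using h(2) elim(2) by blast
      then show ?case using elim Phi_eq[of v \<omega> y] v_mono[OF elim(2)] by simp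
    qed
  qed
  also have "\<dots> = (\<integral>\<omega>\<in>A. u \<omega> (X \<omega>) \<partial>M)"
    by (rule cond_exp_versionD[OF G h(1) utility_integrable[OF u X] A, symmetric])
  also have "\<dots> = (\<integral>\<omega>. u \<omega> (mix A X (\<lambda>_. 0) \<omega>) \<partial>M)" using u0 by (rule integral_mix_zero[symmetric])
  finally show ?thesis .
qed

lemma integral_E_space:
  assumes G: "subsigma M G" and X: "bounded_measurable M X"
  shows "(\<integral>\<omega>. u \<omega> (E G X \<omega>) \<partial>M) = (\<integral>\<omega>. u \<omega> (X \<omega>) \<partial>M)"
proof -
  have "space M \<in> G" using sets.top[of "sub M G"] by (simp add: sets_sub G)
  moreover have "(\<integral>\<omega>. u \<omega> (mix (space M) Z (\<lambda>_. 0) \<omega>) \<partial>M) = (\<integral>\<omega>. u \<omega> (Z \<omega>) \<partial>M)" for Z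
    by (intro Bochner_Integration.integral_cong) (auto simp: mix_def)
  ultimately show ?thesis using integral_E[OF G X] by metis
qed

lemma integral_E0:
  assumes X: "bounded_measurable M X"
  shows "(\<integral>\<omega>. u \<omega> (E0 M E X) \<partial>M) = (\<integral>\<omega>. u \<omega> (X \<omega>) \<partial>M)"
proof -
  have "(\<integral>\<omega>. u \<omega> (E0 M E X) \<partial>M) = (\<integral>\<omega>. u \<omega> (E (triv M) X \<omega>) \<partial>M)"
    by (intro Bochner_Integration.integral_cong) (auto simp: E_triv[OF X])
  then show ?thesis using integral_E_space[OF subsigma_triv X] by simp
qed

text \<open>Expected utility is strictly increasing along constants, so statements about expected
  utilities of \<open>E0\<close> values can be read back as statements about the values.\<close>

lemma integral_const_less_iff: "(\<integral>\<omega>. u \<omega> x \<partial>M) < (\<integral>\<omega>. u \<omega> y \<partial>M) \<longleftrightarrow> x < y"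
proof -
  have *: "(\<integral>\<omega>. u \<omega> x \<partial>M) < (\<integral>\<omega>. u \<omega> y \<partial>M)" if "x < y" for x y
    using that by (intro utility_integral_less[OF u, where A = "space M"]) (auto simp: prob_space)
  show ?thesis using *[of x y] *[of y x] by (cases x y rule: linorder_cases) auto
qed

lemma represented_time_consistent: "time_consistent M E"
  unfolding time_consistent_def Linf_sets_iff
proof (intro allI impI)
  fix G X assume G: "subsigma M G" and X: "bounded_measurable M X"
  have "bounded_measurable M (E G X)" by (rule bounded_measurable_sub[OF G E_bounded[OF G X]])
  then have "(\<integral>\<omega>. u \<omega> (E0 M E (E G X)) \<partial>M) = (\<integral>\<omega>. u \<omega> (E0 M E X) \<partial>M)"
    by (simp add: integral_E0 integral_E_space G X)
  then show "E0 M E (E G X) = E0 M E X" using integral_const_less_iff by (metis less_irrefl linorder_neqE)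
qed

lemma represented_pointwise_continuous: "pointwise_continuous M (E0 M E)"
  unfolding pointwise_continuous_def Linf_sets_iff
proof (intro allI impI)
  fix Xs :: "nat \<Rightarrow> 'a \<Rightarrow> real" and X
  assume Xs: "\<forall>n. bounded_measurable M (Xs n)" and X: "bounded_measurable M X"
    and "\<exists>C. \<forall>n. \<forall>\<omega>\<in>space M. \<bar>Xs n \<omega>\<bar> \<le> C" and "AE \<omega> in M. (\<lambda>n. Xs n \<omega>) \<longlonglongrightarrow> X \<omega>"
  then have "(\<lambda>n. \<integral>\<omega>. u \<omega> (Xs n \<omega>) \<partial>M) \<longlonglongrightarrow> (\<integral>\<omega>. u \<omega> (X \<omega>) \<partial>M)"
    by (elim exE) (rule utility_integral_tendsto[OF u], auto)
  then have lim: "(\<lambda>n. \<integral>\<omega>. u \<omega> (E0 M E (Xs n)) \<partial>M) \<longlonglongrightarrow> (\<integral>\<omega>. u \<omega> (E0 M E X) \<partial>M)"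
    using Xs X by (simp add: integral_E0)
  \<comment> \<open>No continuous inverse is invoked: a strict bound a on the limit becomes a strict
    bound on expected utilities, holds eventually there, and is translated back.\<close>
  show "(\<lambda>n. E0 M E (Xs n)) \<longlonglongrightarrow> E0 M E X"
  proof (rule order_tendstoI)
    fix a assume "a < E0 M E X"
    then show "\<forall>\<^sub>F n in sequentially. a < E0 M E (Xs n)"
      using order_tendstoD(1)[OF lim, of "\<integral>\<omega>. u \<omega> a \<partial>M"] by (simp add: integral_const_less_iff)
  next
    fix a assume "E0 M E X < a"
    then show "\<forall>\<^sub>F n in sequentially. E0 M E (Xs n) < a"
      using order_tendstoD(2)[OF lim, of "\<integral>\<omega>. u \<omega> a \<partial>M"] by (simp add: integral_const_less_iff)
  qed
qed

lemma represented_strictly_monotone: "strictly_monotone_dichotomic M (E0 M E)"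
  unfolding strictly_monotone_dichotomic_def Linf_sets_iff
proof (intro allI impI)
  fix x y :: real and Z A
  assume xy: "x < y" and Z: "bounded_measurable M Z" and A: "A \<in> sets M" "0 < measure M A"
  have bm: "bounded_measurable M (mix A (\<lambda>_. c) Z)" for c using Z A by (intro bounded_measurable_mix) auto
  have "(\<integral>\<omega>. u \<omega> (mix A (\<lambda>_. x) Z \<omega>) \<partial>M) < (\<integral>\<omega>. u \<omega> (mix A (\<lambda>_. y) Z \<omega>) \<partial>M)"
    using xy by (intro utility_integral_less[OF u bm bm _ A]) (auto simp: mix_def)
  then have "E0 M E (mix A (\<lambda>_. x) Z) < E0 M E (mix A (\<lambda>_. y) Z)"
    unfolding integral_E0[OF bm, symmetric] integral_const_less_iff .
  then show "E0 M E (\<lambda>\<omega>. x * indicator A \<omega> + Z \<omega> * indicator (space M - A) \<omega>)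
      < E0 M E (\<lambda>\<omega>. y * indicator A \<omega> + Z \<omega> * indicator (space M - A) \<omega>)"
    using E0_dichotomic[of "\<lambda>_. x" Z A] E0_dichotomic[of "\<lambda>_. y" Z A] Z A by simp
qed

text \<open>The test event is where Y1 < Y2, which lies in G; with positive probability it would
  make the two integrals differ, since u is strictly increasing.\<close>

lemma AE_le_if_integral_eq:
  assumes G: "subsigma M G" and Y: "bounded_measurable (sub M G) Y1" "bounded_measurable (sub M G) Y2"
    and eq: "\<And>B. B \<in> G \<Longrightarrow> (\<integral>\<omega>. u \<omega> (mix B Y1 (\<lambda>_. 0) \<omega>) \<partial>M) = (\<integral>\<omega>. u \<omega> (mix B Y2 (\<lambda>_. 0) \<omega>) \<partial>M)"
  shows "AE \<omega> in M. Y2 \<omega> \<le> Y1 \<omega>"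
proof -
  have [measurable]: "Y1 \<in> borel_measurable (sub M G)" "Y2 \<in> borel_measurable (sub M G)"
    using Y by (auto simp: bounded_measurable_def)
  define B where "B = {\<omega>\<in>space (sub M G). Y1 \<omega> < Y2 \<omega>}"
  have "B \<in> sets (sub M G)" unfolding B_def by measurable
  then have BG: "B \<in> G" by (simp add: sets_sub G)
  note BM = subsigmaD[OF G BG]
  have "\<not> 0 < measure M B"
  proof
    assume "0 < measure M B"
    then have "(\<integral>\<omega>. u \<omega> (mix B Y1 (\<lambda>_. 0) \<omega>) \<partial>M) < (\<integral>\<omega>. u \<omega> (mix B Y2 (\<lambda>_. 0) \<omega>) \<partial>M)"
      using BM Y by (intro utility_integral_less[OF u, where A = B] bounded_measurable_mix bounded_measurable_sub[OF G])
        (auto simp: mix_def B_def)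
    then show False using eq[OF BG] by simp
  qed
  then have "measure M B = 0" by (simp add: zero_less_measure_iff)
  then have "B \<in> null_sets M" using BM by (intro null_setsI) (simp_all add: emeasure_eq_measure)
  then show ?thesis by (rule AE_I') (auto simp: B_def)
qed

text \<open>For B in G, \<open>integral_E\<close> sends both candidates to the expected utility of X
  on A \<inter> B: one through the variable X 1_A and the event B, the other through X and the event
  A \<inter> B.\<close>

lemma represented_cond_nonlin_exp: "cond_nonlin_exp M E"
  unfolding cond_nonlin_exp_def Linf_sets_iff
proof (intro allI impI)
  fix G X A assume G: "subsigma M G" and X: "bounded_measurable M X" and A: "A \<in> G"
  note AM = subsigmaD[OF G A]
  let ?X = "mix A X (\<lambda>_. 0)" and ?Y = "mix A (E G X) (\<lambda>_. 0)"
  have X': "bounded_measurable M ?X" using X AM by (intro bounded_measurable_mix) auto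
  have Y: "bounded_measurable (sub M G) ?Y"
    using E_bounded[OF G X] A by (intro bounded_measurable_mix) (simp_all add: sets_sub G)
  have eq: "(\<integral>\<omega>. u \<omega> (mix B (E G ?X) (\<lambda>_. 0) \<omega>) \<partial>M) = (\<integral>\<omega>. u \<omega> (mix B ?Y (\<lambda>_. 0) \<omega>) \<partial>M)"
    if B: "B \<in> G" for B
  proof -
    have AB: "A \<inter> B \<in> G"
      using sets.Int[of A "sub M G" B] A B by (simp add: sets_sub G)
    have "mix B (mix A Z (\<lambda>_. 0)) (\<lambda>_. 0) = mix (A \<inter> B) Z (\<lambda>_. 0)" for Z by (auto simp: mix_def)
    then show ?thesis using integral_E[OF G X' B] integral_E[OF G X AB] by simp
  qed
  have "AE \<omega> in M. ?Y \<omega> \<le> E G ?X \<omega>" "AE \<omega> in M. E G ?X \<omega> \<le> ?Y \<omega>"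
    using AE_le_if_integral_eq[OF G E_bounded[OF G X'] Y] AE_le_if_integral_eq[OF G Y E_bounded[OF G X']] eq
    by simp_all
  then have "AE \<omega> in M. E G ?X \<omega> = ?Y \<omega>" by eventually_elim simp
  then show "AE \<omega> in M. E G (\<lambda>\<omega>. X \<omega> * indicator A \<omega>) \<omega> = E G X \<omega> * indicator A \<omega>"
    by (simp add: mix_zero_eq_indicator)
qed

end

end

theorem mainTheorem1:
  fixes M :: "'a measure"
    and E :: "'a set set \<Rightarrow> ('a \<Rightarrow> real) \<Rightarrow> 'a \<Rightarrow> real"
  assumes "prob_space M"
    and "nonatomic M"
    and E_maps: "\<And>G X. subsigma M G \<Longrightarrow> Linf M (sets M) X \<Longrightarrow> Linf M G (E G X)"
    and E_wd: "\<And>G X Y. subsigma M G \<Longrightarrow> Linf M (sets M) X \<Longrightarrow> Linf M (sets M) Y \<Longrightarrow>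
                 (AE \<omega> in M. X \<omega> = Y \<omega>) \<Longrightarrow> (AE \<omega> in M. E G X \<omega> = E G Y \<omega>)"
  shows "(cond_nonlin_exp M E \<and> time_consistent M E \<and>
          strictly_monotone_dichotomic M (E0 M E) \<and> pointwise_continuous M (E0 M E))
     \<longleftrightarrow>
     (\<exists>u. regular M (sets M) u \<and> (\<forall>x. integrable M (\<lambda>\<omega>. u \<omega> x)) \<and>
        (\<forall>G. subsigma M G \<longrightarrow>
          (\<exists>uG. regular M G uG \<and>
             (\<forall>x. integrable M (\<lambda>\<omega>. uG \<omega> x) \<and>
                  cond_exp_version M G (\<lambda>\<omega>. u \<omega> x) (\<lambda>\<omega>. uG \<omega> x)) \<and>
             (\<forall>X. Linf M (sets M) X \<longrightarrow>
                (\<exists>h. cond_exp_version M G (\<lambda>\<omega>. u \<omega> (X \<omega>)) h \<and>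
                     (\<forall>\<omega>\<in>space M. h \<omega> \<in> range (uG \<omega>)) \<and>
                     (AE \<omega> in M. E G X \<omega> = Phi uG \<omega> (h \<omega>)))))))"
proof -
  interpret prob_space M by fact
  interpret expectation_family M E
  proof
    show "nonatomic M" by fact
    show "bounded_measurable (sub M G) (E G X)" if "subsigma M G" "bounded_measurable M X" for G X
      using E_maps[OF that(1), of X] that by (simp add: Linf_iff Linf_sets_iff)
    show "AE \<omega> in M. E G X \<omega> = E G Y \<omega>"
      if "subsigma M G" "bounded_measurable M X" "bounded_measurable M Y" "AE \<omega> in M. X \<omega> = Y \<omega>" for G X Y
      using E_wd[OF that(1) _ _ that(4)] that by (simp add: Linf_sets_iff)
  qed
  have "(cond_nonlin_exp M E \<and> time_consistent M E \<and>
          strictly_monotone_dichotomic M (E0 M E) \<and> pointwise_continuous M (E0 M E))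
      \<longleftrightarrow> (\<exists>u. utility M u \<and> represented_by u)"
  proof
    assume "cond_nonlin_exp M E \<and> time_consistent M E \<and>
          strictly_monotone_dichotomic M (E0 M E) \<and> pointwise_continuous M (E0 M E)"
    then show "\<exists>u. utility M u \<and> represented_by u" by (intro representation) auto
  next
    assume "\<exists>u. utility M u \<and> represented_by u"
    then obtain u where u: "utility M u" "represented_by u" by (elim exE conjE)
    show "cond_nonlin_exp M E \<and> time_consistent M E \<and>
          strictly_monotone_dichotomic M (E0 M E) \<and> pointwise_continuous M (E0 M E)"
      by (intro conjI represented_cond_nonlin_exp[OF u] represented_time_consistent[OF u]
          represented_strictly_monotone[OF u] represented_pointwise_continuous[OF u])
  qed
  then show ?thesis unfolding utility_iff[of M] represented_by_def conj_assoc .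
qed

end
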